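(* There exist absolute constants $0<c<C$ such that for all integers $n,k$ with $1\le k\le n/2$, \[ c\, k^{-\delta}(1+\log k)^{-3/2} \le i(n,k) \le C\, k^{-\delta}(1+\log k)^{-3/2}, \] where $\delta = 1 - \frac{1+\log\log 2}{\log 2}$.
   Context: For integers $1\le k\le n$, $i(n,k)$ denotes the proportion of permutations $\pi$ of $\{1,\dots,n\}$ (i.e. of $\pi\in S_n$) having an invariant set of size $k$, i.e. a set $A\subset\{1,\dots,n\}$ with $|A|=k$ and $\pi(A)=A$. Logarithms are natural. *)

theory Defs
  imports Complex_Main "HOL-Combinatorics.Permutations"
begin

definition has_invariant_set :: "nat \<Rightarrow> (nat \<Rightarrow> nat) \<Rightarrow> nat \<Rightarrow> bool" where
  "has_invariant_set n p k \<longleftrightarrow> (\<exists>A. A \<subseteq> {1..n} \<and> card A = k \<and> p ` A = A)"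

definition inv_prop :: "nat \<Rightarrow> nat \<Rightarrow> real" where
  "inv_prop n k = real (card {p. p permutes {1..n} \<and> has_invariant_set n p k}) / fact n"

definition delta_const :: real where
  "delta_const = 1 - (1 + ln (ln 2)) / ln 2"

end

theory Submission
  imports Defs "HOL-Library.Multiset" "HOL-Library.Disjoint_Sets"
    "HOL-Computational_Algebra.Polynomial" "HOL-Analysis.Complex_Transcendental"
    "HOL-Analysis.Harmonic_Numbers" "HOL-Analysis.Convex"
begin

text \<open>
  The proportion \<open>inv_prop n k\<close> is a weighted sum over cycle types \<open>M\<close> with \<open>k \<in> subsums M\<close>, the
  weight of \<open>M\<close> being \<open>1 / \<Prod> x ^ c * c!\<close>. Singling out one cycle whose length is determined by the
  others shows that it has the order of \<open>1 / k\<^sup>2\<close> times the weighted sum of \<open>card (subsums M)\<close> over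
  the multisets \<open>M\<close> with parts at most \<open>k\<close>.

  Split the parts into \<open>J \<approx> log\<^sub>2 k\<close> dyadic blocks, each of harmonic mass about \<open>ln 2\<close>, and let
  \<open>b\<^sub>i\<close> be the number of parts in the \<open>i\<close>-th block. With \<open>h\<^sub>j = j - (b\<^sub>1 + \<dots> + b\<^sub>j)\<close> one has
  \<open>card (subsums M) \<le> 2 ^ (\<Sum>b\<^sub>i) * 2 powr h\<^sub>j\<close> up to a factor of bounded mean, for every \<open>j\<close>; choosing
  \<open>j\<close> where \<open>h\<close> is minimal splits the weighted sum into two ballot-type sums. Conversely, if \<open>h \<ge> 0\<close>
  throughout, a second moment bound shows that \<open>card (subsums M)\<close> is typically of order
  \<open>2 ^ (\<Sum>b\<^sub>i)\<close>. In both directions the ballot problem for the skip-free walk \<open>h\<close> with weights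
  \<open>1 / \<Prod> b\<^sub>i!\<close> is solved by the explicit first-passage weights \<open>h / L * L ^ (L - h) / (L - h)!\<close>,
  whose decay \<open>e ^ L * L powr (-3/2)\<close> is the source of the logarithmic factor, while
  \<open>2 powr (1 - delta_const) = e * ln 2\<close> produces the power of \<open>k\<close>.
\<close>

section \<open>Weighted sums over multisets\<close>

text \<open>By Cauchy's formula \<open>wt M\<close> is the share of the cycle type \<open>M\<close>.
  Over all multisets with parts at most \<open>k\<close> these weights add up to the exponential of
  a harmonic number, which is of order \<open>k\<close>. So one power in \<open>1 / k^2\<close> is
  this missing normalisation, and the other is the price of the marked part having the one right
  length.

  The plain first moment of \<open>2 ^ size M\<close> is too large: under the weights tilted by it a
  block has \<open>2 * ln 2 > 1\<close> parts on average, whereas the parts in the first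
  \<open>j\<close> blocks leave room for only about \<open>2 ^ j\<close> subset sums. The balance of
  the two bounds selects about \<open>J\<close> parts in \<open>J\<close> blocks, and asking for
  room at every scale keeps \<open>h\<close> on one side. Pinning a walk at both ends costs
  \<open>J powr (-1/2)\<close>; keeping it on one side as well makes this
  \<open>J powr (-3/2)\<close>. Such paths carry \<open>(2 * ln 2) ^ J\<close> from the tilt and
  \<open>exp J\<close> from the factorials, together about \<open>k * (e * ln 2) ^ J\<close>.

  The closed form of \<open>hits\<close> is \<open>e ^ L\<close> times the Borel-Tanner law, the
  hitting-time law for Poisson steps of mean 1.\<close>

definition wt :: "nat multiset \<Rightarrow> real" where
  "wt M = (\<Prod>x\<in>set_mset M. 1 / (real x ^ count M x * fact (count M x)))"

definition subsums :: "nat multiset \<Rightarrow> nat set" where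
  "subsums M = sum_mset ` {A. A \<subseteq># M}"

definition msets_sum :: "nat set \<Rightarrow> nat \<Rightarrow> nat multiset set" where
  "msets_sum A n = {M. set_mset M \<subseteq> A \<and> \<Sum>\<^sub># M = n}"

definition msets_sum_le :: "nat set \<Rightarrow> nat \<Rightarrow> nat multiset set" where
  "msets_sum_le A n = {M. set_mset M \<subseteq> A \<and> \<Sum>\<^sub># M \<le> n}"

definition msets_size :: "nat set \<Rightarrow> nat \<Rightarrow> nat multiset set" where
  "msets_size A b = {M. set_mset M \<subseteq> A \<and> size M = b}"

lemma wt_superset:
  assumes "finite S" "set_mset M \<subseteq> S"
  shows "wt M = (\<Prod>x\<in>S. 1 / (real x ^ count M x * fact (count M x)))"
  unfolding wt_def
  by (rule prod.mono_neutral_left) (use assms in \<open>auto simp: not_in_iff\<close>)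

lemma wt_empty [simp]: "wt {#} = 1"
  by (simp add: wt_def)

lemma wt_add_mset: "wt (add_mset x M) = wt M / (real x * real (count M x + 1))"
proof -
  define S where "S = insert x (set_mset M)"
  have S: "finite S" "set_mset M \<subseteq> S" "set_mset (add_mset x M) \<subseteq> S" "x \<in> S"
    by (auto simp: S_def)
  have "wt (add_mset x M) = 1 / (real x ^ (count M x + 1) * fact (count M x + 1)) *
      (\<Prod>y\<in>S-{x}. 1 / (real y ^ count M y * fact (count M y)))"
    unfolding wt_superset[OF S(1,3)] by (subst prod.remove[OF S(1,4)]) simp
  moreover have "wt M = 1 / (real x ^ (count M x) * fact (count M x)) *
      (\<Prod>y\<in>S-{x}. 1 / (real y ^ count M y * fact (count M y)))"
    unfolding wt_superset[OF S(1,2)] by (subst prod.remove[OF S(1,4)]) simp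
  ultimately show ?thesis by (simp add: field_simps)
qed

lemma wt_nonneg [simp]: "0 \<le> wt M"
  unfolding wt_def by (intro prod_nonneg) auto

lemma wt_union:
  assumes "set_mset M \<inter> set_mset N = {}"
  shows "wt (M + N) = wt M * wt N"
  using assms
proof (induction N)
  case (add x N)
  then have "count M x = 0" by (auto simp: not_in_iff)
  with add show ?case by (simp add: wt_add_mset)
qed simp

text \<open>Removing one copy of \<open>x\<close> from \<open>M\<close> multiplies
  \<open>wt M\<close> by exactly \<open>x * count M x\<close>. A sum over multisets with a marked
  part \<open>x\<close> is therefore a sum over what remains. All marking arguments below rest on
  this identity.\<close>

lemma sum_wt_marked:
  assumes "finite X" "0 < x"
  shows "(\<Sum>M\<in>X. wt M * (real (count M x) * real x) * f (M - {#x#})) =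
    (\<Sum>M\<in>{M. add_mset x M \<in> X}. wt M * f M)"
proof -
  have "(\<Sum>M\<in>X. wt M * (real (count M x) * real x) * f (M - {#x#})) =
    (\<Sum>M\<in>{M\<in>X. x \<in># M}. wt M * (real (count M x) * real x) * f (M - {#x#}))"
    by (rule sum.mono_neutral_right) (use assms in \<open>auto simp: not_in_iff\<close>)
  also have "\<dots> = (\<Sum>M\<in>{M. add_mset x M \<in> X}. wt M * f M)"
  proof (rule sum.reindex_bij_witness[of _ "add_mset x" "\<lambda>M. M - {#x#}"])
    fix M assume M: "M \<in> {M \<in> X. x \<in># M}"
    then have "M = add_mset x (M - {#x#})" by simp
    then obtain N where N: "M = add_mset x N" by blast
    show "wt (M - {#x#}) * f (M - {#x#}) = wt M * (real (count M x) * real x) * f (M - {#x#})"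
      unfolding N using assms by (simp add: wt_add_mset)
  qed auto
  finally show ?thesis .
qed

lemma finite_msets_size_le: "finite A \<Longrightarrow> finite {M. set_mset M \<subseteq> A \<and> size M \<le> n}"
proof -
  assume "finite A"
  then have "finite (mset ` {xs. set xs \<subseteq> A \<and> length xs \<le> n})"
    by (intro finite_imageI finite_lists_length_le)
  moreover have "{M. set_mset M \<subseteq> A \<and> size M \<le> n} \<subseteq> mset ` {xs. set xs \<subseteq> A \<and> length xs \<le> n}"
  proof
    fix M assume M: "M \<in> {M. set_mset M \<subseteq> A \<and> size M \<le> n}"
    obtain xs where "mset xs = M" using ex_mset by blast
    with M show "M \<in> mset ` {xs. set xs \<subseteq> A \<and> length xs \<le> n}"
      by (intro image_eqI[of _ _ xs]) auto
  qed
  ultimately show ?thesis by (rule rev_finite_subset)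
qed

lemma finite_msets_size [simp]: "finite A \<Longrightarrow> finite (msets_size A n)"
  unfolding msets_size_def by (rule finite_subset[OF _ finite_msets_size_le[of A n]]) auto

lemma member_le_sum_mset: "x \<in># M \<Longrightarrow> (x::nat) \<le> \<Sum>\<^sub># M"
  by (metis le_add1 multi_member_split sum_mset.add_mset)

lemma size_le_sum_mset: "0 \<notin># M \<Longrightarrow> size M \<le> \<Sum>\<^sub># (M :: nat multiset)"
  by (induction M) (auto simp: add_mono Suc_le_eq)

lemma finite_msets_sum_le [simp]: "0 \<notin> A \<Longrightarrow> finite (msets_sum_le A n)"
proof -
  assume A: "0 \<notin> A"
  have "msets_sum_le A n \<subseteq> {M. set_mset M \<subseteq> {1..n} \<and> size M \<le> n}"
  proof
    fix M assume M: "M \<in> msets_sum_le A n"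
    then have "0 \<notin># M" using A by (auto simp: msets_sum_le_def)
    moreover have "x \<in> {1..n}" if "x \<in># M" for x
    proof -
      have "x \<noteq> 0" using that \<open>0 \<notin># M\<close> by metis
      with member_le_sum_mset[OF that] M show ?thesis by (auto simp: msets_sum_le_def)
    qed
    ultimately show "M \<in> {M. set_mset M \<subseteq> {1..n} \<and> size M \<le> n}"
      using size_le_sum_mset[of M] M by (auto simp: msets_sum_le_def)
  qed
  then show ?thesis by (rule finite_subset) (rule finite_msets_size_le, simp)
qed

lemma msets_sum_subset: "m \<le> n \<Longrightarrow> msets_sum A m \<subseteq> msets_sum_le A n"
  by (auto simp: msets_sum_def msets_sum_le_def)

lemma finite_msets_sum [simp]: "0 \<notin> A \<Longrightarrow> finite (msets_sum A n)"
  by (rule finite_subset[OF msets_sum_subset[OF order_refl]]) simp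

lemma msets_sum_0: "0 \<notin> A \<Longrightarrow> msets_sum A 0 = {{#}}"
proof -
  assume A: "0 \<notin> A"
  have "M = {#}" if "set_mset M \<subseteq> A" "\<Sum>\<^sub># M = 0" for M
    using that A by (metis in_mono member_le_sum_mset le_zero_eq multiset_nonemptyE)
  then show ?thesis by (auto simp: msets_sum_def)
qed

lemma sum_mset_image_superset:
  fixes g :: "'a \<Rightarrow> real"
  assumes "finite S" "set_mset M \<subseteq> S"
  shows "\<Sum>\<^sub># (image_mset g M) = (\<Sum>x\<in>S. real (count M x) * g x)"
  using assms(2)
proof (induction M)
  case (add y M)
  have "(\<Sum>x\<in>S. real (count (add_mset y M) x) * g x) =
      (\<Sum>x\<in>S. real (count M x) * g x + (if x = y then g x else 0))"
    by (rule sum.cong) (auto simp: algebra_simps)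
  also have "\<dots> = (\<Sum>x\<in>S. real (count M x) * g x) + g y"
    using add.prems assms(1) by (simp add: sum.distrib)
  finally show ?case using add by simp
qed simp

lemma sum_mset_eq_sum_superset:
  assumes "finite S" "set_mset M \<subseteq> S"
  shows "real (\<Sum>\<^sub># M) = (\<Sum>x\<in>S. real (count M x) * real x)"
proof -
  have "real (\<Sum>\<^sub># M) = \<Sum>\<^sub># (image_mset real M)" by (induction M) auto
  also have "\<dots> = (\<Sum>x\<in>S. real (count M x) * real x)"
    by (rule sum_mset_image_superset[OF assms])
  finally show ?thesis .
qed

lemma size_eq_sum_superset:
  assumes "finite S" "set_mset M \<subseteq> S"
  shows "real (size M) = (\<Sum>x\<in>S. real (count M x))"
proof -
  have "real (size M) = \<Sum>\<^sub># (image_mset (\<lambda>_. 1) M)" by (induction M) auto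
  also have "\<dots> = (\<Sum>x\<in>S. real (count M x) * 1)"
    by (rule sum_mset_image_superset[OF assms])
  finally show ?thesis by simp
qed

lemma sum_wt_marked_all:
  assumes "0 \<notin> A"
  shows "(\<Sum>M\<in>msets_sum A n. wt M * (\<Sum>x\<in>{x\<in>A. x \<le> n}. real (count M x) * real x * f x (M - {#x#}))) =
    (\<Sum>x\<in>{x\<in>A. x \<le> n}. \<Sum>M\<in>msets_sum A (n - x). wt M * f x M)"
proof -
  have "(\<Sum>M\<in>msets_sum A n. wt M * (\<Sum>x\<in>{x\<in>A. x \<le> n}. real (count M x) * real x * f x (M - {#x#}))) =
    (\<Sum>x\<in>{x\<in>A. x \<le> n}. \<Sum>M\<in>msets_sum A n. wt M * (real (count M x) * real x) * f x (M - {#x#}))"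
    by (simp add: sum_distrib_left mult.assoc) (rule sum.swap)
  also have "\<dots> = (\<Sum>x\<in>{x\<in>A. x \<le> n}. \<Sum>M\<in>msets_sum A (n - x). wt M * f x M)"
  proof (rule sum.cong[OF refl])
    fix x assume x: "x \<in> {x\<in>A. x \<le> n}"
    with assms have "0 < x" by (auto intro: gr0I)
    moreover have "{M. add_mset x M \<in> msets_sum A n} = msets_sum A (n - x)"
      using x by (auto simp: msets_sum_def)
    ultimately show "(\<Sum>M\<in>msets_sum A n. wt M * (real (count M x) * real x) * f x (M - {#x#})) =
        (\<Sum>M\<in>msets_sum A (n - x). wt M * f x M)"
      using sum_wt_marked[of "msets_sum A n" x "f x"] assms by simp
  qed
  finally show ?thesis .
qed

text \<open>Since \<open>n\<close> is the sum of all \<open>count M x * x\<close>, multiplying by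
  \<open>n\<close> marks a part in proportion to its length; the marked part is then
  removed.\<close>

lemma sum_wt_recursion:
  assumes "0 \<notin> A"
  shows "real n * (\<Sum>M\<in>msets_sum A n. wt M * f M) =
    (\<Sum>x\<in>{x\<in>A. x \<le> n}. \<Sum>M\<in>msets_sum A (n - x). wt M * f (add_mset x M))"
proof -
  have fin: "finite {x\<in>A. x \<le> n}" by (rule finite_subset[of _ "{..n}"]) auto
  have "real n * (\<Sum>M\<in>msets_sum A n. wt M * f M) =
    (\<Sum>M\<in>msets_sum A n. wt M * (\<Sum>x\<in>{x\<in>A. x \<le> n}. real (count M x) * real x * f (add_mset x (M - {#x#}))))"
  proof (subst sum_distrib_left, rule sum.cong[OF refl])
    fix M assume M: "M \<in> msets_sum A n"
    have "set_mset M \<subseteq> {x\<in>A. x \<le> n}"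
      using M member_le_sum_mset by (auto simp: msets_sum_def)
    moreover have "\<Sum>\<^sub># M = n" using M by (simp add: msets_sum_def)
    ultimately have n: "real n = (\<Sum>x\<in>{x\<in>A. x \<le> n}. real (count M x) * real x)"
      using sum_mset_eq_sum_superset[OF fin, of M] by simp
    have "real n * (wt M * f M) = wt M * (\<Sum>x\<in>{x\<in>A. x \<le> n}. real (count M x) * real x * f M)"
      by (subst n) (simp add: sum_distrib_left sum_distrib_right mult_ac)
    also have "(\<Sum>x\<in>{x\<in>A. x \<le> n}. real (count M x) * real x * f M) =
        (\<Sum>x\<in>{x\<in>A. x \<le> n}. real (count M x) * real x * f (add_mset x (M - {#x#})))"
      by (rule sum.cong[OF refl]) (metis count_inI insert_DiffM mult_zero_left of_nat_0)
    finally show "real n * (wt M * f M) =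
      wt M * (\<Sum>x\<in>{x\<in>A. x \<le> n}. real (count M x) * real x * f (add_mset x (M - {#x#})))"
      by (simp add: mult_ac sum_distrib_left)
  qed
  also have "\<dots> = (\<Sum>x\<in>{x\<in>A. x \<le> n}. \<Sum>M\<in>msets_sum A (n - x). wt M * f (add_mset x M))"
    by (rule sum_wt_marked_all[OF assms, where f = "\<lambda>x M. f (add_mset x M)"])
  finally show ?thesis .
qed

section \<open>Subset sums of a multiset\<close>

lemma subsums_empty [simp]: "subsums {#} = {0}"
  by (simp add: subsums_def)

lemma subsums_add_mset: "subsums (add_mset x M) = subsums M \<union> (\<lambda>l. x + l) ` subsums M"
proof -
  have "{A. A \<subseteq># add_mset x M} = {A. A \<subseteq># M} \<union> add_mset x ` {A. A \<subseteq># M}" (is "?L = ?R")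
  proof
    show "?L \<subseteq> ?R"
    proof
      fix A assume A: "A \<in> ?L"
      show "A \<in> ?R"
      proof (cases "x \<in># A")
        case True
        then obtain B where "A = add_mset x B" by (meson multi_member_split)
        with A show ?thesis by auto
      next
        case False
        then have "A - {#x#} = A" by (rule diff_single_trivial)
        moreover have "A - {#x#} \<subseteq># M" using A by (simp add: subset_eq_diff_conv)
        ultimately have "A \<subseteq># M" by simp
        then show ?thesis by simp
      qed
    qed
    show "?R \<subseteq> ?L"
    proof -
      have "M \<subseteq># add_mset x M" by simp
      then have "A \<subseteq># add_mset x M" if "A \<subseteq># M" for A
        using that by (rule subset_mset.order_trans[rotated])
      then show ?thesis by auto
    qed
  qed
  then show ?thesis by (force simp: subsums_def image_Un image_image)
qed

lemma finite_subsums [simp]: "finite (subsums M)"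
  by (induction M) (auto simp: subsums_add_mset)

lemma subsums_le: "l \<in> subsums M \<Longrightarrow> l \<le> \<Sum>\<^sub># M"
  by (induction M arbitrary: l) (auto simp: subsums_add_mset trans_le_add2)

lemma sum_in_subsums: "A \<subseteq># M \<Longrightarrow> \<Sum>\<^sub># A \<in> subsums M"
  unfolding subsums_def by auto

lemma card_subsums_le_sum: "card (subsums M) \<le> 1 + \<Sum>\<^sub># M"
proof -
  have "card (subsums M) \<le> card {..\<Sum>\<^sub># M}"
    by (rule card_mono) (auto intro: subsums_le)
  then show ?thesis by simp
qed

lemma card_subsums_add_mset: "card (subsums (add_mset x M)) \<le> 2 * card (subsums M)"
proof -
  have "card (subsums (add_mset x M)) \<le> card (subsums M) + card ((\<lambda>l. x + l) ` subsums M)"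
    unfolding subsums_add_mset by (rule card_Un_le)
  also have "card ((\<lambda>l. x + l) ` subsums M) \<le> card (subsums M)"
    by (rule card_image_le) simp
  finally show ?thesis by simp
qed

lemma card_subsums_union: "card (subsums (M + N)) \<le> 2 ^ size N * card (subsums M)"
proof (induction N)
  case (add x N)
  have "card (subsums (M + add_mset x N)) \<le> 2 * card (subsums (M + N))"
    using card_subsums_add_mset[of x "M + N"] by simp
  with add show ?case by simp
qed simp

section \<open>Cycle types of permutations\<close>

definition block_sizes :: "nat set set \<Rightarrow> nat multiset" where
  "block_sizes P = image_mset card (mset_set P)"

text \<open>Composing with the transposition inserts the new point \<open>a\<close> into the cycle
  of \<open>b\<close>, directly before \<open>b\<close>. An invariant set contains both points or
  neither, and deleting \<open>a\<close> leaves a set invariant under \<open>p\<close>.\<close>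

lemma invariant_transpose_comp_iff:
  assumes p: "p permutes S" and a: "a \<notin> S" and b: "b \<in> S"
  shows "(Transposition.transpose a b \<circ> p) ` A = A \<longleftrightarrow> (a \<in> A \<longleftrightarrow> b \<in> A) \<and> p ` (A - {a}) = A - {a}"
proof -
  have pa: "p a = a" using p a by (simp add: permutes_not_in)
  have inj: "inj p" using p by (rule permutes_inj)
  have tau: "Transposition.transpose a b ` B = B \<longleftrightarrow> (a \<in> B \<longleftrightarrow> b \<in> B)" for B
    by (metis transpose_image_eq transpose_apply_first transpose_apply_second image_eqI)
  have tt: "Transposition.transpose a b ` Transposition.transpose a b ` B = B" for B
    by (simp add: image_comp)
  have *: "(Transposition.transpose a b \<circ> p) ` A = A \<longleftrightarrow> p ` A = Transposition.transpose a b ` A"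
    by (metis image_comp tt)
  have pA: "a \<in> p ` A \<longleftrightarrow> a \<in> A" using pa inj by (metis image_eqI imageE inj_eq)
  have tA: "a \<in> Transposition.transpose a b ` A \<longleftrightarrow> b \<in> A"
    by (metis transpose_apply_second image_eqI imageE transpose_involutory)
  have p1: "p ` (A - {a}) = p ` A - {a}" using image_set_diff[OF inj, of A "{a}"] pa by simp
  show ?thesis unfolding * p1
  proof
    assume e: "p ` A = Transposition.transpose a b ` A"
    then have "a \<in> A \<longleftrightarrow> b \<in> A" using pA tA by metis
    with tau[of A] e show "(a \<in> A \<longleftrightarrow> b \<in> A) \<and> p ` A - {a} = A - {a}" by metis
  next
    assume e: "(a \<in> A \<longleftrightarrow> b \<in> A) \<and> p ` A - {a} = A - {a}"
    then have "p ` A = A" using pA by (metis Diff_empty Diff_insert0 insert_Diff)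
    with e tau[of A] show "p ` A = Transposition.transpose a b ` A" by metis
  qed
qed

text \<open>The same insertion seen on blocks: only the block of \<open>b\<close> grows. The third
  claim matches the criterion of \<open>invariant_transpose_comp_iff\<close> clause by
  clause.\<close>

lemma insert_into_partition:
  assumes P: "partition_on S P" and fin: "finite S" and a: "a \<notin> S" and b: "b \<in> S" "b \<in> B" "B \<in> P"
  defines "\<phi> \<equiv> \<lambda>C. if b \<in> C then insert a C else C"
  shows "partition_on (insert a S) (\<phi> ` P)"
    and "block_sizes (\<phi> ` P) = add_mset (Suc (card B)) (block_sizes P - {#card B#})"
    and "A \<subseteq> insert a S \<Longrightarrow> (\<exists>Q\<subseteq>\<phi> ` P. A = \<Union>Q) \<longleftrightarrow> (a \<in> A \<longleftrightarrow> b \<in> A) \<and> (\<exists>Q\<subseteq>P. A - {a} = \<Union>Q)"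
proof -
  have U: "\<Union>P = S" and disj: "disjoint P" and ne: "{} \<notin> P" using P by (auto simp: partition_on_def)
  have aC: "a \<notin> C" if "C \<in> P" for C using U that a by auto
  have ab: "a \<noteq> b" using a b by auto
  have uniq: "C = B" if "C \<in> P" "b \<in> C" for C
    using disj that b by (auto simp: disjoint_def)
  have inj: "inj_on \<phi> P"
  proof (rule inj_onI)
    fix C D assume CD: "C \<in> P" "D \<in> P" "\<phi> C = \<phi> D"
    then have "\<phi> C - {a} = \<phi> D - {a}" by simp
    moreover have "\<phi> E - {a} = E" if "E \<in> P" for E using aC[OF that] by (auto simp: \<phi>_def)
    ultimately show "C = D" using CD by metis
  qed
  show "partition_on (insert a S) (\<phi> ` P)"
  proof (rule partition_onI)
    show "\<Union>(\<phi> ` P) = insert a S"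
      using U b by (auto simp: \<phi>_def split: if_splits)
    fix C D assume "C \<in> \<phi> ` P" "D \<in> \<phi> ` P" "C \<noteq> D"
    then obtain C' D' where CD: "C = \<phi> C'" "D = \<phi> D'" "C' \<in> P" "D' \<in> P" "C' \<noteq> D'" by auto
    then have "C' \<inter> D' = {}" using disj by (auto simp: disjoint_def)
    moreover have "a \<notin> C'" "a \<notin> D'" using aC CD by auto
    ultimately show "disjnt C D" using CD uniq[of C'] uniq[of D'] by (auto simp: \<phi>_def disjnt_def)
  next
    show "{} \<notin> \<phi> ` P" using ne by (auto simp: \<phi>_def)
  qed
  have finP: "finite P" using P fin by (rule finite_elements[rotated])
  have finB: "finite B" using U b fin by (metis Union_upper finite_subset)
  have bs: "block_sizes P = add_mset (card B) (image_mset card (mset_set (P - {B})))"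
    unfolding block_sizes_def using mset_set.remove[OF finP b(3)] by simp
  have "block_sizes (\<phi> ` P) = image_mset (\<lambda>C. card (\<phi> C)) (mset_set P)"
    unfolding block_sizes_def by (simp add: image_mset_mset_set[OF inj, symmetric] multiset.map_comp comp_def)
  also have "\<dots> = add_mset (card (\<phi> B)) (image_mset (\<lambda>C. card (\<phi> C)) (mset_set (P - {B})))"
    using mset_set.remove[OF finP b(3)] by simp
  also have "image_mset (\<lambda>C. card (\<phi> C)) (mset_set (P - {B})) = image_mset card (mset_set (P - {B}))"
    by (rule image_mset_cong) (use uniq finP in \<open>auto simp: \<phi>_def\<close>)
  also have "card (\<phi> B) = Suc (card B)" using aC[OF b(3)] finB b by (simp add: \<phi>_def)
  finally show "block_sizes (\<phi> ` P) = add_mset (Suc (card B)) (block_sizes P - {#card B#})"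
    unfolding bs by simp
  have \<phi>U: "\<Union>(\<phi> ` Q) = \<Union>Q \<union> (if b \<in> \<Union>Q then {a} else {})" for Q
    by (auto simp: \<phi>_def split: if_splits)
  assume "A \<subseteq> insert a S"
  show "(\<exists>Q\<subseteq>\<phi> ` P. A = \<Union>Q) \<longleftrightarrow> (a \<in> A \<longleftrightarrow> b \<in> A) \<and> (\<exists>Q\<subseteq>P. A - {a} = \<Union>Q)" (is "?l \<longleftrightarrow> ?r")
  proof
    assume ?l
    then obtain Q where Q: "Q \<subseteq> P" "A = \<Union>(\<phi> ` Q)" by (metis subset_image_iff)
    have "a \<notin> \<Union>Q" using Q aC by auto
    moreover have AQ: "A = \<Union>Q \<union> (if b \<in> \<Union>Q then {a} else {})" unfolding Q(2) by (rule \<phi>U)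
    ultimately have "A - {a} = \<Union>Q" by (simp split: if_splits)
    moreover have "a \<in> A \<longleftrightarrow> b \<in> A"
      using \<open>a \<notin> \<Union>Q\<close> ab unfolding AQ by (simp split: if_splits)
    ultimately show ?r using Q by blast
  next
    assume ?r
    then obtain Q where Q: "Q \<subseteq> P" "A - {a} = \<Union>Q" "a \<in> A \<longleftrightarrow> b \<in> A" by metis
    have "\<Union>(\<phi> ` Q) = A" unfolding \<phi>U Q(2)[symmetric] using Q(3) ab by (auto simp: insert_absorb)
    then show ?l using Q by (intro exI[of _ "\<phi> ` Q"]) auto
  qed
qed

lemma partition_on_insert_singleton:
  assumes P: "partition_on S P" and fin: "finite S" and a: "a \<notin> S"
  shows "partition_on (insert a S) (insert {a} P)"
    and "block_sizes (insert {a} P) = add_mset 1 (block_sizes P)"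
    and "A \<subseteq> insert a S \<Longrightarrow> (\<exists>Q\<subseteq>insert {a} P. A = \<Union>Q) \<longleftrightarrow> (\<exists>Q\<subseteq>P. A - {a} = \<Union>Q)"
proof -
  have U: "\<Union>P = S" using P by (auto simp: partition_on_def)
  have aP: "{a} \<notin> P" using U a by auto
  have finP: "finite P" using P fin by (rule finite_elements[rotated])
  show "partition_on (insert a S) (insert {a} P)"
    using P a by (auto simp: partition_on_def disjoint_def)
  show "block_sizes (insert {a} P) = add_mset 1 (block_sizes P)"
    using aP finP by (simp add: block_sizes_def)
  assume A: "A \<subseteq> insert a S"
  show "(\<exists>Q\<subseteq>insert {a} P. A = \<Union>Q) \<longleftrightarrow> (\<exists>Q\<subseteq>P. A - {a} = \<Union>Q)" (is "?l \<longleftrightarrow> ?r")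
  proof
    assume ?l
    then obtain Q where Q: "Q \<subseteq> insert {a} P" "A = \<Union>Q" by blast
    have "a \<notin> C" if "C \<in> Q - {{a}}" for C using that Q(1) U a by blast
    then have "A - {a} = \<Union>(Q - {{a}})" unfolding Q(2) by blast
    then show ?r using Q by (intro exI[of _ "Q - {{a}}"]) auto
  next
    assume ?r
    then obtain Q where Q: "Q \<subseteq> P" "A - {a} = \<Union>Q" by metis
    show ?l
    proof (cases "a \<in> A")
      case True
      then have "A = \<Union>(insert {a} Q)" unfolding Union_insert Q(2)[symmetric] by blast
      then show ?thesis using Q by (intro exI[of _ "insert {a} Q"]) auto
    next
      case False
      then have "A = \<Union>Q" unfolding Q(2)[symmetric] by blast
      then show ?thesis using Q by blast
    qed
  qed
qed

text \<open>A block of size \<open>x\<close> is counted once for each of its elements. This produces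
  the factor \<open>count * x\<close> that marking a part requires.\<close>

lemma sum_over_blocks:
  fixes g :: "nat \<Rightarrow> real"
  assumes P: "partition_on S P" and fin: "finite S" and N: "card S \<le> N"
    and G: "\<And>b B. b \<in> B \<Longrightarrow> B \<in> P \<Longrightarrow> G b = g (card B)"
  shows "(\<Sum>b\<in>S. G b) = (\<Sum>x\<in>{1..N}. real (count (block_sizes P) x) * real x * g x)"
proof -
  have U: "\<Union>P = S" and ne: "{} \<notin> P" and disj: "disjoint P" using P by (auto simp: partition_on_def)
  have finP: "finite P" using P fin by (rule finite_elements[rotated])
  have finB: "finite B" if "B \<in> P" for B using U fin that by (metis Union_upper finite_subset)
  have "(\<Sum>b\<in>S. G b) = (\<Sum>B\<in>P. \<Sum>b\<in>B. G b)"
    unfolding U[symmetric] by (subst sum.Union_disjoint) (use finB disj in \<open>auto simp: disjoint_def\<close>)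
  also have "\<dots> = (\<Sum>B\<in>P. real (card B) * g (card B))"
    by (rule sum.cong[OF refl]) (simp add: G)
  also have "\<dots> = \<Sum>\<^sub># (image_mset (\<lambda>x. real x * g x) (block_sizes P))"
    by (simp add: block_sizes_def multiset.map_comp comp_def sum_unfold_sum_mset)
  also have "\<dots> = (\<Sum>x\<in>{1..N}. real (count (block_sizes P) x) * (real x * g x))"
  proof (rule sum_mset_image_superset)
    show "set_mset (block_sizes P) \<subseteq> {1..N}"
    proof
      fix x assume "x \<in># block_sizes P"
      then obtain B where B: "B \<in> P" "x = card B" using finP by (auto simp: block_sizes_def)
      have "B \<noteq> {}" using B ne by auto
      then have "card B \<ge> 1" using finB[OF B(1)] by (simp add: Suc_le_eq card_gt_0_iff)
      moreover have "card B \<le> card S" using B U fin by (intro card_mono) auto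
      ultimately show "x \<in> {1..N}" using B N by simp
    qed
  qed simp
  finally show ?thesis by (simp add: mult.assoc)
qed

text \<open>This determines \<open>P p\<close> as the partition into cycles through its invariant
  sets alone, so that cycles need no definition of their own.\<close>

definition generates_invariant_sets :: "nat set \<Rightarrow> ((nat \<Rightarrow> nat) \<Rightarrow> nat set set) \<Rightarrow> bool" where
  "generates_invariant_sets S P \<longleftrightarrow>
    (\<forall>p. p permutes S \<longrightarrow> partition_on S (P p) \<and> (\<forall>A\<subseteq>S. p ` A = A \<longleftrightarrow> (\<exists>Q\<subseteq>P p. A = \<Union>Q)))"

lemma generates_invariant_setsD:
  assumes "generates_invariant_sets S P" "p permutes S"
  shows "partition_on S (P p)" "A \<subseteq> S \<Longrightarrow> p ` A = A \<longleftrightarrow> (\<exists>Q\<subseteq>P p. A = \<Union>Q)"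
  using assms by (simp_all add: generates_invariant_sets_def)

text \<open>Cauchy's formula for cycle types, tested against an arbitrary \<open>f\<close>. A
  permutation of \<open>insert a S\<close> comes from a unique pair of a permutation of
  \<open>S\<close> and an image \<open>b\<close> of \<open>a\<close>: either \<open>b = a\<close>
  opens a new block, or the block of \<open>b\<close> grows by one. On the side of the weights, this
  is \<open>sum_wt_recursion\<close> one step further.\<close>

lemma invariant_partition_exists:
  fixes S :: "nat set"
  assumes "finite S"
  shows "\<exists>P. generates_invariant_sets S P \<and>
    (\<forall>f :: nat multiset \<Rightarrow> real. (\<Sum>p\<in>{p. p permutes S}. f (block_sizes (P p))) =
      fact (card S) * (\<Sum>M\<in>msets_sum {1..} (card S). wt M * f M))"
  using assms
proof (induction S rule: finite_induct)
  case empty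
  have "{p. p permutes {}} = {id}" by auto
  moreover have "msets_sum {1..} 0 = {{#}}" by (rule msets_sum_0) simp
  ultimately show ?case
    by (intro exI[of _ "\<lambda>_. {}"]) (auto simp: partition_on_def block_sizes_def generates_invariant_sets_def)
next
  case (insert a S)
  define n where "n = card S"
  obtain P where P: "generates_invariant_sets S P"
    and P3: "\<And>f :: nat multiset \<Rightarrow> real. (\<Sum>p\<in>{p. p permutes S}. f (block_sizes (P p))) =
      fact n * (\<Sum>M\<in>msets_sum {1..} n. wt M * f M)"
    using insert.IH unfolding n_def by blast
  note P1 = generates_invariant_setsD(1)[OF P] and P2 = generates_invariant_setsD(2)[OF P]
  \<comment> \<open>The pair is recovered from \<open>p'\<close>: \<open>b\<close> is the image of
    \<open>a\<close>, and composing with the transposition again undoes the insertion.\<close>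
  define P' where "P' = (\<lambda>p'. let b = p' a; p = Transposition.transpose a b \<circ> p' in
    if b = a then insert {a} (P p) else (\<lambda>C. if b \<in> C then insert a C else C) ` P p)"
  have dec: "(Transposition.transpose a b \<circ> p) a = b" "Transposition.transpose a b \<circ> (Transposition.transpose a b \<circ> p) = p" if "p permutes S" for b p
    using that insert.hyps(2) by (auto simp: permutes_not_in fun_eq_iff)
  have P'a: "P' (Transposition.transpose a a \<circ> p) = insert {a} (P p)" if "p permutes S" for p
    using dec[OF that, of a] by (simp add: P'_def)
  have P'b: "P' (Transposition.transpose a b \<circ> p) = (\<lambda>C. if b \<in> C then insert a C else C) ` P p"
    if "p permutes S" "b \<in> S" for p b
  proof -
    have "b \<noteq> a" using that insert.hyps by auto
    with dec[OF that(1), of b] show ?thesis by (simp add: P'_def Let_def)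
  qed
  have block: "\<exists>B. b \<in> B \<and> B \<in> P p" if "p permutes S" "b \<in> S" for b p
    using P1[OF that(1)] that(2) by (auto simp: partition_on_def)
  have *: "partition_on (insert a S) (P' p')" "(\<forall>A\<subseteq>insert a S. p' ` A = A \<longleftrightarrow> (\<exists>Q\<subseteq>P' p'. A = \<Union>Q))"
    if p': "p' permutes insert a S" for p'
  proof -
    have "p' \<in> (\<lambda>(b, p). Transposition.transpose a b \<circ> p) ` {(b, p). b \<in> insert a S \<and> p \<in> {p. p permutes S}}"
      using p' unfolding permutes_insert[symmetric] by simp
    then obtain b p where p: "p' = Transposition.transpose a b \<circ> p" "b \<in> insert a S" "p permutes S"
      by (auto simp del: insert_iff)
    note P1 = P1[OF p(3)] and P2 = P2[OF p(3)]
    have "partition_on (insert a S) (P' p') \<and> (\<forall>A\<subseteq>insert a S. p' ` A = A \<longleftrightarrow> (\<exists>Q\<subseteq>P' p'. A = \<Union>Q))"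
    proof (cases "b = a")
      case True
      note pa = P'a[OF p(3)]
      have pa': "p a = a" using p(3) insert.hyps by (simp add: permutes_not_in)
      have inv: "p ` A = A \<longleftrightarrow> p ` (A - {a}) = A - {a}" for A
      proof -
        have "p ` (A - {a}) = p ` A - {a}"
          using image_set_diff[OF permutes_inj[OF p(3)], of A "{a}"] pa' by simp
        moreover have "a \<in> p ` A \<longleftrightarrow> a \<in> A"
          using pa' permutes_inj[OF p(3)] by (metis image_eqI imageE inj_eq)
        ultimately show ?thesis by (metis Diff_empty Diff_insert0 insert_Diff)
      qed
      have "p' ` A = A \<longleftrightarrow> (\<exists>Q\<subseteq>P' p'. A = \<Union>Q)" if "A \<subseteq> insert a S" for A
      proof -
        have sub: "A - {a} \<subseteq> S" using that by auto
        have "p' ` A = A \<longleftrightarrow> p ` A = A" unfolding p(1) True by simp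
        also have "\<dots> \<longleftrightarrow> (\<exists>Q\<subseteq>P p. A - {a} = \<Union>Q)" unfolding inv[of A] by (rule P2[OF sub])
        also have "\<dots> \<longleftrightarrow> (\<exists>Q\<subseteq>insert {a} (P p). A = \<Union>Q)"
          by (rule partition_on_insert_singleton(3)[OF P1 insert.hyps that, symmetric])
        finally show ?thesis unfolding p(1) True pa .
      qed
      with partition_on_insert_singleton(1)[OF P1 insert.hyps] show ?thesis
        unfolding p(1) True pa by blast
    next
      case False
      then have b: "b \<in> S" using p by simp
      obtain B where B: "b \<in> B" "B \<in> P p" using block[OF p(3) b] by blast
      have "p' ` A = A \<longleftrightarrow> (\<exists>Q\<subseteq>P' p'. A = \<Union>Q)" if "A \<subseteq> insert a S" for A
      proof -
        have "A - {a} \<subseteq> S" using that by auto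
        then show ?thesis
          unfolding p(1) P'b[OF p(3) b] insert_into_partition(3)[OF P1 insert.hyps b B that]
            invariant_transpose_comp_iff[OF p(3) insert.hyps(2) b] by (simp add: P2)
      qed
      with insert_into_partition(1)[OF P1 insert.hyps b B] show ?thesis
        unfolding p(1) P'b[OF p(3) b] by blast
    qed
    then show "partition_on (insert a S) (P' p')" "(\<forall>A\<subseteq>insert a S. p' ` A = A \<longleftrightarrow> (\<exists>Q\<subseteq>P' p'. A = \<Union>Q))"
      by auto
  qed
  have sum_eq: "(\<Sum>p\<in>{p. p permutes insert a S}. f (block_sizes (P' p))) =
      fact (Suc n) * (\<Sum>M\<in>msets_sum {1..} (Suc n). wt M * f M)" for f :: "nat multiset \<Rightarrow> real"
  proof -
    \<comment> \<open>The possible images of \<open>a\<close> in one expression: \<open>a\<close> is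
      a new fixed point, or a block of length \<open>x\<close> is prolonged, for which there are
      \<open>count M x * x\<close> choices.\<close>
    define ff where "ff = (\<lambda>M. f (add_mset 1 M) +
      (\<Sum>x\<in>{1..n}. real (count M x) * real x * f (add_mset (Suc x) (M - {#x#}))))"
    have "(\<Sum>p\<in>{p. p permutes insert a S}. f (block_sizes (P' p))) =
      (\<Sum>b\<in>insert a S. \<Sum>p\<in>{p. p permutes S}. f (block_sizes (P' (Transposition.transpose a b \<circ> p))))"
      by (rule sum_over_permutations_insert[OF insert.hyps])
    also have "\<dots> = (\<Sum>p\<in>{p. p permutes S}. \<Sum>b\<in>insert a S. f (block_sizes (P' (Transposition.transpose a b \<circ> p))))"
      by (rule sum.swap)
    also have "\<dots> = (\<Sum>p\<in>{p. p permutes S}. ff (block_sizes (P p)))"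
    proof (rule sum.cong[OF refl])
      fix p assume "p \<in> {p. p permutes S}"
      then have p: "p permutes S" by simp
      have "(\<Sum>b\<in>S. f (block_sizes (P' (Transposition.transpose a b \<circ> p)))) =
        (\<Sum>x\<in>{1..n}. real (count (block_sizes (P p)) x) * real x * f (add_mset (Suc x) (block_sizes (P p) - {#x#})))"
      proof (rule sum_over_blocks[OF P1[OF p] insert.hyps(1)])
        fix b B assume bB: "b \<in> B" "B \<in> P p"
        then have b: "b \<in> S" using P1[OF p] by (auto simp: partition_on_def)
        show "f (block_sizes (P' (Transposition.transpose a b \<circ> p))) =
          f (add_mset (Suc (card B)) (block_sizes (P p) - {#card B#}))"
          unfolding P'b[OF p b] using insert_into_partition(2)[OF P1[OF p] insert.hyps b bB] by simp
      qed (simp add: n_def)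
      moreover have "block_sizes (P' (Transposition.transpose a a \<circ> p)) = add_mset 1 (block_sizes (P p))"
        unfolding P'a[OF p] by (rule partition_on_insert_singleton(2)[OF P1[OF p] insert.hyps])
      ultimately show "(\<Sum>b\<in>insert a S. f (block_sizes (P' (Transposition.transpose a b \<circ> p)))) = ff (block_sizes (P p))"
        unfolding ff_def using insert.hyps by simp
    qed
    also have "\<dots> = fact n * (\<Sum>M\<in>msets_sum {1..} n. wt M * ff M)" by (rule P3)
    also have "(\<Sum>M\<in>msets_sum {1..} n. wt M * ff M) = real (Suc n) * (\<Sum>M\<in>msets_sum {1..} (Suc n). wt M * f M)"
    proof -
      have e: "{x \<in> {1..}. x \<le> m} = {1..m}" for m :: nat by auto
      have "(\<Sum>M\<in>msets_sum {1..} n. wt M * ff M) = (\<Sum>M\<in>msets_sum {1..} n. wt M * f (add_mset 1 M)) +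
        (\<Sum>M\<in>msets_sum {1..} n. wt M * (\<Sum>x\<in>{1..n}. real (count M x) * real x * f (add_mset (Suc x) (M - {#x#}))))"
        unfolding ff_def by (simp add: distrib_left sum.distrib)
      also have "(\<Sum>M\<in>msets_sum {1..} n. wt M * (\<Sum>x\<in>{1..n}. real (count M x) * real x * f (add_mset (Suc x) (M - {#x#})))) =
        (\<Sum>x\<in>{1..n}. \<Sum>M\<in>msets_sum {1..} (n - x). wt M * f (add_mset (Suc x) M))"
        using sum_wt_marked_all[where A = "{1..}" and n = n and f = "\<lambda>x M. f (add_mset (Suc x) M)"] unfolding e by simp
      \<comment> \<open>A prolonged block has length at least 2. The new fixed point supplies the
        missing term \<open>x = 1\<close> of the recursion at \<open>Suc n\<close>.\<close>
      also have "\<dots> = (\<Sum>x\<in>{2..Suc n}. \<Sum>M\<in>msets_sum {1..} (Suc n - x). wt M * f (add_mset x M))"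
        by (rule sum.reindex_bij_witness[of _ "\<lambda>x. x - 1" Suc]) auto
      also have "(\<Sum>M\<in>msets_sum {1..} n. wt M * f (add_mset 1 M)) + \<dots> =
        (\<Sum>x\<in>{1..Suc n}. \<Sum>M\<in>msets_sum {1..} (Suc n - x). wt M * f (add_mset x M))"
        using sum.atLeast_Suc_atMost[of 1 "Suc n" "\<lambda>x. \<Sum>M\<in>msets_sum {1..} (Suc n - x). wt M * f (add_mset x M)"]
        by (simp add: numeral_2_eq_2)
      also have "\<dots> = real (Suc n) * (\<Sum>M\<in>msets_sum {1..} (Suc n). wt M * f M)"
        using sum_wt_recursion[of "{1..}" "Suc n" f] unfolding e by simp
      finally show ?thesis .
    qed
    finally show ?thesis by simp
  qed
  have "card (insert a S) = Suc n" using insert.hyps by (simp add: n_def)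
  moreover have "generates_invariant_sets (insert a S) P'"
    unfolding generates_invariant_sets_def using * by simp
  ultimately show ?case using sum_eq by (intro exI[of _ P']) simp
qed

lemma subsums_block_sizes:
  assumes P: "partition_on S P" and fin: "finite S"
  shows "k \<in> subsums (block_sizes P) \<longleftrightarrow> (\<exists>Q\<subseteq>P. card (\<Union>Q) = k)"
proof -
  have U: "\<Union>P = S" and disj: "disjoint P" using P by (auto simp: partition_on_def)
  have finP: "finite P" using P fin by (rule finite_elements[rotated])
  have finB: "finite B" if "B \<in> P" for B using U fin that by (metis Union_upper finite_subset)
  have card: "card (\<Union>Q) = \<Sum>\<^sub># (block_sizes Q)" if "Q \<subseteq> P" for Q
  proof -
    have "card (\<Union>Q) = (\<Sum>B\<in>Q. card B)"
      by (rule card_Union_disjoint) (use that disj finB in \<open>auto simp: pairwise_def disjoint_def disjnt_def\<close>)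
    then show ?thesis by (simp add: block_sizes_def sum_unfold_sum_mset)
  qed
  show ?thesis
  proof
    assume "k \<in> subsums (block_sizes P)"
    then obtain A where A: "A \<subseteq># block_sizes P" "k = \<Sum>\<^sub># A" by (auto simp: subsums_def)
    then obtain C where "image_mset card (mset_set P) = A + C"
      by (metis block_sizes_def mset_subset_eq_exists_conv)
    then obtain A' C' where A': "mset_set P = A' + C'" "A = image_mset card A'"
      using image_mset_eq_plusD by blast
    have le: "A' \<subseteq># mset_set P" using A'(1) by simp
    have sub: "set_mset A' \<subseteq> P" using set_mset_mono[OF le] finP by simp
    \<comment> \<open>Lifting the submultiset of sizes to blocks is what keeps blocks of equal size
      apart: multiplicities in \<open>A'\<close> are at most one, so \<open>A'\<close> is a genuine
      set of blocks.\<close>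
    have "A' = mset_set (set_mset A')"
    proof (rule multiset_eqI)
      fix B
      have "count A' B \<le> 1"
        using mset_subset_eq_count[OF le, of B] by (simp add: count_mset_set' split: if_splits)
      then show "count A' B = count (mset_set (set_mset A')) B"
        by (cases "count A' B = 0") (auto simp: not_in_iff count_mset_set' le_Suc_eq)
    qed
    then have "A = block_sizes (set_mset A')" unfolding A' block_sizes_def by simp
    with card[OF sub] A sub show "\<exists>Q\<subseteq>P. card (\<Union>Q) = k" by auto
  next
    assume "\<exists>Q\<subseteq>P. card (\<Union>Q) = k"
    then obtain Q where Q: "Q \<subseteq> P" "card (\<Union>Q) = k" by blast
    have "mset_set Q \<subseteq># mset_set P" using Q finP by (simp add: finite_subset subset_imp_msubset_mset_set)
    then have "block_sizes Q \<subseteq># block_sizes P" unfolding block_sizes_def by (rule image_mset_subseteq_mono)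
    then show "k \<in> subsums (block_sizes P)" using card[OF Q(1)] Q sum_in_subsums by metis
  qed
qed

lemma inv_prop_eq:
  "inv_prop n k = (\<Sum>M\<in>msets_sum {1..} n. wt M * of_bool (k \<in> subsums M))"
proof -
  obtain P where P: "generates_invariant_sets {1..n} P"
    and P3: "\<And>f :: nat multiset \<Rightarrow> real. (\<Sum>p\<in>{p. p permutes {1..n}}. f (block_sizes (P p))) =
      fact n * (\<Sum>M\<in>msets_sum {1..} n. wt M * f M)"
    using invariant_partition_exists[OF finite_atLeastAtMost, of 1 n, unfolded card_atLeastAtMost diff_Suc_1] by blast
  note P1 = generates_invariant_setsD(1)[OF P] and P2 = generates_invariant_setsD(2)[OF P]
  have "has_invariant_set n p k \<longleftrightarrow> k \<in> subsums (block_sizes (P p))" if p: "p permutes {1..n}" for p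
  proof -
    have "\<Union>Q \<subseteq> {1..n}" if "Q \<subseteq> P p" for Q
      using P1[OF p] that by (auto simp: partition_on_def)
    then show ?thesis
      unfolding has_invariant_set_def subsums_block_sizes[OF P1[OF p] finite_atLeastAtMost]
      using P2[OF p] by metis
  qed
  then have "{p. p permutes {1..n} \<and> has_invariant_set n p k} =
      {p\<in>{p. p permutes {1..n}}. k \<in> subsums (block_sizes (P p))}"
    by auto
  then have "real (card {p. p permutes {1..n} \<and> has_invariant_set n p k}) =
      (\<Sum>p\<in>{p. p permutes {1..n}}. of_bool (k \<in> subsums (block_sizes (P p))))"
    by (simp add: finite_permutations of_bool_def sum.If_cases Int_def)
  then show ?thesis
    unfolding inv_prop_def using P3[of "\<lambda>M. of_bool (k \<in> subsums M)"] by simp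
qed

section \<open>Parts exceeding a threshold\<close>

text \<open>Parts in \<open>A\<close> and parts in \<open>B\<close> are linked only through the
  total \<open>n\<close>, because \<open>wt\<close> is multiplicative over disjoint
  supports.\<close>

lemma sum_wt_split:
  assumes A: "0 \<notin> A" and B: "0 \<notin> B" and AB: "A \<inter> B = {}"
  shows "(\<Sum>N\<in>msets_sum (A \<union> B) n. wt N * f (filter_mset (\<lambda>x. x \<in> A) N) (filter_mset (\<lambda>x. x \<in> B) N)) =
    (\<Sum>M\<in>msets_sum_le A n. wt M * (\<Sum>R\<in>msets_sum B (n - \<Sum>\<^sub># M). wt R * f M R))"
proof -
  have "(\<Sum>M\<in>msets_sum_le A n. wt M * (\<Sum>R\<in>msets_sum B (n - \<Sum>\<^sub># M). wt R * f M R)) =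
    (\<Sum>(M, R)\<in>Sigma (msets_sum_le A n) (\<lambda>M. msets_sum B (n - \<Sum>\<^sub># M)). wt M * (wt R * f M R))"
    using A B by (subst sum.Sigma[symmetric]) (auto simp: sum_distrib_left)
  also have "\<dots> = (\<Sum>N\<in>msets_sum (A \<union> B) n. wt N * f (filter_mset (\<lambda>x. x \<in> A) N) (filter_mset (\<lambda>x. x \<in> B) N))"
  proof (rule sum.reindex_bij_witness[of _ "\<lambda>N. (filter_mset (\<lambda>x. x \<in> A) N, filter_mset (\<lambda>x. x \<in> B) N)" "\<lambda>(M, R). M + R"])
    fix a assume a: "a \<in> Sigma (msets_sum_le A n) (\<lambda>M. msets_sum B (n - \<Sum>\<^sub># M))"
    obtain M R where MR: "a = (M, R)" by (cases a)
    with a have M: "set_mset M \<subseteq> A" "\<Sum>\<^sub># M \<le> n" and R: "set_mset R \<subseteq> B" "\<Sum>\<^sub># R = n - \<Sum>\<^sub># M"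
      by (auto simp: msets_sum_le_def msets_sum_def)
    have "filter_mset (\<lambda>x. x \<in> A) M = M" "filter_mset (\<lambda>x. x \<in> B) R = R"
      using M R by (auto simp: filter_mset_eq_conv)
    moreover have "filter_mset (\<lambda>x. x \<in> A) R = {#}" "filter_mset (\<lambda>x. x \<in> B) M = {#}"
      using M R AB by (auto simp: multiset_eq_iff count_eq_zero_iff)
    ultimately have F: "filter_mset (\<lambda>x. x \<in> A) (M + R) = M" "filter_mset (\<lambda>x. x \<in> B) (M + R) = R"
      by simp_all
    show "(case case a of (M, R) \<Rightarrow> M + R of N \<Rightarrow> (filter_mset (\<lambda>x. x \<in> A) N, filter_mset (\<lambda>x. x \<in> B) N)) = a"
      using F by (simp add: MR)
    show "(case a of (M, R) \<Rightarrow> M + R) \<in> msets_sum (A \<union> B) n"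
      using M R by (auto simp: MR msets_sum_def)
    have "wt (M + R) = wt M * wt R" using M R AB by (intro wt_union) auto
    then show "wt (case a of (M, R) \<Rightarrow> M + R) * f (filter_mset (\<lambda>x. x \<in> A) (case a of (M, R) \<Rightarrow> M + R))
      (filter_mset (\<lambda>x. x \<in> B) (case a of (M, R) \<Rightarrow> M + R)) = (case a of (M, R) \<Rightarrow> wt M * (wt R * f M R))"
      using F by (simp add: MR)
  next
    fix N assume N: "N \<in> msets_sum (A \<union> B) n"
    have e: "filter_mset (\<lambda>x. x \<in> A) N + filter_mset (\<lambda>x. x \<in> B) N = N"
    proof (rule multiset_eqI)
      fix x
      show "count (filter_mset (\<lambda>x. x \<in> A) N + filter_mset (\<lambda>x. x \<in> B) N) x = count N x"
        using N AB by (cases "x \<in># N") (auto simp: msets_sum_def not_in_iff)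
    qed
    show "(case (filter_mset (\<lambda>x. x \<in> A) N, filter_mset (\<lambda>x. x \<in> B) N) of (M, R) \<Rightarrow> M + R) = N"
      using e by simp
    have "\<Sum>\<^sub># (filter_mset (\<lambda>x. x \<in> A) N) + \<Sum>\<^sub># (filter_mset (\<lambda>x. x \<in> B) N) = n"
      using N unfolding sum_mset.union[symmetric] e by (simp add: msets_sum_def)
    then show "(filter_mset (\<lambda>x. x \<in> A) N, filter_mset (\<lambda>x. x \<in> B) N)
      \<in> Sigma (msets_sum_le A n) (\<lambda>M. msets_sum B (n - \<Sum>\<^sub># M))"
      by (auto simp: msets_sum_le_def msets_sum_def)
  qed
  finally show ?thesis by simp
qed

text \<open>The proportion of permutations of \<open>m\<close> points all of whose cycles are longer
  than \<open>z\<close>.\<close>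

definition rough :: "nat \<Rightarrow> nat \<Rightarrow> real" where
  "rough z m = (\<Sum>R\<in>msets_sum {z<..} m. wt R)"

lemma rough_0: "rough z 0 = 1"
  by (simp add: rough_def msets_sum_0)

lemma rough_recursion: "real m * rough z m = (\<Sum>x\<in>{z<..m}. rough z (m - x))"
proof -
  have "{x \<in> {z<..}. x \<le> m} = {z<..m}" by auto
  then show ?thesis
    using sum_wt_recursion[of "{z<..}" m "\<lambda>_. 1"] by (simp add: rough_def)
qed

lemma rough_eq_0: "0 < m \<Longrightarrow> m \<le> z \<Longrightarrow> rough z m = 0"
  using rough_recursion[of m z] by simp

lemma rough_sum_expand:
  assumes "z < m"
  shows "(\<Sum>x\<in>{z<..m}. rough z (m - x)) = 1 + (\<Sum>j\<in>{z<..m-z-1}. rough z j)"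
proof -
  have "(\<Sum>x\<in>{z<..m}. rough z (m - x)) = (\<Sum>j\<in>{..m-z-1}. rough z j)"
    by (rule sum.reindex_bij_witness[of _ "\<lambda>j. m - j" "\<lambda>x. m - x"]) (use assms in auto)
  also have "\<dots> = (\<Sum>j\<in>insert 0 {z<..m-z-1}. rough z j)"
    by (rule sum.mono_neutral_right) (auto, metis not_gr_zero not_less rough_eq_0)
  also have "\<dots> = 1 + (\<Sum>j\<in>{z<..m-z-1}. rough z j)" by (simp add: rough_0)
  finally show ?thesis .
qed

lemma rough_upper: "0 < m \<Longrightarrow> rough z m \<le> 1 / (real z + 1)"
proof (induction m rule: less_induct)
  case (less m)
  show ?case
  proof (cases "z < m")
    case False
    then show ?thesis using less.prems rough_eq_0[of m z] by simp
  next
    case True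
    have "real m * rough z m = 1 + (\<Sum>j\<in>{z<..m-z-1}. rough z j)"
      unfolding rough_recursion rough_sum_expand[OF True] ..
    also have "(\<Sum>j\<in>{z<..m-z-1}. rough z j) \<le> (\<Sum>j\<in>{z<..m-z-1}. 1 / (real z + 1))"
      by (rule sum_mono) (use less.IH in auto)
    also have "\<dots> = real (m - z - 1 - z) / (real z + 1)" by simp
    also have "1 + real (m - z - 1 - z) / (real z + 1) = real (z + 1 + (m - z - 1 - z)) / (real z + 1)"
      by (simp add: divide_simps)
    also have "\<dots> \<le> real m / (real z + 1)"
      using True by (intro divide_right_mono of_nat_mono) auto
    finally have "real m * rough z m \<le> real m * (1 / (real z + 1))" by simp
    then show ?thesis using True by (subst (asm) mult_le_cancel_left_pos) auto
  qed
qed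

text \<open>The constant \<open>2 * z + 1\<close> makes the induction exact: for larger
  \<open>m\<close> the recursion gives
  \<open>1 + (m - 2 * z - 1) / (2 * z + 1) = m / (2 * z + 1)\<close>, and for
  \<open>m <= 2 * z + 1\<close> only the single part \<open>m\<close> contributes.\<close>

lemma rough_lower: "z < m \<Longrightarrow> 1 / (2 * real z + 1) \<le> rough z m"
proof (induction m rule: less_induct)
  case (less m)
  have eq: "real m * rough z m = 1 + (\<Sum>j\<in>{z<..m-z-1}. rough z j)"
    unfolding rough_recursion rough_sum_expand[OF less.prems] ..
  have "real m / (2 * real z + 1) \<le> real (2 * z + 1 + (m - z - 1 - z)) / (2 * real z + 1)"
    by (intro divide_right_mono of_nat_mono) auto
  also have "\<dots> = 1 + real (m - z - 1 - z) / (2 * real z + 1)"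
    by (simp add: divide_simps)
  also have "real (m - z - 1 - z) / (2 * real z + 1) = (\<Sum>j\<in>{z<..m-z-1}. 1 / (2 * real z + 1))" by simp
  also have "\<dots> \<le> (\<Sum>j\<in>{z<..m-z-1}. rough z j)"
    by (rule sum_mono) (use less in auto)
  finally have "real m * (1 / (2 * real z + 1)) \<le> real m * rough z m" using eq by simp
  then show ?case using less.prems by (subst (asm) mult_le_cancel_left_pos) auto
qed

section \<open>Reduction to subset sums\<close>

definition smooth_sum :: "nat \<Rightarrow> nat \<Rightarrow> real" where
  "smooth_sum n Q = (\<Sum>M\<in>msets_sum_le {1..Q} n. wt M * real (card (subsums M)))"

lemma sum_of_bool_card:
  assumes "finite Y" "inj_on g {y\<in>Y. P y}" "finite S" "\<And>y. y \<in> Y \<Longrightarrow> P y \<Longrightarrow> g y \<in> S"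
  shows "(\<Sum>y\<in>Y. of_bool (P y)) \<le> real (card S)"
proof -
  have "(\<Sum>y\<in>Y. of_bool (P y)) = real (card {y\<in>Y. P y})"
    using assms(1) by (simp add: of_bool_def sum.If_cases Int_def)
  also have "card {y\<in>Y. P y} = card (g ` {y\<in>Y. P y})"
    using assms(2) by (simp add: card_image)
  also have "\<dots> \<le> card S"
    using assms(3,4) by (intro card_mono) auto
  finally show ?thesis by simp
qed

lemma filter_split_atMost:
  fixes N :: "nat multiset"
  assumes "set_mset N \<subseteq> {1..}"
  shows "filter_mset (\<lambda>x. x \<in> {1..K}) N + filter_mset (\<lambda>x. x \<in> {K<..}) N = N"
  using assms
proof (induction N)
  case (add x N)
  then show ?case by (cases "x \<le> K") auto
qed simp

text \<open>Mark a part \<open>y\<close> for which \<open>k - y\<close> is a subset sum of the small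
  parts \<open>M\<close>. Different subset sums belong to different \<open>y\<close>, so summing
  over \<open>y\<close> yields \<open>card (subsums M)\<close>. The remaining parts contribute at
  least \<open>1 / (2 * k + 1)\<close> by \<open>rough_lower\<close>, and the marking weight of one
  cycle type is at most \<open>2 * k\<close>. The quarter in \<open>K\<close> keeps \<open>y\<close>
  above the small parts and leaves room for the others.\<close>

lemma inv_prop_lower:
  assumes k: "1 \<le> k" and n: "2 * k \<le> n"
  defines "K \<equiv> k div 4"
  shows "smooth_sum K K / (2 * real k * (2 * real k + 1))
    \<le> inv_prop n k"
proof -
  \<comment> \<open>The parts \<open>R\<close> are either all larger than \<open>k\<close> or \<open>R\<close> is a single part, so that at most two
    parts lie in \<open>Y\<close> below and every cycle type is counted at most twice.\<close>
  define h where "h = (\<lambda>y M R. of_bool (k - y \<in> subsums M \<and> \<Sum>\<^sub># M \<le> K \<and>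
    (\<forall>r\<in>#R. min k (\<Sum>\<^sub># R - 1) < r)) :: real)"
  define Y where "Y = {k - K..k}"
  define lo where "lo = filter_mset (\<lambda>x. x \<in> {1..K})"
  define hi where "hi = filter_mset (\<lambda>x. x \<in> {K<..})"
  define g where "g = (\<lambda>y N. h y (lo N) (hi N))"
  have K4: "4 * K \<le> k" unfolding K_def by simp
  have Ypos: "K < y" "0 < y" "y \<le> k" "y \<le> n" if "y \<in> Y" for y
    using that k K4 n by (auto simp: Y_def)
  have fY: "finite Y" by (simp add: Y_def)
  have h01: "0 \<le> h y M R" "h y M R \<le> 1" for y M R by (auto simp: h_def)
  have g01: "0 \<le> g y N" "g y N \<le> 1" for y N by (simp_all add: g_def h01)
  have main1: "(\<Sum>y\<in>Y. real (count N y) * real y * g y (N - {#y#}))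
      \<le> 2 * real k * of_bool (k \<in> subsums N)" if N: "N \<in> msets_sum {1..} n" for N
  proof (cases "\<exists>y\<in>Y. count N y \<noteq> 0 \<and> g y (N - {#y#}) \<noteq> 0")
    case False
    then have "(\<Sum>y\<in>Y. real (count N y) * real y * g y (N - {#y#})) = 0"
      by (intro sum.neutral) auto
    then show ?thesis by simp
  next
    case True
    then obtain y where y: "y \<in> Y" "y \<in># N" and hy: "g y (N - {#y#}) \<noteq> 0"
      by (auto simp: count_eq_zero_iff)
    define M where "M = lo (N - {#y#})"
    define R where "R = hi (N - {#y#})"
    from hy have hy: "k - y \<in> subsums M" "\<Sum>\<^sub># M \<le> K" "\<And>r. r \<in># R \<Longrightarrow> min k (\<Sum>\<^sub># R - 1) < r"
      by (auto simp: g_def h_def M_def R_def)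
    have "set_mset (N - {#y#}) \<subseteq> {1..}" using N by (auto simp: msets_sum_def dest: in_diffD)
    then have "M + R = N - {#y#}" unfolding M_def R_def lo_def hi_def by (rule filter_split_atMost)
    then have Neq: "N = add_mset y (M + R)" using y by simp
    have MK: "x \<le> K" if "x \<in># M" for x using that unfolding M_def lo_def by (simp only: set_mset_filter mem_Collect_eq atLeastAtMost_iff)
    have RK: "K < x" if "x \<in># R" for x using that unfolding R_def hi_def by (simp only: set_mset_filter mem_Collect_eq greaterThan_iff)
    have "k \<in> subsums N"
    proof -
      from hy(1) obtain A where A: "A \<subseteq># M" "\<Sum>\<^sub># A = k - y" by (auto simp: subsums_def)
      then have "add_mset y A \<subseteq># N" unfolding Neq by (simp add: subset_mset.add_increasing2)
      moreover have "\<Sum>\<^sub># (add_mset y A) = k" using A Ypos[OF y(1)] by simp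
      ultimately show ?thesis using sum_in_subsums by metis
    qed
    have s1: "size (filter_mset (\<lambda>x. x \<in> Y) M) = 0"
      using MK Ypos(1) by (auto simp: filter_mset_eq_conv multiset_eq_iff count_eq_zero_iff) (metis leD)
    have s2: "size (filter_mset (\<lambda>x. x \<in> Y) R) \<le> 1"
    proof (cases "\<exists>r\<in>#R. r \<in> Y")
      case True
      then obtain r where r: "r \<in># R" "r \<in> Y" by blast
      then obtain R' where R': "R = add_mset r R'" by (meson multi_member_split)
      have "\<Sum>\<^sub># R \<le> r" using hy(3)[OF r(1)] Ypos[OF r(2)] by auto
      then have "\<Sum>\<^sub># R' = 0" unfolding R' by simp
      moreover have "0 \<notin># R'" using RK unfolding R' by auto
      ultimately have "size R' = 0" by (metis le_zero_eq size_le_sum_mset)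
      then have "size R \<le> 1" unfolding R' by simp
      then show ?thesis using size_filter_mset_lesseq[of "\<lambda>x. x \<in> Y" R] by linarith
    next
      case False
      then have "filter_mset (\<lambda>x. x \<in> Y) R = {#}" by (auto simp: multiset_eq_iff count_eq_zero_iff)
      then show ?thesis by (metis size_empty zero_le)
    qed
    have "size (filter_mset (\<lambda>x. x \<in> Y) N) \<le>
        1 + size (filter_mset (\<lambda>x. x \<in> Y) M) + size (filter_mset (\<lambda>x. x \<in> Y) R)"
      by (simp add: Neq)
    then have sz: "size (filter_mset (\<lambda>x. x \<in> Y) N) \<le> 2" using s1 s2 by linarith
    have "(\<Sum>y\<in>Y. real (count N y) * real y * g y (N - {#y#}))
        \<le> (\<Sum>y\<in>Y. real (count N y) * real k * 1)"
      using g01 Ypos(3) by (intro sum_mono mult_mono) (auto intro!: mult_nonneg_nonneg)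
    also have "\<dots> = real k * (\<Sum>y\<in>Y. real (count N y))"
      by (simp add: sum_distrib_left mult.commute)
    also have "(\<Sum>y\<in>Y. real (count N y)) = (\<Sum>y\<in>Y. real (count (filter_mset (\<lambda>x. x \<in> Y) N) y))"
      by (rule sum.cong) auto
    also have "\<dots> = real (size (filter_mset (\<lambda>x. x \<in> Y) N))"
      by (rule size_eq_sum_superset[symmetric]) (auto simp: fY)
    also have "real k * \<dots> \<le> real k * 2" using sz by (intro mult_left_mono) auto
    finally show ?thesis using \<open>k \<in> subsums N\<close> by simp
  qed
  have inner: "1 / (2 * real k + 1) \<le> (\<Sum>R\<in>msets_sum {K<..} (n - y - \<Sum>\<^sub># M). wt R * h y M R)"
    if y: "y \<in> Y" and M: "\<Sum>\<^sub># M \<le> K" "k - y \<in> subsums M" for y M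
  proof -
    define m where "m = n - y - \<Sum>\<^sub># M"
    \<comment> \<open>\<open>m\<close> need not exceed \<open>k\<close> when \<open>n\<close> is
      close to \<open>2 * k\<close>, but \<open>rough_lower\<close> requires \<open>z < m\<close>.
      This is the origin of the minimum in \<open>h\<close>.\<close>
    define z where "z = min k (m - 1)"
    have "K + 1 \<le> m" using K4 k n M Ypos[OF y] unfolding m_def by linarith
    then have z: "z < m" "K \<le> z" "z \<le> k" using K4 unfolding z_def by auto
    have "1 / (2 * real k + 1) \<le> 1 / (2 * real z + 1)"
      using z by (intro divide_left_mono) auto
    also have "\<dots> \<le> rough z m" by (rule rough_lower[OF z(1)])
    also have "\<dots> = (\<Sum>R\<in>msets_sum {z<..} m. wt R * h y M R)"
      unfolding rough_def
    proof (rule sum.cong[OF refl])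
      fix R assume "R \<in> msets_sum {z<..} m"
      then have "h y M R = 1" using M by (auto simp: h_def msets_sum_def z_def)
      then show "wt R = wt R * h y M R" by simp
    qed
    also have "\<dots> \<le> (\<Sum>R\<in>msets_sum {K<..} m. wt R * h y M R)"
      by (rule sum_mono2[OF finite_msets_sum]) (use z h01 in \<open>auto simp: msets_sum_def\<close>)
    finally show ?thesis by (simp add: m_def)
  qed
  have mark: "(\<Sum>N\<in>msets_sum {1..} n. wt N * (real (count N y) * real y) * g y (N - {#y#}))
      \<ge> (\<Sum>M\<in>msets_sum_le {1..K} K. wt M * (of_bool (k - y \<in> subsums M) / (2 * real k + 1)))"
    if y: "y \<in> Y" for y
  proof -
    have "{M. add_mset y M \<in> msets_sum {1..} n} = msets_sum {1..} (n - y)"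
      using Ypos[OF y] by (auto simp: msets_sum_def)
    moreover have un: "{1..} = {1..K} \<union> {K<..}" by auto
    ultimately have "(\<Sum>N\<in>msets_sum {1..} n. wt N * (real (count N y) * real y) * g y (N - {#y#}))
      = (\<Sum>N\<in>msets_sum ({1..K} \<union> {K<..}) (n - y). wt N * g y N)"
      using sum_wt_marked[of "msets_sum {1..} n" y "g y"] Ypos[OF y] by simp
    also have "\<dots> = (\<Sum>M\<in>msets_sum_le {1..K} (n - y). wt M *
        (\<Sum>R\<in>msets_sum {K<..} (n - y - \<Sum>\<^sub># M). wt R * h y M R))"
      unfolding g_def lo_def hi_def by (rule sum_wt_split) auto
    also have "\<dots> \<ge> (\<Sum>M\<in>msets_sum_le {1..K} K. wt M *
        (\<Sum>R\<in>msets_sum {K<..} (n - y - \<Sum>\<^sub># M). wt R * h y M R))"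
    proof (rule sum_mono2)
      have "K \<le> n - y" using Ypos[OF y] n K4 by linarith
      then show "msets_sum_le {1..K} K \<subseteq> msets_sum_le {1..K} (n - y)"
        by (auto simp: msets_sum_le_def)
    qed (auto intro!: mult_nonneg_nonneg sum_nonneg h01)
    moreover have "(\<Sum>M\<in>msets_sum_le {1..K} K. wt M * (of_bool (k - y \<in> subsums M) / (2 * real k + 1)))
      \<le> (\<Sum>M\<in>msets_sum_le {1..K} K. wt M *
        (\<Sum>R\<in>msets_sum {K<..} (n - y - \<Sum>\<^sub># M). wt R * h y M R))"
    proof (intro sum_mono mult_left_mono)
      fix M assume M: "M \<in> msets_sum_le {1..K} K"
      show "of_bool (k - y \<in> subsums M) / (2 * real k + 1) \<le>
        (\<Sum>R\<in>msets_sum {K<..} (n - y - \<Sum>\<^sub># M). wt R * h y M R)"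
      proof (cases "k - y \<in> subsums M")
        case True
        with inner[OF y _ True] M show ?thesis by (simp add: msets_sum_le_def)
      qed (auto intro!: sum_nonneg mult_nonneg_nonneg h01)
    qed simp
    ultimately show ?thesis by linarith
  qed
  have cardeq: "(\<Sum>y\<in>Y. of_bool (k - y \<in> subsums M)) \<ge> real (card (subsums M))"
    if M: "M \<in> msets_sum_le {1..K} K" for M
  proof -
    have "(\<Sum>y\<in>Y. of_bool (k - y \<in> subsums M)) = real (card {y\<in>Y. k - y \<in> subsums M})"
      using fY by (simp add: of_bool_def sum.If_cases Int_def)
    moreover have "card (subsums M) \<le> card {y\<in>Y. k - y \<in> subsums M}"
    proof (rule card_inj_on_le[where f = "\<lambda>l. k - l"])
      have le: "l \<le> K" if "l \<in> subsums M" for l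
        using subsums_le[OF that] M by (auto simp: msets_sum_le_def)
      show "inj_on (\<lambda>l. k - l) (subsums M)"
      proof (rule inj_onI)
        fix l l' assume "l \<in> subsums M" "l' \<in> subsums M" "k - l = k - l'"
        with le[of l] le[of l'] K4 show "l = l'" by linarith
      qed
      show "(\<lambda>l. k - l) ` subsums M \<subseteq> {y \<in> Y. k - y \<in> subsums M}"
      proof
        fix y assume "y \<in> (\<lambda>l. k - l) ` subsums M"
        then obtain l where l: "l \<in> subsums M" "y = k - l" by blast
        then have "l \<le> k" using le[OF l(1)] K4 by linarith
        then show "y \<in> {y \<in> Y. k - y \<in> subsums M}" using l le[OF l(1)] by (auto simp: Y_def)
      qed
    qed (simp add: fY)
    ultimately show ?thesis by simp
  qed
  have "smooth_sum K K / (2 * real k + 1)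
      = (\<Sum>M\<in>msets_sum_le {1..K} K. wt M / (2 * real k + 1) * real (card (subsums M)))"
    by (simp add: smooth_sum_def sum_divide_distrib)
  also have "\<dots> \<le> (\<Sum>M\<in>msets_sum_le {1..K} K. wt M / (2 * real k + 1) * (\<Sum>y\<in>Y. of_bool (k - y \<in> subsums M)))"
    by (intro sum_mono mult_left_mono cardeq) auto
  also have "\<dots> = (\<Sum>y\<in>Y. \<Sum>M\<in>msets_sum_le {1..K} K. wt M * (of_bool (k - y \<in> subsums M) / (2 * real k + 1)))"
    unfolding sum_distrib_left by (subst sum.swap) simp
  also have "\<dots> \<le> (\<Sum>y\<in>Y. \<Sum>N\<in>msets_sum {1..} n. wt N * (real (count N y) * real y) * g y (N - {#y#}))"
    by (rule sum_mono) (rule mark)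
  also have "\<dots> = (\<Sum>N\<in>msets_sum {1..} n. wt N * (\<Sum>y\<in>Y. real (count N y) * real y * g y (N - {#y#})))"
    unfolding sum_distrib_left by (subst sum.swap) (simp add: mult.assoc)
  also have "\<dots> \<le> (\<Sum>N\<in>msets_sum {1..} n. wt N * (2 * real k * of_bool (k \<in> subsums N)))"
    by (intro sum_mono mult_left_mono main1) auto
  also have "\<dots> = 2 * real k * inv_prop n k"
    unfolding inv_prop_eq sum_distrib_left by (simp add: mult_ac)
  finally have le: "smooth_sum K K / (2 * real k + 1)
      \<le> 2 * real k * inv_prop n k" .
  have "smooth_sum K K / (2 * real k * (2 * real k + 1))
      = smooth_sum K K / (2 * real k + 1) / (2 * real k)"
    by (simp add: mult.commute)
  also have "\<dots> \<le> 2 * real k * inv_prop n k / (2 * real k)"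
    by (intro divide_right_mono le) simp
  also have "\<dots> = inv_prop n k" using k by simp
  finally show ?thesis .
qed

text \<open>
  Given an invariant set and its complement, the marked cycle is the longest one in whichever of the
  two has the shorter longest cycle; \<open>T\<close> is the size of that set and \<open>N\<close> consists of the other cycles.
\<close>

definition mark_ok :: "nat \<Rightarrow> nat \<Rightarrow> nat multiset \<Rightarrow> bool" where
  "mark_ok T z N \<longleftrightarrow> z \<le> T \<and> T - z \<in> subsums (filter_mset (\<lambda>x. x \<in> {1..z}) N) \<and> (\<exists>r\<in>#N. z \<le> r)"

lemma mark_ok_Max:
  assumes A: "A \<noteq> {#}" "set_mset A \<subseteq> {1..}" and B: "B \<noteq> {#}"
    and le: "Max (set_mset A) \<le> Max (set_mset B)"
  defines "z \<equiv> Max (set_mset A)"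
  shows "z \<in># A" "mark_ok (\<Sum>\<^sub># A) z (A + B - {#z#})"
proof -
  show zA: "z \<in># A" unfolding z_def using A(1) by (intro Max_in) auto
  then obtain A' where A': "A = add_mset z A'" by (meson multi_member_split)
  have eq: "A + B - {#z#} = A' + B" unfolding A' by simp
  have "x \<le> z" if "x \<in># A" for x using that unfolding z_def by simp
  then have "filter_mset (\<lambda>x. x \<in> {1..z}) A' = A'"
    using A(2) unfolding A' by (auto simp: filter_mset_eq_conv)
  then have "A' \<subseteq># filter_mset (\<lambda>x. x \<in> {1..z}) (A' + B)" by simp
  then have "\<Sum>\<^sub># A' \<in> subsums (filter_mset (\<lambda>x. x \<in> {1..z}) (A' + B))" by (rule sum_in_subsums)
  moreover have "\<Sum>\<^sub># A - z = \<Sum>\<^sub># A'" "z \<le> \<Sum>\<^sub># A" unfolding A' by simp_all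
  moreover have "Max (set_mset B) \<in># A' + B" using Max_in[of "set_mset B"] B by auto
  ultimately show "mark_ok (\<Sum>\<^sub># A) z (A + B - {#z#})"
    unfolding mark_ok_def eq using le z_def by auto
qed

text \<open>The marked part is at most \<open>k\<close> even if it comes from the complement, since
  it is then shorter than the longest part of \<open>A\<close>, whose parts add up to
  \<open>k\<close>. The longest part of the other set stays in \<open>N - {#z#}\<close> and will be
  worth a second factor \<open>1 / z\<close>.\<close>

lemma subsums_marked:
  assumes N: "N \<in> msets_sum {1..} n" and k: "1 \<le> k" "k < n"
  shows "of_bool (k \<in> subsums N) \<le> (\<Sum>z\<in>{1..k}. real (count N z) *
    (of_bool (mark_ok k z (N - {#z#})) + of_bool (mark_ok (n - k) z (N - {#z#}))))"
proof (cases "k \<in> subsums N")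
  case True
  then obtain A where A: "A \<subseteq># N" "\<Sum>\<^sub># A = k" by (auto simp: subsums_def)
  define B where "B = N - A"
  have NAB: "N = A + B" using A by (simp add: B_def)
  have sN: "set_mset N \<subseteq> {1..}" "\<Sum>\<^sub># N = n" using N by (auto simp: msets_sum_def)
  have sA: "set_mset A \<subseteq> {1..}" and sB: "set_mset B \<subseteq> {1..}" using sN NAB by auto
  have B: "\<Sum>\<^sub># B = n - k" using sN NAB A by simp
  have ne: "A \<noteq> {#}" "B \<noteq> {#}" using A B k by auto
  have "\<exists>z\<in>{1..k}. z \<in># N \<and> (mark_ok k z (N - {#z#}) \<or> mark_ok (n - k) z (N - {#z#}))"
  proof (cases "Max (set_mset A) \<le> Max (set_mset B)")
    case True
    from mark_ok_Max[OF ne(1) sA ne(2) True] obtain z where z: "z \<in># A" "mark_ok k z (N - {#z#})"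
      unfolding A NAB by blast
    then have "z \<in> {1..k}" using sA member_le_sum_mset[OF z(1)] A by auto
    with z show ?thesis by (auto simp: NAB)
  next
    case False
    define z where "z = Max (set_mset B)"
    have z: "z \<in># B" "mark_ok (n - k) z (N - {#z#})"
      using mark_ok_Max[OF ne(2) sB ne(1)] False unfolding B NAB z_def by (simp_all add: add.commute)
    have "Max (set_mset A) \<in># A" using ne by (intro Max_in) auto
    from member_le_sum_mset[OF this] have "z \<le> k" using False A unfolding z_def by simp
    then have "z \<in> {1..k}" using sB z by auto
    with z show ?thesis by (auto simp: NAB)
  qed
  then obtain z where z: "z \<in> {1..k}" "z \<in># N" "mark_ok k z (N - {#z#}) \<or> mark_ok (n - k) z (N - {#z#})"
    by blast
  have "1 \<le> real (count N z)" using z(2) by (simp add: Suc_le_eq)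
  moreover have "(1::real) \<le> of_bool (mark_ok k z (N - {#z#})) + of_bool (mark_ok (n - k) z (N - {#z#}))"
    using z(3) by auto
  ultimately have "1 * 1 \<le> real (count N z) *
      (of_bool (mark_ok k z (N - {#z#})) + of_bool (mark_ok (n - k) z (N - {#z#})))"
    by (intro mult_mono) auto
  also have "\<dots> \<le> (\<Sum>z\<in>{1..k}. real (count N z) *
    (of_bool (mark_ok k z (N - {#z#})) + of_bool (mark_ok (n - k) z (N - {#z#}))))"
    by (rule member_le_sum[OF z(1)]) auto
  finally show ?thesis by simp
qed (auto intro!: sum_nonneg)

definition hit :: "nat \<Rightarrow> nat \<Rightarrow> nat multiset \<Rightarrow> real" where
  "hit T y M = of_bool (y \<le> T \<and> T - y \<in> subsums M)"

lemma hit_nonneg [simp]: "0 \<le> hit T y M" and hit_le_1: "hit T y M \<le> 1"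
  by (auto simp: hit_def)

lemma hit_add_mset: "hit T z (add_mset z M) \<le> hit T z M + hit T (2 * z) M"
proof (cases "z \<le> T \<and> T - z \<in> subsums (add_mset z M)")
  case True
  then consider "T - z \<in> subsums M" | l where "l \<in> subsums M" "T - z = z + l"
    by (auto simp: subsums_add_mset)
  then show ?thesis
  proof cases
    case 2
    then have "2 * z \<le> T" "T - 2 * z = l" using True by linarith+
    with 2 True show ?thesis by (auto simp: hit_def)
  qed (use True in \<open>auto simp: hit_def\<close>)
qed (simp add: hit_def)

lemma sum_wt_marked_le:
  assumes x: "x \<in> A" and A: "0 \<notin> A" and f: "\<And>M. f (add_mset x M) \<le> g M" and g: "\<And>M. (0::real) \<le> g M"
  shows "(\<Sum>M\<in>msets_sum_le A n. wt M * (real (count M x) * real x) * f M) \<le> (\<Sum>M\<in>msets_sum_le A n. wt M * g M)"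
proof -
  have x0: "0 < x" using x A by (metis gr0I)
  have "(\<Sum>M\<in>msets_sum_le A n. wt M * (real (count M x) * real x) * f M) \<le>
      (\<Sum>M\<in>msets_sum_le A n. wt M * (real (count M x) * real x) * g (M - {#x#}))"
  proof (rule sum_mono)
    fix M
    show "wt M * (real (count M x) * real x) * f M \<le> wt M * (real (count M x) * real x) * g (M - {#x#})"
    proof (cases "x \<in># M")
      case True
      then obtain M' where "M = add_mset x M'" by (meson multi_member_split)
      then show ?thesis using f[of M'] by (intro mult_left_mono) auto
    qed (simp add: not_in_iff)
  qed
  also have "\<dots> = (\<Sum>M\<in>{M. add_mset x M \<in> msets_sum_le A n}. wt M * g M)"
    by (rule sum_wt_marked) (use x0 A in auto)
  also have "\<dots> \<le> (\<Sum>M\<in>msets_sum_le A n. wt M * g M)"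
    by (rule sum_mono2[OF finite_msets_sum_le[OF A]]) (auto simp: msets_sum_le_def g)
  finally show ?thesis .
qed

text \<open>The required part of length at least \<open>z\<close> is worth \<open>1 / z\<close> in
  both of its forms. Parts beyond \<open>z\<close>, if there are any, contribute
  \<open>rough z m' <= 1 / z\<close>. Otherwise \<open>z\<close> occurs again and can itself be
  marked and removed; this may shift the target by \<open>z\<close>, whence the term with
  \<open>2 * z\<close>.\<close>

lemma sum_mark_ok:
  assumes z: "1 \<le> z"
  shows "(\<Sum>N\<in>msets_sum {1..} m. wt N * of_bool (mark_ok T z N)) \<le>
    (\<Sum>M\<in>msets_sum_le {1..z} m. wt M * (2 * hit T z M + hit T (2 * z) M)) / real z"
proof -
  have un: "{1..} = {1..z} \<union> {z<..}" using z by auto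
  define h where "h = (\<lambda>M (R :: nat multiset). hit T z M * of_bool (R \<noteq> {#} \<or> z \<in># M))"
  have ind: "of_bool (mark_ok T z N) = h (filter_mset (\<lambda>x. x \<in> {1..z}) N) (filter_mset (\<lambda>x. x \<in> {z<..}) N)" for N
  proof -
    have "(\<exists>r\<in>#N. z \<le> r) \<longleftrightarrow> filter_mset (\<lambda>x. x \<in> {z<..}) N \<noteq> {#} \<or> z \<in># filter_mset (\<lambda>x. x \<in> {1..z}) N"
    proof -
      have "filter_mset (\<lambda>x. x \<in> {z<..}) N \<noteq> {#} \<longleftrightarrow> (\<exists>r\<in>#N. z < r)"
        unfolding set_mset_eq_empty_iff[symmetric] set_mset_filter by auto
      moreover have "z \<in># filter_mset (\<lambda>x. x \<in> {1..z}) N \<longleftrightarrow> z \<in># N"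
        using z by simp
      ultimately show ?thesis by (auto simp: le_less)
    qed
    then show ?thesis unfolding mark_ok_def h_def hit_def by (simp only: of_bool_conj conj_assoc[symmetric])
  qed
  have inner: "(\<Sum>R\<in>msets_sum {z<..} m'. wt R * h M R) \<le> hit T z M * (1 / real z + real (count M z))"
    for M m'
  proof (cases "m' = 0")
    case True
    have "of_bool (z \<in># M) \<le> real (count M z)" by (auto simp: Suc_le_eq)
    also have "\<dots> \<le> 1 / real z + real (count M z)" by simp
    finally have "hit T z M * of_bool (z \<in># M) \<le> hit T z M * (1 / real z + real (count M z))"
      by (rule mult_left_mono) simp
    then show ?thesis using True by (simp add: msets_sum_0 h_def)
  next
    case False
    have "(\<Sum>R\<in>msets_sum {z<..} m'. wt R * h M R) \<le> (\<Sum>R\<in>msets_sum {z<..} m'. wt R * hit T z M)"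
      by (intro sum_mono mult_left_mono) (auto simp: h_def)
    also have "\<dots> = hit T z M * rough z m'" by (simp add: rough_def sum_distrib_left mult.commute)
    also have "\<dots> \<le> hit T z M * (1 / real z + real (count M z))"
    proof (intro mult_left_mono)
      have "rough z m' \<le> 1 / (real z + 1)" using rough_upper False by simp
      also have "\<dots> \<le> 1 / real z" using z by (intro divide_left_mono) auto
      finally show "rough z m' \<le> 1 / real z + real (count M z)" by simp
    qed simp
    finally show ?thesis .
  qed
  have "(\<Sum>N\<in>msets_sum {1..} m. wt N * of_bool (mark_ok T z N)) =
    (\<Sum>M\<in>msets_sum_le {1..z} m. wt M * (\<Sum>R\<in>msets_sum {z<..} (m - \<Sum>\<^sub># M). wt R * h M R))"
    unfolding ind un by (rule sum_wt_split) auto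
  also have "\<dots> \<le> (\<Sum>M\<in>msets_sum_le {1..z} m. wt M * (hit T z M * (1 / real z + real (count M z))))"
    by (intro sum_mono mult_left_mono inner) simp
  also have "\<dots> = (\<Sum>M\<in>msets_sum_le {1..z} m. wt M * hit T z M) / real z +
      (\<Sum>M\<in>msets_sum_le {1..z} m. wt M * (real (count M z) * real z) * hit T z M) / real z"
    unfolding sum_divide_distrib sum.distrib[symmetric]
    by (rule sum.cong[OF refl]) (use z in \<open>simp add: field_simps\<close>)
  also have "(\<Sum>M\<in>msets_sum_le {1..z} m. wt M * (real (count M z) * real z) * hit T z M)
    \<le> (\<Sum>M\<in>msets_sum_le {1..z} m. wt M * (hit T z M + hit T (2 * z) M))"
    by (rule sum_wt_marked_le) (use z hit_add_mset in auto)
  finally show ?thesis using z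
    by (simp add: divide_right_mono add_divide_distrib[symmetric] sum.distrib[symmetric] algebra_simps)
qed

lemma smooth_sum_nonneg: "0 \<le> smooth_sum n Q"
  unfolding smooth_sum_def by (intro sum_nonneg) auto

text \<open>Weighting by the sum marks a part of some length \<open>x <= Q\<close>, and restoring
  that part at most doubles the number of subset sums.\<close>

lemma sum_weighted_smooth:
  "(\<Sum>M\<in>msets_sum_le {1..Q} n. wt M * (real (\<Sum>\<^sub># M) * real (card (subsums M)))) \<le> 2 * real Q * smooth_sum n Q"
proof -
  have "(\<Sum>M\<in>msets_sum_le {1..Q} n. wt M * (real (\<Sum>\<^sub># M) * real (card (subsums M)))) =
    (\<Sum>M\<in>msets_sum_le {1..Q} n. \<Sum>x\<in>{1..Q}. wt M * (real (count M x) * real x) * real (card (subsums M)))"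
  proof (rule sum.cong[OF refl])
    fix M assume "M \<in> msets_sum_le {1..Q} n"
    then have "real (\<Sum>\<^sub># M) = (\<Sum>x\<in>{1..Q}. real (count M x) * real x)"
      by (intro sum_mset_eq_sum_superset) (auto simp: msets_sum_le_def)
    then show "wt M * (real (\<Sum>\<^sub># M) * real (card (subsums M))) =
      (\<Sum>x\<in>{1..Q}. wt M * (real (count M x) * real x) * real (card (subsums M)))"
      by (simp only: sum_distrib_left sum_distrib_right mult.assoc)
  qed
  also have "\<dots> = (\<Sum>x\<in>{1..Q}. \<Sum>M\<in>msets_sum_le {1..Q} n. wt M * (real (count M x) * real x) * real (card (subsums M)))"
    by (rule sum.swap)
  also have "\<dots> \<le> (\<Sum>x\<in>{1..Q}. 2 * smooth_sum n Q)"
  proof (rule sum_mono)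
    fix x assume x: "x \<in> {1..Q}"
    have "(\<Sum>M\<in>msets_sum_le {1..Q} n. wt M * (real (count M x) * real x) * real (card (subsums M)))
      \<le> (\<Sum>M\<in>msets_sum_le {1..Q} n. wt M * (2 * real (card (subsums M))))"
    proof (rule sum_wt_marked_le[OF x])
      fix M
      show "real (card (subsums (add_mset x M))) \<le> 2 * real (card (subsums M))"
        using card_subsums_add_mset[of x M] by simp
    qed auto
    also have "\<dots> = 2 * smooth_sum n Q"
      by (simp add: smooth_sum_def sum_distrib_left mult_ac)
    finally show "(\<Sum>M\<in>msets_sum_le {1..Q} n. wt M * (real (count M x) * real x) * real (card (subsums M))) \<le> 2 * smooth_sum n Q" .
  qed
  finally show ?thesis by simp
qed

text \<open>For fixed \<open>M\<close> distinct \<open>z\<close> aim at distinct values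
  \<open>T - c * z\<close>, so at most \<open>card (subsums M)\<close> of them hit. If
  \<open>4 * Q <= k\<close>, a hit also forces the parts of \<open>M\<close> to add up to at least
  \<open>k - 2 * Q >= k / 2\<close>, and Markov's inequality with \<open>sum_weighted_smooth\<close>
  saves the factor \<open>Q / k\<close>.\<close>

lemma sum_hit_le:
  assumes k: "1 \<le> k" "k \<le> T" and c: "1 \<le> c" "c \<le> 2"
  shows "(\<Sum>z\<in>{z\<in>{1..Q}. Q < 2 * z}. \<Sum>M\<in>msets_sum_le {1..z} n. wt M * hit T (c * z) M)
    \<le> 4 * real Q / real k * smooth_sum n Q"
proof -
  define Z where "Z = {z\<in>{1..Q}. Q < 2 * z}"
  define P where "P = (\<lambda>M. k \<le> \<Sum>\<^sub># M + 2 * Q)"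
  have fZ: "finite Z" by (simp add: Z_def)
  have zs: "(\<Sum>z\<in>Z. hit T (c * z) M) \<le> of_bool (P M) * real (card (subsums M))" for M
  proof (cases "P M")
    case True
    have "(\<Sum>z\<in>Z. hit T (c * z) M) \<le> real (card (subsums M))"
      unfolding hit_def
    proof (rule sum_of_bool_card[where g = "\<lambda>z. T - c * z"])
      show "inj_on (\<lambda>z. T - c * z) {z \<in> Z. c * z \<le> T \<and> T - c * z \<in> subsums M}"
      proof (rule inj_onI)
        fix x y assume "x \<in> {z \<in> Z. c * z \<le> T \<and> T - c * z \<in> subsums M}"
          "y \<in> {z \<in> Z. c * z \<le> T \<and> T - c * z \<in> subsums M}" "T - c * x = T - c * y"
        then have "c * x = c * y" by (metis (lifting) diff_diff_cancel mem_Collect_eq)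
        then show "x = y" using c by simp
      qed
    qed (use fZ in auto)
    with True show ?thesis by simp
  next
    case False
    have "hit T (c * z) M = 0" if "z \<in> Z" for z
    proof (rule ccontr)
      assume "hit T (c * z) M \<noteq> 0"
      then have "c * z \<le> T" "T - c * z \<le> \<Sum>\<^sub># M" by (auto simp: hit_def intro: subsums_le split: if_splits)
      moreover have "c * z \<le> 2 * Q" using that c by (intro mult_mono) (auto simp: Z_def)
      ultimately show False using False k by (simp add: P_def)
    qed
    then show ?thesis by simp
  qed
  have "(\<Sum>z\<in>Z. \<Sum>M\<in>msets_sum_le {1..z} n. wt M * hit T (c * z) M)
    \<le> (\<Sum>z\<in>Z. \<Sum>M\<in>msets_sum_le {1..Q} n. wt M * hit T (c * z) M)"
    by (intro sum_mono sum_mono2[OF finite_msets_sum_le]) (auto simp: msets_sum_le_def Z_def)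
  also have "\<dots> = (\<Sum>M\<in>msets_sum_le {1..Q} n. wt M * (\<Sum>z\<in>Z. hit T (c * z) M))"
    unfolding sum_distrib_left by (rule sum.swap)
  also have "\<dots> \<le> (\<Sum>M\<in>msets_sum_le {1..Q} n. wt M * (of_bool (P M) * real (card (subsums M))))"
    by (intro sum_mono mult_left_mono zs) simp
  also have "\<dots> \<le> 4 * real Q / real k * smooth_sum n Q"
  proof (cases "k < 4 * Q")
    case True
    have "(\<Sum>M\<in>msets_sum_le {1..Q} n. wt M * (of_bool (P M) * real (card (subsums M)))) \<le> smooth_sum n Q"
      unfolding smooth_sum_def by (intro sum_mono mult_left_mono) auto
    also have "1 * smooth_sum n Q \<le> 4 * real Q / real k * smooth_sum n Q"
      using True k smooth_sum_nonneg by (intro mult_right_mono) auto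
    finally show ?thesis by simp
  next
    case False
    have "of_bool (P M) \<le> 2 / real k * real (\<Sum>\<^sub># M)" for M
    proof (cases "P M")
      case True
      then have "k \<le> 2 * \<Sum>\<^sub># M" using False by (simp add: P_def)
      then have "real k \<le> 2 * real (\<Sum>\<^sub># M)" by (metis of_nat_le_iff of_nat_mult of_nat_numeral)
      with True k show ?thesis by (simp add: field_simps del: of_nat_sum_mset)
    qed (simp del: of_nat_sum_mset)
    then have "(\<Sum>M\<in>msets_sum_le {1..Q} n. wt M * (of_bool (P M) * real (card (subsums M))))
      \<le> (\<Sum>M\<in>msets_sum_le {1..Q} n. wt M * ((2 / real k * real (\<Sum>\<^sub># M)) * real (card (subsums M))))"
      by (intro sum_mono mult_left_mono mult_right_mono) auto
    also have "\<dots> = 2 / real k * (\<Sum>M\<in>msets_sum_le {1..Q} n. wt M * (real (\<Sum>\<^sub># M) * real (card (subsums M))))"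
      by (simp add: sum_distrib_left mult_ac del: of_nat_sum_mset)
    also have "\<dots> \<le> 2 / real k * (2 * real Q * smooth_sum n Q)"
      by (intro mult_left_mono sum_weighted_smooth) auto
    finally show ?thesis by simp
  qed
  finally show ?thesis by (simp add: Z_def)
qed

lemma sum_dyadic_le:
  fixes \<phi> :: "nat \<Rightarrow> real"
  assumes "\<And>z. 0 \<le> \<phi> z"
  shows "(\<Sum>z\<in>{1..2^J}. \<phi> z) \<le> (\<Sum>j\<le>J. \<Sum>z\<in>{z\<in>{1..2^j}. 2^j < 2 * z}. \<phi> z)"
proof (induction J)
  case 0
  have "{z \<in> {1..2^0}. 2^0 < 2 * z} = {1..2^0::nat}" by auto
  then show ?case by simp
next
  case (Suc J)
  have "{1..2^Suc J :: nat} = {1..2^J} \<union> {z\<in>{1..2^Suc J}. 2^Suc J < 2 * z}" by auto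
  then have "(\<Sum>z\<in>{1..2^Suc J}. \<phi> z) = (\<Sum>z\<in>{1..2^J} \<union> {z\<in>{1..2^Suc J}. 2^Suc J < 2 * z}. \<phi> z)"
    by metis
  also have "\<dots> \<le> (\<Sum>z\<in>{1..2^J}. \<phi> z) + (\<Sum>z\<in>{z\<in>{1..2^Suc J}. 2^Suc J < 2 * z}. \<phi> z)"
    using assms by (subst sum.union_inter[symmetric]) (auto intro!: sum_nonneg)
  finally show ?case using Suc by simp
qed

text \<open>One factor \<open>1 / z\<close> comes from the marked part and one from the guaranteed
  part of length at least \<open>z\<close>. The constant is \<open>96 = 2 * 4 * 12\<close>: the
  targets \<open>k\<close> and \<open>n - k\<close>, the bound \<open>1 / z^2 <= 4 / 4 ^ j\<close>
  on a dyadic range, and three hit terms bounded with the factor 4 each.\<close>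

lemma inv_prop_upper:
  assumes k: "1 \<le> k" and n: "2 * k \<le> n" and J: "k \<le> 2 ^ J"
  shows "inv_prop n k \<le> 96 / real k * (\<Sum>j\<le>J. smooth_sum n (2 ^ j) / 2 ^ j)"
proof -
  define G where "G = (\<lambda>T z. \<Sum>M\<in>msets_sum_le {1..z} n. wt M * (2 * hit T (1 * z) M + hit T (2 * z) M))"
  have G0: "0 \<le> G T z" for T z unfolding G_def by (intro sum_nonneg) auto
  have one: "(\<Sum>N\<in>msets_sum {1..} n. wt N * (real (count N z) * of_bool (mark_ok T z (N - {#z#}))))
      \<le> G T z / (real z)\<^sup>2" if z: "z \<in> {1..k}" for z T
  proof -
    have "{M. add_mset z M \<in> msets_sum {1..} n} = msets_sum {1..} (n - z)"
      using z n by (auto simp: msets_sum_def)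
    then have "real z * (\<Sum>N\<in>msets_sum {1..} n. wt N * (real (count N z) * of_bool (mark_ok T z (N - {#z#}))))
      = (\<Sum>N\<in>msets_sum {1..} (n - z). wt N * of_bool (mark_ok T z N))"
      using sum_wt_marked[of "msets_sum {1..} n" z "\<lambda>N. of_bool (mark_ok T z N)"] z
      by (simp add: sum_distrib_left mult_ac)
    also have "\<dots> \<le> (\<Sum>M\<in>msets_sum_le {1..z} (n - z). wt M * (2 * hit T z M + hit T (2 * z) M)) / real z"
      using z by (intro sum_mark_ok) auto
    also have "\<dots> \<le> G T z / real z"
      unfolding G_def mult_1 by (intro divide_right_mono sum_mono2[OF finite_msets_sum_le]) (auto simp: msets_sum_le_def)
    finally show ?thesis using z by (simp add: field_simps power2_eq_square)
  qed
  have "inv_prop n k \<le> (\<Sum>N\<in>msets_sum {1..} n. wt N * (\<Sum>z\<in>{1..k}. real (count N z) *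
    (of_bool (mark_ok k z (N - {#z#})) + of_bool (mark_ok (n - k) z (N - {#z#})))))"
    unfolding inv_prop_eq
    by (intro sum_mono mult_left_mono subsums_marked) (use k n in auto)
  also have "\<dots> = (\<Sum>z\<in>{1..k}.
      (\<Sum>N\<in>msets_sum {1..} n. wt N * (real (count N z) * of_bool (mark_ok k z (N - {#z#})))) +
      (\<Sum>N\<in>msets_sum {1..} n. wt N * (real (count N z) * of_bool (mark_ok (n - k) z (N - {#z#})))))"
    unfolding sum_distrib_left sum.distrib[symmetric] distrib_left by (rule sum.swap)
  also have "\<dots> \<le> (\<Sum>z\<in>{1..k}. G k z / (real z)\<^sup>2 + G (n - k) z / (real z)\<^sup>2)"
    by (intro sum_mono add_mono one)
  also have "\<dots> \<le> (\<Sum>z\<in>{1..2^J}. G k z / (real z)\<^sup>2 + G (n - k) z / (real z)\<^sup>2)"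
    by (rule sum_mono2) (use J G0 in auto)
  also have "\<dots> \<le> (\<Sum>j\<le>J. \<Sum>z\<in>{z\<in>{1..2^j}. 2^j < 2 * z}. G k z / (real z)\<^sup>2 + G (n - k) z / (real z)\<^sup>2)"
    by (rule sum_dyadic_le) (use G0 in auto)
  also have "\<dots> \<le> (\<Sum>j\<le>J. 96 / real k * (smooth_sum n (2 ^ j) / 2 ^ j))"
  proof (rule sum_mono)
    fix j
    define Z where "Z = {z\<in>{1..2^j}. 2^j < 2 * (z::nat)}"
    have GZ: "(\<Sum>z\<in>Z. G T z) \<le> 12 * 2 ^ j / real k * smooth_sum n (2 ^ j)" if T: "k \<le> T" for T
    proof -
      have "(\<Sum>z\<in>Z. G T z) = 2 * (\<Sum>z\<in>Z. \<Sum>M\<in>msets_sum_le {1..z} n. wt M * hit T (1 * z) M) +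
        (\<Sum>z\<in>Z. \<Sum>M\<in>msets_sum_le {1..z} n. wt M * hit T (2 * z) M)"
        unfolding G_def by (simp add: sum_distrib_left sum.distrib algebra_simps)
      also have "\<dots> \<le> 2 * (4 * real (2 ^ j) / real k * smooth_sum n (2 ^ j)) +
          4 * real (2 ^ j) / real k * smooth_sum n (2 ^ j)"
        unfolding Z_def using k T by (intro add_mono mult_left_mono sum_hit_le) auto
      finally show ?thesis by (simp add: algebra_simps)
    qed
    have "(\<Sum>z\<in>Z. G k z / (real z)\<^sup>2 + G (n - k) z / (real z)\<^sup>2) \<le> (\<Sum>z\<in>Z. 4 / 4 ^ j * (G k z + G (n - k) z))"
    proof (rule sum_mono)
      fix z assume "z \<in> Z"
      then have "2 ^ j \<le> 2 * z" "0 < z" by (auto simp: Z_def)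
      then have "(2 ^ j :: real) \<le> 2 * real z" by (metis of_nat_le_iff of_nat_mult of_nat_numeral of_nat_power)
      then have "(2 ^ j :: real)\<^sup>2 \<le> (2 * real z)\<^sup>2" by (intro power_mono) auto
      then have "4 ^ j \<le> 4 * (real z)\<^sup>2" by (simp add: power_mult_distrib power2_eq_square flip: power_mult_distrib)
      then have "1 / (real z)\<^sup>2 \<le> 4 / 4 ^ j" using \<open>0 < z\<close> by (simp add: field_simps)
      then have "1 / (real z)\<^sup>2 * (G k z + G (n - k) z) \<le> 4 / 4 ^ j * (G k z + G (n - k) z)"
        using G0 by (intro mult_right_mono) auto
      then show "G k z / (real z)\<^sup>2 + G (n - k) z / (real z)\<^sup>2 \<le> 4 / 4 ^ j * (G k z + G (n - k) z)"
        by (simp add: add_divide_distrib)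
    qed
    also have "\<dots> = 4 / 4 ^ j * ((\<Sum>z\<in>Z. G k z) + (\<Sum>z\<in>Z. G (n - k) z))"
      by (simp only: sum_distrib_left[symmetric] sum.distrib)
    also have "\<dots> \<le> 4 / 4 ^ j * (12 * 2 ^ j / real k * smooth_sum n (2 ^ j) + 12 * 2 ^ j / real k * smooth_sum n (2 ^ j))"
      using n by (intro mult_left_mono add_mono GZ) auto
    also have "\<dots> = 96 / real k * (smooth_sum n (2 ^ j) / 2 ^ j)"
    proof -
      have "(4::real) ^ j = 2 ^ j * 2 ^ j" by (simp flip: power_mult_distrib)
      then show ?thesis by (simp add: field_simps)
    qed
    finally show "(\<Sum>z\<in>{z\<in>{1..2^j}. 2^j < 2 * z}. G k z / (real z)\<^sup>2 + G (n - k) z / (real z)\<^sup>2)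
      \<le> 96 / real k * (smooth_sum n (2 ^ j) / 2 ^ j)" by (simp add: Z_def)
  qed
  finally show ?thesis by (simp add: sum_distrib_left)
qed

section \<open>First-passage weights\<close>

text \<open>
  The total weight \<open>\<Prod> 1 / b!\<close> of all paths with steps \<open>b - 1\<close>, \<open>b \<ge> 0\<close>, that start at \<open>h\<close> and
  reach \<open>0\<close> for the first time after \<open>L\<close> steps. In this closed form the first-step recursion is an
  Abel-type binomial identity.
\<close>

definition hits :: "nat \<Rightarrow> nat \<Rightarrow> real" where
  "hits h L = (if L = 0 then of_bool (h = 0)
     else if h \<le> L then real h / real L * real L ^ (L - h) / fact (L - h) else 0)"

lemma hits_nonneg [simp]: "0 \<le> hits h L"
  by (simp add: hits_def)

lemma hits_0_left [simp]: "hits 0 (Suc L) = 0"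
  by (simp add: hits_def)

lemma hits_1: "hits h 1 = of_bool (h = 1)"
  by (auto simp: hits_def)

lemma hits_eq_0: "L < h \<Longrightarrow> hits h L = 0"
  by (auto simp: hits_def)

lemma hits_pos: "1 \<le> h \<Longrightarrow> h \<le> L \<Longrightarrow> 0 < hits h L"
  by (auto simp: hits_def)

lemma sum_binomial_weighted:
  fixes x :: real
  assumes "N \<ge> 1"
  shows "(\<Sum>b\<le>N. real b * (real (N choose b) * x ^ (N - b))) = real N * (1 + x) ^ (N - 1)"
proof -
  obtain K where N: "N = Suc K" using assms by (cases N) auto
  have "(\<Sum>b\<le>N. real b * (real (N choose b) * x ^ (N - b))) =
      (\<Sum>b\<le>K. real (Suc b) * (real (N choose Suc b) * x ^ (K - b)))"
    unfolding N by (subst sum.atMost_Suc_shift) simp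
  also have "\<dots> = (\<Sum>b\<le>K. real N * (real (K choose b) * 1 ^ b * x ^ (K - b)))"
  proof (rule sum.cong[OF refl])
    fix b
    have "Suc b * (N choose Suc b) = N * (K choose b)"
      unfolding N by (rule Suc_times_binomial)
    then have "real (Suc b) * real (N choose Suc b) = real N * real (K choose b)"
      by (metis of_nat_mult)
    then show "real (Suc b) * (real (N choose Suc b) * x ^ (K - b)) = real N * (real (K choose b) * 1 ^ b * x ^ (K - b))"
      by (simp add: mult.assoc[symmetric])
  qed
  also have "\<dots> = real N * (1 + x) ^ K"
    by (simp add: binomial_ring[of 1 x K] sum_distrib_left)
  finally show ?thesis by (simp add: N)
qed

text \<open>Clearing \<open>L * fact N\<close> turns the right-hand side into the binomial theorem
  and its derivative at \<open>1 + L\<close>; they combine because \<open>L = g + N\<close> gives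
  \<open>g * (1 + L) + N = (g + 1) * L\<close>. Cutting the sum at \<open>n >= L\<close> loses
  nothing, as a walk above \<open>L\<close> cannot come down to 0 in \<open>L\<close> steps.\<close>

lemma hits_Suc:
  assumes h: "1 \<le> h" and n: "L \<le> n"
  shows "hits h (Suc L) = (\<Sum>b\<le>n. hits (h - 1 + b) L / fact b)"
proof (cases "L = 0")
  case True
  have "(\<Sum>b\<le>n. hits (h - 1 + b) L / fact b) = (\<Sum>b\<le>n. if b = 0 then of_bool (h = 1) else 0)"
    by (rule sum.cong[OF refl]) (use h True in \<open>auto simp: hits_def\<close>)
  then show ?thesis using True by (auto simp: hits_def)
next
  case L: False
  show ?thesis
  proof (cases "h - 1 \<le> L")
    case False
    then have "hits (h - 1 + b) L = 0" for b by (intro hits_eq_0) auto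
    moreover have "hits h (Suc L) = 0" using False by (intro hits_eq_0) auto
    ultimately show ?thesis by simp
  next
    case True
    define g where "g = h - 1"
    define N where "N = L - g"
    have hg: "h = Suc g" and gL: "g \<le> L" "L = g + N" using h True by (auto simp: g_def N_def)
    have "(\<Sum>b\<le>n. hits (g + b) L / fact b) = (\<Sum>b\<le>N. hits (g + b) L / fact b)"
      by (rule sum.mono_neutral_right) (use n gL in \<open>auto intro!: hits_eq_0\<close>)
    also have "\<dots> = (\<Sum>b\<le>N. (real g + real b) * (real (N choose b) * real L ^ (N - b)) / (real L * fact N))"
    proof (rule sum.cong[OF refl])
      fix b assume b: "b \<in> {..N}"
      then have "L - (g + b) = N - b" "g + b \<le> L" using gL by auto
      then have "hits (g + b) L / fact b = (real g + real b) / real L * real L ^ (N - b) / (fact (N - b) * fact b)"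
        using L by (simp add: hits_def)
      moreover have "real (N choose b) = fact N / (fact b * fact (N - b))"
        using b by (simp add: binomial_fact)
      then have "(real g + real b) * (real (N choose b) * real L ^ (N - b)) / (real L * fact N) =
          (real g + real b) / real L * real L ^ (N - b) / (fact (N - b) * fact b)"
        by simp
      ultimately show "hits (g + b) L / fact b = (real g + real b) * (real (N choose b) * real L ^ (N - b)) / (real L * fact N)"
        by simp
    qed
    also have "\<dots> = (real g * (\<Sum>b\<le>N. real (N choose b) * real L ^ (N - b)) +
        (\<Sum>b\<le>N. real b * (real (N choose b) * real L ^ (N - b)))) / (real L * fact N)"
      by (simp add: sum_divide_distrib[symmetric] distrib_right sum.distrib sum_distrib_left)
    also have "(\<Sum>b\<le>N. real (N choose b) * real L ^ (N - b)) = (1 + real L) ^ N"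
      using binomial_ring[of "1::real" "real L" N] by simp
    also have "(\<Sum>b\<le>N. real b * (real (N choose b) * real L ^ (N - b))) = real N * (1 + real L) ^ (N - 1)"
      by (cases "N = 0") (auto simp: sum_binomial_weighted)
    also have "(real g * (1 + real L) ^ N + real N * (1 + real L) ^ (N - 1)) / (real L * fact N) =
        hits h (Suc L)"
    proof (cases N)
      case 0
      then show ?thesis using L gL by (simp add: hits_def hg)
    next
      case (Suc K)
      have "real g * (1 + real L) ^ N + real N * (1 + real L) ^ (N - 1) =
          (1 + real L) ^ K * (real g * (1 + real L) + real N)" by (simp add: Suc algebra_simps)
      also have "real g * (1 + real L) + real N = (real g + 1) * real L"
        using gL by (simp add: algebra_simps)
      finally have "(real g * (1 + real L) ^ N + real N * (1 + real L) ^ (N - 1)) / (real L * fact N) =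
          (1 + real L) ^ K * (real g + 1) / fact N" using L by simp
      also have "\<dots> = hits h (Suc L)"
      proof -
        have "Suc L - h = Suc K" using gL hg Suc by simp
        then have "hits h (Suc L) = (real g + 1) / real (Suc L) * real (Suc L) ^ Suc K / fact N"
          using gL by (simp only: hits_def hg Suc) simp
        also have "\<dots> = real (Suc L) ^ K * (real g + 1) / fact N" by simp
        finally show ?thesis by simp
      qed
      finally show ?thesis .
    qed
    finally show ?thesis by (simp add: g_def)
  qed
qed

lemma hits_Suc_ge: "1 \<le> h \<Longrightarrow> (\<Sum>b\<le>n. hits (h - 1 + b) L / fact b) \<le> hits h (Suc L)"
proof -
  assume h: "1 \<le> h"
  have "(\<Sum>b\<le>n. hits (h - 1 + b) L / fact b) \<le> (\<Sum>b\<le>n + L. hits (h - 1 + b) L / fact b)"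
    by (rule sum_mono2) auto
  then show ?thesis using hits_Suc[OF h, of L "n + L"] by simp
qed

section \<open>Stirling's formula with explicit constants\<close>

definition stirling_err :: "nat \<Rightarrow> real" where
  "stirling_err n = ln (fact n) + real n - (real n + 1/2) * ln (real n)"

lemma stirling_err_Suc:
  "stirling_err n - stirling_err (Suc n) = (real n + 1/2) * (ln (real n + 1) - ln (real n)) - 1"
proof -
  have "ln (fact (Suc n) :: real) = ln (real (Suc n) * fact n)" by simp
  also have "\<dots> = ln (real (Suc n)) + ln (fact n)" by (subst ln_mult) auto
  finally show ?thesis unfolding stirling_err_def by (simp add: algebra_simps)
qed

text \<open>The error equals 1 at \<open>n = 1\<close> and decreases. By the trapezoidal bound for
  the logarithm each decrease is at most \<open>1 / (4 * n) - 1 / (4 * (n + 1))\<close>, which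
  telescopes; this explains the extra term carried through the induction.\<close>

lemma stirling_err_bounds:
  assumes "1 \<le> n"
  shows "0 \<le> stirling_err n" "stirling_err n \<le> 1"
proof -
  have "3/4 + 1 / (4 * real n) \<le> stirling_err n \<and> stirling_err n \<le> 1"
    using assms
  proof (induction n rule: dec_induct)
    case base
    show ?case by (simp add: stirling_err_def)
  next
    case (step n)
    have n: "real n \<ge> 1" using step by simp
    have d: "stirling_err n - stirling_err (Suc n) = (real n + 1/2) * (ln (real n + 1) - ln (real n)) - 1"
      by (rule stirling_err_Suc)
    have "(real n + 1/2) * (ln (real n + 1) - ln (real n)) \<le>
        (real n + 1/2) * (1 * (inverse (real n) + inverse (real n + 1)) / 2)"
      using n by (intro mult_left_mono ln_inverse_approx_le) auto
    also have "\<dots> = 1 + 1 / (4 * real n) - 1 / (4 * real (Suc n))"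
      using n by (simp add: divide_simps) (simp add: algebra_simps)
    finally have u: "stirling_err n - stirling_err (Suc n) \<le> 1 / (4 * real n) - 1 / (4 * real (Suc n))"
      using d by simp
    have "1 = (real n + 1/2) * (2 * ((real n + 1) - real n) / (real n + (real n + 1)))"
      using n by (simp add: divide_simps)
    also have "\<dots> \<le> (real n + 1/2) * (ln (real n + 1) - ln (real n))"
      using n by (intro mult_left_mono ln_inverse_approx_ge) auto
    finally show ?case using u d step.IH by linarith
  qed
  moreover have "0 \<le> 1 / (4 * real n)" by simp
  ultimately show "0 \<le> stirling_err n" "stirling_err n \<le> 1" by linarith+
qed

lemma fact_stirling:
  assumes "1 \<le> n"
  shows "sqrt (real n) * real n ^ n / exp (real n) \<le> fact n"
    and "fact n \<le> exp 1 * (sqrt (real n) * real n ^ n / exp (real n))"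
proof -
  have n: "0 < real n" using assms by simp
  define s where "s = sqrt (real n) * real n ^ n / exp (real n)"
  have s: "0 < s" using n by (simp add: s_def)
  have "ln s = (real n + 1/2) * ln (real n) - real n"
    unfolding s_def using n by (simp add: ln_div ln_mult ln_sqrt ln_realpow algebra_simps)
  then have e: "stirling_err n = ln (fact n) - ln s" by (simp add: stirling_err_def)
  show "s \<le> fact n"
    using stirling_err_bounds(1)[OF assms] e s by (simp flip: ln_le_cancel_iff)
  have "ln (fact n) \<le> ln (exp 1 * s)"
    using stirling_err_bounds(2)[OF assms] e s by (simp add: ln_mult)
  then show "fact n \<le> exp 1 * s" using s by (subst (asm) ln_le_cancel_iff) auto
qed

definition decay :: "nat \<Rightarrow> real" where
  "decay m = 1 / (real m * sqrt (real m))"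

lemma decay_nonneg [simp]: "0 \<le> decay m"
  by (simp add: decay_def)

lemma decay_antimono: "1 \<le> m \<Longrightarrow> m \<le> n \<Longrightarrow> decay n \<le> decay m"
  unfolding decay_def by (intro divide_left_mono mult_mono) auto

text \<open>The quotient of consecutive terms is \<open>L / (N + 1)\<close>, which is at least 1 up
  to \<open>N = L\<close>: Poisson weights of mean \<open>L\<close> peak there.\<close>

lemma power_over_fact_le: "N \<le> L \<Longrightarrow> real L ^ N / fact N \<le> real L ^ L / fact L"
proof (induction "L - N" arbitrary: N)
  case (Suc d)
  then have "d = L - Suc N" "Suc N \<le> L" by auto
  from Suc.hyps(1)[OF this] have IH: "real L ^ Suc N / fact (Suc N) \<le> real L ^ L / fact L" .
  have "real L ^ N / fact N = real L ^ N / fact N * 1" by simp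
  also have "\<dots> \<le> real L ^ N / fact N * (real L / real (Suc N))"
    using \<open>Suc N \<le> L\<close> by (intro mult_left_mono) auto
  also have "\<dots> = real L ^ Suc N / fact (Suc N)" by (simp add: field_simps)
  finally show ?case using IH by simp
qed simp

lemma hits_upper:
  assumes "1 \<le> L"
  shows "hits h L \<le> real h * exp (real L) * decay L"
proof (cases "h \<le> L")
  case True
  have L: "0 < real L" using assms by simp
  have "real L ^ L / fact L \<le> real L ^ L / (sqrt (real L) * real L ^ L / exp (real L))"
    using fact_stirling(1)[OF assms] L by (intro divide_left_mono) auto
  also have "\<dots> = exp (real L) / sqrt (real L)" using L by simp
  finally have b: "real L ^ (L - h) / fact (L - h) \<le> exp (real L) / sqrt (real L)"
    using power_over_fact_le[of "L - h" L] by simp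
  have "hits h L = real h / real L * (real L ^ (L - h) / fact (L - h))"
    using True assms by (simp add: hits_def)
  also have "\<dots> \<le> real h / real L * (exp (real L) / sqrt (real L))"
    by (intro mult_left_mono b) auto
  finally show ?thesis by (simp add: decay_def)
qed (simp add: hits_eq_0)

lemma hits_diag_lower:
  assumes "1 \<le> L"
  shows "exp (real L) * decay L / exp 1 \<le> hits 1 L"
proof -
  have L: "0 < real L" using assms by simp
  have f: "(fact L :: real) = real L * fact (L - 1)" using assms by (simp add: fact_reduce)
  have p: "real L ^ L = real L * real L ^ (L - 1)" using assms by (simp add: power_eq_if)
  have "exp (real L) * decay L / exp 1 = real L ^ L / (exp 1 * (sqrt (real L) * real L ^ L / exp (real L))) / real L"
    using L by (simp add: decay_def)
  also have "\<dots> \<le> real L ^ L / fact L / real L"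
    using fact_stirling(2)[OF assms] L by (intro divide_right_mono divide_left_mono) auto
  also have "\<dots> = hits 1 L"
    unfolding f p using assms L by (simp add: hits_def)
  finally show ?thesis .
qed

lemma hits_double_lower:
  assumes "1 \<le> D"
  shows "exp (2 * real D) * (2 / exp 1) ^ D / (2 * exp 1 * real D) \<le> hits D (2 * D)"
proof -
  have D: "0 < real D" using assms by simp
  have "sqrt (real D) \<le> sqrt (real D) * sqrt (real D)"
    using assms mult_left_mono[of 1 "sqrt (real D)" "sqrt (real D)"] by simp
  then have sq: "sqrt (real D) \<le> real D" using D by simp
  have "fact D \<le> exp 1 * (sqrt (real D) * real D ^ D / exp (real D))"
    by (rule fact_stirling(2)[OF assms])
  also have "\<dots> \<le> exp 1 * (real D * real D ^ D / exp (real D))"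
    using sq by (intro mult_left_mono divide_right_mono mult_right_mono) auto
  finally have f: "fact D \<le> exp 1 * (real D * real D ^ D / exp (real D))" .
  have e: "exp (2 * real D) = exp (real D) * exp (real D)" by (simp flip: exp_add)
  have e2: "exp (1::real) ^ D = exp (real D)" by (simp flip: exp_of_nat_mult)
  have "exp (2 * real D) * (2 / exp 1) ^ D / (2 * exp 1 * real D) =
      1 / 2 * ((2 * real D) ^ D / (exp 1 * (real D * real D ^ D / exp (real D))))"
    unfolding e using D by (simp add: power_divide e2 power_mult_distrib mult_ac)
  also have "\<dots> \<le> 1 / 2 * ((2 * real D) ^ D / fact D)"
    using f D by (intro mult_left_mono divide_left_mono) auto
  also have "\<dots> = hits D (2 * D)"
    using D by (simp add: hits_def)
  finally show ?thesis .
qed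

section \<open>Sums over walks\<close>

text \<open>The cap \<open>n\<close> on the entries keeps the set finite; the upper bounds on walk
  sums hold uniformly in \<open>n\<close>.\<close>

definition count_lists :: "nat \<Rightarrow> nat \<Rightarrow> nat list set" where
  "count_lists n m = {us. set us \<subseteq> {..n} \<and> length us = m}"

lemma count_lists_0 [simp]: "count_lists n 0 = {[]}"
  by (auto simp: count_lists_def)

lemma finite_count_lists [simp]: "finite (count_lists n m)"
  unfolding count_lists_def by (rule finite_lists_length_eq) simp

lemma sum_count_lists_Suc:
  "(\<Sum>us\<in>count_lists n (Suc m). f us) = (\<Sum>u\<le>n. \<Sum>us\<in>count_lists n m. f (u # us))"
proof -
  have "(\<Sum>u\<le>n. \<Sum>us\<in>count_lists n m. f (u # us)) = (\<Sum>(u, us)\<in>{..n} \<times> count_lists n m. f (u # us))"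
    by (rule sum.cartesian_product)
  also have "\<dots> = (\<Sum>us\<in>count_lists n (Suc m). f us)"
    by (rule sum.reindex_bij_witness[of _ "\<lambda>us. (hd us, tl us)" "\<lambda>(u, us). u # us"])
       (auto simp: count_lists_def length_Suc_conv)
  finally show ?thesis ..
qed

text \<open>
  Lists of block counts have the last block at their head, so \<open>walk\<close> runs backwards in time; it is
  killed when it hits \<open>0\<close> before the end of the list.
\<close>

fun walk :: "(nat \<Rightarrow> real) \<Rightarrow> nat \<Rightarrow> nat list \<Rightarrow> real" where
  "walk \<phi> x [] = \<phi> x"
| "walk \<phi> x (u # us) = (if x = 0 then 0 else walk \<phi> (x - 1 + u) us / fact u)"

definition walk_sum :: "nat \<Rightarrow> (nat \<Rightarrow> real) \<Rightarrow> nat \<Rightarrow> nat \<Rightarrow> real" where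
  "walk_sum n \<phi> x m = (\<Sum>us\<in>count_lists n m. walk \<phi> x us)"

lemma walk_sum_0 [simp]: "walk_sum n \<phi> x 0 = \<phi> x"
  by (simp add: walk_sum_def)

lemma walk_sum_Suc:
  "walk_sum n \<phi> x (Suc m) = (if x = 0 then 0 else \<Sum>u\<le>n. walk_sum n \<phi> (x - 1 + u) m / fact u)"
  by (simp add: walk_sum_def sum_count_lists_Suc sum_divide_distrib)

lemma walk_nonneg: "(\<And>y. 0 \<le> \<phi> y) \<Longrightarrow> 0 \<le> walk \<phi> x us"
  by (induction us arbitrary: x) auto

text \<open>One step of the walk raises every length \<open>l i\<close> by one, by
  \<open>hits_Suc_ge\<close>. To bound a walk with an arbitrary terminal reward it therefore
  suffices to dominate the reward by a combination of \<open>hits\<close>, at the positions that can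
  be reached.\<close>

lemma walk_sum_le_hits:
  fixes c :: "'i \<Rightarrow> real"
  assumes "finite I" "\<And>i. i \<in> I \<Longrightarrow> 0 \<le> c i"
    and "\<And>y. y \<le> x + n * m \<Longrightarrow> \<phi> y \<le> (\<Sum>i\<in>I. c i * hits y (l i))"
  shows "walk_sum n \<phi> x m \<le> (\<Sum>i\<in>I. c i * hits x (m + l i))"
  using assms(3)
proof (induction m arbitrary: x)
  case (Suc m)
  show ?case
  proof (cases "x = 0")
    case True
    then show ?thesis using assms by (auto simp: walk_sum_Suc intro!: sum_nonneg mult_nonneg_nonneg)
  next
    case False
    have "walk_sum n \<phi> x (Suc m) \<le> (\<Sum>u\<le>n. (\<Sum>i\<in>I. c i * hits (x - 1 + u) (m + l i)) / fact u)"
      using False unfolding walk_sum_Suc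
      by (auto intro!: sum_mono divide_right_mono Suc.IH Suc.prems)
    also have "\<dots> = (\<Sum>i\<in>I. c i * (\<Sum>u\<le>n. hits (x - 1 + u) (m + l i) / fact u))"
      unfolding sum_divide_distrib sum_distrib_left by (subst sum.swap) simp
    also have "\<dots> \<le> (\<Sum>i\<in>I. c i * hits x (Suc (m + l i)))"
      using False assms by (intro sum_mono mult_left_mono hits_Suc_ge) auto
    finally show ?thesis by simp
  qed
qed simp

text \<open>A surviving walk that ends at 1 reaches 0 by one further step with count 0, whose weight
  is 1.\<close>

lemma walk_sum_return:
  "m \<le> n \<Longrightarrow> walk_sum n (\<lambda>x. of_bool (x = 1)) x m = hits x (Suc m)"
proof (induction m arbitrary: x)
  case 0
  show ?case using hits_1[of x] by simp
next
  case (Suc m)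
  then show ?case using hits_Suc[of x "Suc m" n] by (auto simp: walk_sum_Suc)
qed

lemma walk_sum_return_le: "walk_sum n (\<lambda>x. of_bool (x = 1)) x m \<le> hits x (Suc m)"
  using walk_sum_le_hits[of "{()}" "\<lambda>_. 1" x n m "\<lambda>x. of_bool (x = 1)" "\<lambda>_. 1"]
  by (simp add: hits_1[simplified])

section \<open>The mean of a discounted sum of counts along a killed walk\<close>

lemma sum_inverse_fact: "(\<Sum>u\<le>n. 1 / fact u) \<le> exp (1::real)"
proof -
  have "(\<lambda>u. 1 / fact u) sums exp (1::real)"
    using exp_converges[of "1::real"] by (simp add: inverse_eq_divide)
  then show ?thesis using sum_le_suminf[of "\<lambda>u. 1 / fact u :: real" "{..n}"]
    by (simp add: sums_iff)
qed

lemma sum_nat_over_fact: "(\<Sum>u\<le>n. real u / fact u) \<le> exp (1::real)"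
proof (cases n)
  case (Suc k)
  have "(\<Sum>u\<le>n. real u / fact u) = (\<Sum>u\<le>k. real (Suc u) / fact (Suc u))"
    unfolding Suc by (subst sum.atMost_Suc_shift) simp
  also have "\<dots> = (\<Sum>u\<le>k. 1 / fact u)"
    by (rule sum.cong) (simp_all add: divide_simps)
  finally show ?thesis using sum_inverse_fact[of k] by simp
qed simp

lemma sum_nat_sq_over_fact: "(\<Sum>u\<le>n. real u * real u / fact u) \<le> 2 * exp (1::real)"
proof (cases n)
  case (Suc k)
  have "(\<Sum>u\<le>n. real u * real u / fact u) = (\<Sum>u\<le>k. real (Suc u) * real (Suc u) / fact (Suc u))"
    unfolding Suc by (subst sum.atMost_Suc_shift) simp
  also have "\<dots> = (\<Sum>u\<le>k. real u / fact u + 1 / fact u)"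
    by (rule sum.cong) (simp_all add: divide_simps)
  finally show ?thesis using sum_inverse_fact[of k] sum_nat_over_fact[of k] by (simp add: sum.distrib)
qed simp

lemma decay_ratio: "decay (m + 2) \<le> 1.85 * decay (m + 3)"
proof -
  have "sqrt (real (m + 3)) \<le> sqrt (1.23\<^sup>2 * real (m + 2))"
    by (rule real_sqrt_le_mono) (simp add: power2_eq_square)
  also have "\<dots> = 1.23 * sqrt (real (m + 2))" by (simp add: real_sqrt_mult)
  finally have s: "sqrt (real (m + 3)) \<le> 1.23 * sqrt (real (m + 2))" .
  have "real (m + 3) * sqrt (real (m + 3)) \<le> (1.5 * real (m + 2)) * (1.23 * sqrt (real (m + 2)))"
    by (intro mult_mono s) auto
  also have "\<dots> \<le> 1.85 * (real (m + 2) * sqrt (real (m + 2)))" by simp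
  finally have "real (m + 3) * sqrt (real (m + 3)) \<le> 1.85 * (real (m + 2) * sqrt (real (m + 2)))" .
  moreover have "0 < real (m + 2) * sqrt (real (m + 2))" "0 < real (m + 3) * sqrt (real (m + 3))" by auto
  ultimately show ?thesis unfolding decay_def by (simp add: divide_simps del: of_nat_add)
qed

text \<open>\<open>2 ^ length us * damped us\<close> exceeds the sum of all parts in blocks with counts \<open>us\<close>.\<close>

fun damped :: "nat list \<Rightarrow> real" where
  "damped [] = 1"
| "damped (u # us) = real u + damped us / 2"

lemma damped_nonneg [simp]: "0 \<le> damped us"
  by (induction us) auto

text \<open>The latest count has bounded mean and everything older is halved, so the mean satisfies
  a contracting recursion. With the constant 50, halving gives 25, the step gives
  \<open>26 * x + 1 <= 27 * x\<close>, the factor \<open>exp 1\<close> is absorbed in the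
  exponential, and the change of \<open>decay\<close> costs 1.85; the induction closes because
  \<open>27 * 1.85 < 50\<close>.\<close>

lemma sum_walk_damped:
  assumes \<phi>: "\<And>y. 0 \<le> \<phi> y" and C: "0 \<le> C"
    and bound: "\<And>x m. walk_sum n \<phi> x m \<le> C * real x * exp (real m) * decay (m + 2)"
  shows "(\<Sum>us\<in>count_lists n m. walk \<phi> x us * damped us) \<le> 50 * C * real x * exp (real m) * decay (m + 2)"
proof (induction m arbitrary: x)
  case 0
  have "walk_sum n \<phi> x 0 \<le> C * real x * exp (real 0) * decay (0 + 2)" by (rule bound)
  moreover have "0 \<le> C * real x * decay 2" using C by simp
  ultimately show ?case by (simp add: numeral_2_eq_2)
next
  case (Suc m)
  show ?case
  proof (cases "x = 0")
    case True
    then show ?thesis by (simp add: sum_count_lists_Suc)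
  next
    case False
    define K where "K = C * exp (real m) * decay (m + 2)"
    have K: "0 \<le> K" using C by (simp add: K_def)
    have x1: "1 \<le> real x" and rx: "real (x - 1 + u) = real x - 1 + real u" for u using False by auto
    have "(\<Sum>us\<in>count_lists n (Suc m). walk \<phi> x us * damped us) =
      (\<Sum>u\<le>n. real u / fact u * walk_sum n \<phi> (x - 1 + u) m +
        (\<Sum>us\<in>count_lists n m. walk \<phi> (x - 1 + u) us * damped us) / (2 * fact u))"
      using False unfolding sum_count_lists_Suc walk_sum_def
      by (simp add: sum_divide_distrib sum_distrib_left sum.distrib[symmetric] distrib_left divide_simps)
         (intro sum.cong refl; simp add: algebra_simps)
    also have "\<dots> \<le> (\<Sum>u\<le>n. real u / fact u * (C * real (x - 1 + u) * exp (real m) * decay (m + 2)) +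
        (50 * C * real (x - 1 + u) * exp (real m) * decay (m + 2)) / (2 * fact u))"
      by (intro sum_mono add_mono mult_left_mono divide_right_mono bound Suc.IH) auto
    also have "\<dots> = (\<Sum>u\<le>n. K * ((real x - 1) * (real u / fact u) + real u * real u / fact u +
         25 * (real x - 1) * (1 / fact u) + 25 * (real u / fact u)))"
      unfolding rx K_def by (rule sum.cong[OF refl]) (simp add: field_simps)
    also have "\<dots> = K * ((real x - 1) * (\<Sum>u\<le>n. real u / fact u) + (\<Sum>u\<le>n. real u * real u / fact u) +
         25 * (real x - 1) * (\<Sum>u\<le>n. 1 / fact u) + 25 * (\<Sum>u\<le>n. real u / fact u))"
      by (simp only: sum.distrib sum_distrib_left[symmetric])
    also have "\<dots> \<le> K * ((real x - 1) * exp 1 + 2 * exp 1 + 25 * (real x - 1) * exp 1 + 25 * exp 1)"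
      using x1 K by (intro mult_left_mono add_mono sum_inverse_fact sum_nat_over_fact sum_nat_sq_over_fact) auto
    also have "\<dots> = K * exp 1 * (26 * real x + 1)" by (simp add: algebra_simps)
    also have "\<dots> \<le> K * exp 1 * (27 * real x)"
      using x1 K by (intro mult_left_mono) auto
    also have "\<dots> = 27 * C * real x * exp (real (Suc m)) * decay (m + 2)"
      unfolding K_def by (simp add: exp_add mult_ac)
    also have "\<dots> \<le> 27 * C * real x * exp (real (Suc m)) * (1.85 * decay (m + 3))"
      using C by (intro mult_left_mono decay_ratio) auto
    also have "\<dots> \<le> 50 * C * real x * exp (real (Suc m)) * decay (m + 3)"
    proof -
      have "0 \<le> C * real x * exp (real (Suc m)) * decay (m + 3)" using C by simp
      then show ?thesis by simp
    qed
    finally show ?thesis by (simp add: numeral_3_eq_3)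
  qed
qed

section \<open>Walks with an exponential reward at the end\<close>

lemma sum_sq_geometric_bounded:
  fixes \<rho> :: real
  assumes "0 \<le> \<rho>" "\<rho> < 1"
  shows "\<exists>C>0. \<forall>X. (\<Sum>y\<le>X. real (y + 1) * real (y + 1) * \<rho> ^ y) \<le> C"
proof -
  have s0: "summable (\<lambda>n. (\<lambda>_. 1) n * x ^ n)" if "norm x < 1" for x :: real
    using summable_geometric[OF that] by simp
  have s1: "summable (\<lambda>n. diffs (\<lambda>_. 1) n * x ^ n)" if "norm x < 1" for x :: real
    by (rule termdiff_converges[OF that s0])
  have s2: "summable (\<lambda>n. diffs (diffs (\<lambda>_. 1)) n * \<rho> ^ n)"
    by (rule termdiff_converges[where K = 1, OF _ s1]) (use assms in auto)
  define a where "a = (\<lambda>n. diffs (diffs (\<lambda>_. 1)) n * \<rho> ^ n)"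
  have sa: "summable a" using s2 by (simp add: a_def)
  have a: "a n = real (n + 1) * real (n + 2) * \<rho> ^ n" for n
    by (simp add: a_def diffs_def algebra_simps)
  have "(\<Sum>y\<le>X. real (y + 1) * real (y + 1) * \<rho> ^ y) \<le> suminf a" for X
  proof -
    have "(\<Sum>y\<le>X. real (y + 1) * real (y + 1) * \<rho> ^ y) \<le> (\<Sum>y\<le>X. a y)"
      unfolding a using assms by (intro sum_mono mult_right_mono mult_left_mono) auto
    also have "\<dots> \<le> suminf a"
      by (rule sum_le_suminf[OF sa]) (use assms in \<open>auto simp: a\<close>)
    finally show ?thesis .
  qed
  then have "\<forall>X. (\<Sum>y\<le>X. real (y + 1) * real (y + 1) * \<rho> ^ y) \<le> max 1 (suminf a)"
    by (meson max.coboundedI2)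
  then show ?thesis by (intro exI[of _ "max 1 (suminf a)"]) auto
qed

text \<open>
  A path from \<open>x\<close> that is at \<open>D\<close> after \<open>m\<close> steps, followed by a first passage from \<open>D\<close> to \<open>0\<close> of
  length \<open>2 * D\<close>, is a first passage of length \<open>m + 2 * D\<close>. Hence the weight of the former paths is at
  most \<open>hits x (m + 2 * D) / hits D (2 * D)\<close>, which loses only a factor \<open>(e / 2) ^ D\<close>; this is
  harmless because \<open>e * ln 2 / 2 < 1\<close> in the upper bound and \<open>e / 4 < 1\<close> in the lower bound.
\<close>

lemma inverse_hits_double:
  assumes "1 \<le> D"
  shows "1 / hits D (2 * D) \<le> 2 * exp 1 * real D * (exp 1 / 2) ^ D / exp (2 * real D)"
proof -
  have "1 / hits D (2 * D) \<le> 1 / (exp (2 * real D) * (2 / exp 1) ^ D / (2 * exp 1 * real D))"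
    using hits_double_lower[OF assms] assms hits_pos[of D "2 * D"] by (intro divide_left_mono) auto
  also have "\<dots> = 2 * exp 1 * real D * (exp 1 / 2) ^ D / exp (2 * real D)"
    using assms by (simp add: power_divide mult_ac)
  finally show ?thesis .
qed

lemma hits_ratio_le:
  assumes D: "1 \<le> D"
  shows "hits x (m + 2 * D) / hits D (2 * D) \<le>
    real x * exp (real m) * decay (m + 2) * (2 * exp 1 * real D * (exp 1 / 2) ^ D)"
proof -
  have "hits x (m + 2 * D) \<le> real x * exp (real (m + 2 * D)) * decay (m + 2 * D)"
    using D by (intro hits_upper) auto
  also have "\<dots> \<le> real x * exp (real (m + 2 * D)) * decay (m + 2)"
    using D by (intro mult_left_mono decay_antimono) auto
  finally have h: "hits x (m + 2 * D) \<le> real x * exp (real (m + 2 * D)) * decay (m + 2)" .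
  have "hits x (m + 2 * D) / hits D (2 * D) = hits x (m + 2 * D) * (1 / hits D (2 * D))" by simp
  also have "\<dots> \<le> (real x * exp (real (m + 2 * D)) * decay (m + 2)) *
      (2 * exp 1 * real D * (exp 1 / 2) ^ D / exp (2 * real D))"
    by (intro mult_mono h inverse_hits_double D) auto
  also have "\<dots> = real x * exp (real m) * decay (m + 2) * (2 * exp 1 * real D * (exp 1 / 2) ^ D)"
    by (simp add: exp_add)
  finally show ?thesis .
qed

text \<open>The reward \<open>a ^ D\<close> for ending at \<open>D\<close> is expressed as a
  multiple of \<open>hits D (2 * D)\<close>. The loss \<open>(e / 2) ^ D\<close> turns it into
  \<open>\<rho> ^ D\<close> with \<open>\<rho> = a * e / 2 < 1\<close>, which outweighs the
  additional factor \<open>D\<close>.\<close>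

lemma walk_sum_power_le:
  assumes a: "0 < a" "a * exp 1 / 2 < 1"
  shows "\<exists>C>0. \<forall>n x m. walk_sum n (\<lambda>x. if x = 0 then 0 else a ^ x) x m \<le> C * real x * exp (real m) * decay (m + 2)"
proof -
  define \<rho> where "\<rho> = a * exp 1 / 2"
  have \<rho>: "0 \<le> \<rho>" "\<rho> < 1" using a by (auto simp: \<rho>_def)
  obtain B where B: "0 < B" "\<And>X. (\<Sum>y\<le>X. real (y + 1) * real (y + 1) * \<rho> ^ y) \<le> B"
    using sum_sq_geometric_bounded[OF \<rho>] by blast
  define \<phi> where "\<phi> = (\<lambda>x::nat. if x = 0 then 0 else a ^ x)"
  have "walk_sum n \<phi> x m \<le> (2 * exp 1 * B) * real x * exp (real m) * decay (m + 2)" for n x m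
  proof -
    define X where "X = x + n * m"
    have "walk_sum n \<phi> x m \<le> (\<Sum>D\<in>{1..X}. (a ^ D / hits D (2 * D)) * hits x (m + 2 * D))"
    proof (rule walk_sum_le_hits)
      fix y assume y: "y \<le> x + n * m"
      show "\<phi> y \<le> (\<Sum>D\<in>{1..X}. (a ^ D / hits D (2 * D)) * hits y (2 * D))"
      proof (cases "y = 0")
        case True
        then show ?thesis using a by (auto simp: \<phi>_def intro!: sum_nonneg mult_nonneg_nonneg divide_nonneg_nonneg)
      next
        case False
        then have "\<phi> y = (a ^ y / hits y (2 * y)) * hits y (2 * y)"
          using hits_pos[of y "2 * y"] by (simp add: \<phi>_def)
        also have "\<dots> \<le> (\<Sum>D\<in>{1..X}. (a ^ D / hits D (2 * D)) * hits y (2 * D))"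
          using False y a by (intro member_le_sum) (auto simp: X_def)
        finally show ?thesis .
      qed
    qed (use a in auto)
    also have "\<dots> = (\<Sum>D\<in>{1..X}. a ^ D * (hits x (m + 2 * D) / hits D (2 * D)))" by simp
    also have "\<dots> \<le> (\<Sum>D\<in>{1..X}. a ^ D * (real x * exp (real m) * decay (m + 2) * (2 * exp 1 * real D * (exp 1 / 2) ^ D)))"
      using a by (intro sum_mono mult_left_mono hits_ratio_le) auto
    also have "\<dots> = (\<Sum>D\<in>{1..X}. 2 * exp 1 * real x * exp (real m) * decay (m + 2) * (real D * \<rho> ^ D))"
      by (rule sum.cong[OF refl]) (simp add: \<rho>_def power_mult_distrib power_divide)
    also have "\<dots> \<le> 2 * exp 1 * real x * exp (real m) * decay (m + 2) * B"
      unfolding sum_distrib_left[symmetric]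
    proof (intro mult_left_mono)
      have "(\<Sum>D\<in>{1..X}. real D * \<rho> ^ D) \<le> (\<Sum>D\<in>{1..X}. real (D + 1) * real (D + 1) * \<rho> ^ D)"
      proof (intro sum_mono mult_right_mono)
        fix D show "real D \<le> real (D + 1) * real (D + 1)" by (simp add: algebra_simps)
      qed (use \<rho> in auto)
      also have "\<dots> \<le> (\<Sum>D\<le>X. real (D + 1) * real (D + 1) * \<rho> ^ D)"
        using \<rho> by (intro sum_mono2) auto
      finally show "(\<Sum>D\<in>{1..X}. real D * \<rho> ^ D) \<le> B" using B(2)[of X] by linarith
    qed auto
    finally show ?thesis by (simp add: mult_ac)
  qed
  then show ?thesis using B unfolding \<phi>_def by (intro exI[of _ "2 * exp 1 * B"]) auto
qed

section \<open>Sums and convolutions of \<open>decay\<close>\<close>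

lemma sum_decay_le: "(\<Sum>t<m. decay (t + 1)) \<le> 3"
proof -
  have "(\<Sum>t<Suc m. decay (t + 1)) \<le> 3 - 2 / sqrt (real (Suc m))" for m
  proof (induction m)
    case 0
    show ?case by (simp add: decay_def)
  next
    case (Suc m)
    define r s where "r = sqrt (real (Suc m))" and "s = sqrt (real (Suc (Suc m)))"
    have rs: "0 < r" "r \<le> s" by (auto simp: r_def s_def)
    have s2: "s * s = r * r + 1" by (simp add: r_def s_def)
    have "decay (Suc m + 1) = 1 / (s * s * s)" by (simp add: decay_def s_def)
    also have "\<dots> \<le> 2 / r - 2 / s"
    proof -
      have d: "(s - r) * (s + r) = 1" using s2 by (simp add: algebra_simps)
      have "r \<le> 2 * s * s * (s - r) "
      proof -
        have "1 \<le> (s - r) * (2 * s)" using d rs by (metis add_left_mono diff_ge_0_iff_ge mult_2 mult_left_mono)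
        then have "r * 1 \<le> s * ((s - r) * (2 * s))" using rs by (intro mult_mono) auto
        then show ?thesis by (simp add: mult_ac)
      qed
      then have "1 / (s * s * s) \<le> 2 * (s - r) / (r * s)"
        using rs by (simp add: divide_simps mult_ac) 
      also have "\<dots> = 2 / r - 2 / s" using rs by (simp add: field_simps)
      finally show ?thesis .
    qed
    finally show ?case using Suc by (simp add: r_def s_def)
  qed
  then have "(\<Sum>t<Suc m. decay (t + 1)) \<le> 3 - 2 / sqrt (real (Suc m))" .
  moreover have "(\<Sum>t<m. decay (t + 1)) \<le> (\<Sum>t<Suc m. decay (t + 1))" by simp
  moreover have "0 \<le> 2 / sqrt (real (Suc m))" by simp
  ultimately show ?thesis by linarith
qed

lemma decay_half:
  assumes "m \<le> 2 * s" "1 \<le> m"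
  shows "decay s \<le> 3 * decay m"
proof -
  have "sqrt (real m) \<le> sqrt (1.5\<^sup>2 * real s)"
    using assms by (intro real_sqrt_le_mono) (auto simp: power2_eq_square)
  also have "\<dots> = 1.5 * sqrt (real s)" by (simp add: real_sqrt_mult)
  finally have q: "sqrt (real m) \<le> 1.5 * sqrt (real s)" .
  have "real m * sqrt (real m) \<le> (2 * real s) * (1.5 * sqrt (real s))"
    using assms by (intro mult_mono q) auto
  then have le: "real m * sqrt (real m) \<le> 3 * (real s * sqrt (real s))" by simp
  have "0 < real s * sqrt (real s)" "0 < real m * sqrt (real m)" using assms by auto
  with le show ?thesis unfolding decay_def by (simp add: divide_simps)
qed

text \<open>As \<open>(t + 1) + (m - t) = m + 1\<close>, one argument is at least
  \<open>m / 2\<close> and its factor is comparable to \<open>decay m\<close>, while the other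
  factor is summable. Hence joining two path segments at an unspecified time preserves the order
  \<open>m powr (-3/2)\<close>.\<close>

lemma sum_decay_convolution:
  "(\<Sum>t<m. decay (t + 1) * decay (m - t)) \<le> 18 * decay m"
proof -
  have "(\<Sum>t<m. decay (t + 1) * decay (m - t)) \<le> (\<Sum>t<m. 3 * decay m * (decay (t + 1) + decay (m - t)))"
  proof (rule sum_mono)
    fix t assume t: "t \<in> {..<m}"
    consider "m \<le> 2 * (t + 1)" | "m \<le> 2 * (m - t)" using t by fastforce
    then show "decay (t + 1) * decay (m - t) \<le> 3 * decay m * (decay (t + 1) + decay (m - t))"
    proof cases
      case 1
      then have "decay (t + 1) * decay (m - t) \<le> 3 * decay m * decay (m - t)"
        using t by (intro mult_right_mono decay_half) auto
      also have "\<dots> \<le> 3 * decay m * (decay (t + 1) + decay (m - t))" by (intro mult_left_mono) auto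
      finally show ?thesis .
    next
      case 2
      then have "decay (t + 1) * decay (m - t) \<le> decay (t + 1) * (3 * decay m)"
        using t by (intro mult_left_mono decay_half) auto
      also have "\<dots> = 3 * decay m * decay (t + 1)" by simp
      also have "\<dots> \<le> 3 * decay m * (decay (t + 1) + decay (m - t))" by (intro mult_left_mono) auto
      finally show ?thesis .
    qed
  qed
  also have "\<dots> = 3 * decay m * ((\<Sum>t<m. decay (t + 1)) + (\<Sum>t<m. decay (m - t)))"
    by (simp only: sum_distrib_left sum.distrib distrib_left)
  also have "(\<Sum>t<m. decay (m - t)) = (\<Sum>t<m. decay (t + 1))"
    by (rule sum.reindex_bij_witness[of _ "\<lambda>t. m - 1 - t" "\<lambda>t. m - 1 - t"]) (auto simp: Suc_diff_Suc)
  also have "3 * decay m * ((\<Sum>t<m. decay (t + 1)) + (\<Sum>t<m. decay (t + 1))) \<le> 3 * decay m * (3 + 3)"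
    by (intro mult_left_mono add_mono sum_decay_le) auto
  finally show ?thesis by simp
qed

text \<open>The sum of \<open>2 powr (- h_j)\<close> over all non-empty initial segments of blocks,
  which appear as suffixes of the list. It measures how far the second moment exceeds its ideal
  size.\<close>

fun drift_sum :: "nat list \<Rightarrow> real" where
  "drift_sum [] = 0"
| "drift_sum (u # us) = 2 ^ sum_list (u # us) / 2 ^ length (u # us) + drift_sum us"

lemma drift_sum_nonneg [simp]: "0 \<le> drift_sum us"
  by (induction us) auto

lemma walk_return_length:
  "walk (\<lambda>x. of_bool (x = 1)) x us \<noteq> 0 \<Longrightarrow> x + sum_list us = Suc (length us)"
proof (induction us arbitrary: x)
  case (Cons u us)
  then have "x \<noteq> 0" "x - 1 + u + sum_list us = Suc (length us)" by (auto split: if_splits)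
  then show ?case by simp
qed (simp split: if_splits)

text \<open>By \<open>walk_return_length\<close>, the leading term of \<open>drift_sum\<close>
  equals \<open>2 * (1/2) ^ x\<close>, a function of the current position, so the whole sum runs
  over the positions visited. The summand for \<open>t\<close> and \<open>y\<close> bounds the
  weight of walks at \<open>y\<close> after \<open>t\<close> steps, times the weight
  \<open>hits y (Suc m - t)\<close> of completing the walk. Completion is impossible from heights
  above \<open>Suc m\<close>, so \<open>m < X\<close> covers every relevant
  \<open>y\<close>.\<close>

lemma sum_walk_drift:
  assumes "m < X"
  shows "(\<Sum>us\<in>count_lists n m. walk (\<lambda>x. of_bool (x = 1)) x us * drift_sum us) \<le>
    2 * (\<Sum>t\<le>m. \<Sum>y\<in>{1..X}. (1/2) ^ y * (hits x (t + 2 * y) / hits y (2 * y)) * hits y (Suc m - t))"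
  using assms
proof (induction m arbitrary: x)
  case 0
  show ?case by (auto intro!: sum_nonneg mult_nonneg_nonneg divide_nonneg_nonneg)
next
  case (Suc m)
  define T where "T = (\<lambda>t x m. \<Sum>y\<in>{1..X}. (1/2) ^ y * (hits x (t + 2 * y) / hits y (2 * y)) * hits y (Suc m - t))"
  have T0: "0 \<le> T t x m" for t x m
    unfolding T_def by (intro sum_nonneg mult_nonneg_nonneg divide_nonneg_nonneg) auto
  show ?case
  proof (cases "x = 0")
    case True
    then have "(\<Sum>us\<in>count_lists n (Suc m). walk (\<lambda>x. of_bool (x = 1)) x us * drift_sum us) = 0"
      by (simp add: sum_count_lists_Suc)
    then show ?thesis
      by (auto simp del: sum.atMost_Suc intro!: sum_nonneg mult_nonneg_nonneg divide_nonneg_nonneg)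
  next
    case False
    let ?w = "walk (\<lambda>x. of_bool (x = 1))"
    have "(\<Sum>us\<in>count_lists n (Suc m). ?w x us * drift_sum us) =
      (\<Sum>us\<in>count_lists n (Suc m). 2 * (1/2) ^ x * ?w x us + ?w x us * drift_sum (tl us))"
    proof (rule sum.cong[OF refl])
      fix us assume us: "us \<in> count_lists n (Suc m)"
      then obtain v vs where v: "us = v # vs" by (auto simp: count_lists_def length_Suc_conv)
      show "?w x us * drift_sum us = 2 * (1/2) ^ x * ?w x us + ?w x us * drift_sum (tl us)"
      proof (cases "?w x us = 0")
        case nz: False
        have "2 * (2::real) ^ length us = 2 ^ x * 2 ^ sum_list us"
          using walk_return_length[OF nz] by (metis power_add power_Suc)
        then have "2 ^ sum_list us / 2 ^ length us = 2 * (1/2 :: real) ^ x"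
          by (simp add: field_simps)
        then have "drift_sum us = 2 * (1/2) ^ x + drift_sum (tl us)" unfolding v by simp
        then show ?thesis by (simp add: algebra_simps)
      qed simp
    qed
    also have "\<dots> = 2 * (1/2) ^ x * walk_sum n (\<lambda>x. of_bool (x = 1)) x (Suc m) +
        (\<Sum>u\<le>n. (\<Sum>us\<in>count_lists n m. ?w (x - 1 + u) us * drift_sum us) / fact u)"
      unfolding sum.distrib sum_distrib_left[symmetric] walk_sum_def[symmetric]
      using False by (simp add: sum_count_lists_Suc sum_divide_distrib)
    also have "\<dots> \<le> 2 * (1/2) ^ x * hits x (Suc (Suc m)) + 2 * (\<Sum>t\<le>m. T (Suc t) x (Suc m))"
    proof (intro add_mono mult_left_mono)
      show "walk_sum n (\<lambda>x. of_bool (x = 1)) x (Suc m) \<le> hits x (Suc (Suc m))"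
        by (rule walk_sum_return_le)
      have "(\<Sum>u\<le>n. (\<Sum>us\<in>count_lists n m. ?w (x - 1 + u) us * drift_sum us) / fact u)
        \<le> (\<Sum>u\<le>n. 2 * (\<Sum>t\<le>m. T t (x - 1 + u) m) / fact u)"
        unfolding T_def using Suc by (intro sum_mono divide_right_mono) auto
      also have "\<dots> = 2 * (\<Sum>t\<le>m. \<Sum>u\<le>n. T t (x - 1 + u) m / fact u)"
        unfolding sum_divide_distrib times_divide_eq_right[symmetric] sum_distrib_left[symmetric]
        by (subst sum.swap) simp
      also have "\<dots> \<le> 2 * (\<Sum>t\<le>m. T (Suc t) x (Suc m))"
      proof (intro mult_left_mono sum_mono)
        fix t
        have "(\<Sum>u\<le>n. T t (x - 1 + u) m / fact u) = (\<Sum>y\<in>{1..X}. (1/2) ^ y *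
           ((\<Sum>u\<le>n. hits (x - 1 + u) (t + 2 * y) / fact u) / hits y (2 * y)) * hits y (Suc m - t))"
          unfolding T_def sum_divide_distrib sum_distrib_left sum_distrib_right
          by (subst sum.swap) (simp add: mult_ac)
        also have "\<dots> \<le> (\<Sum>y\<in>{1..X}. (1/2) ^ y * (hits x (Suc (t + 2 * y)) / hits y (2 * y)) * hits y (Suc m - t))"
          using False by (intro sum_mono mult_right_mono mult_left_mono divide_right_mono hits_Suc_ge) auto
        finally show "(\<Sum>u\<le>n. T t (x - 1 + u) m / fact u) \<le> T (Suc t) x (Suc m)"
          by (simp add: T_def)
      qed simp
      finally show "(\<Sum>u\<le>n. (\<Sum>us\<in>count_lists n m. ?w (x - 1 + u) us * drift_sum us) / fact u)
        \<le> 2 * (\<Sum>t\<le>m. T (Suc t) x (Suc m))" .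
    qed auto
    finally have step: "(\<Sum>us\<in>count_lists n (Suc m). ?w x us * drift_sum us) \<le>
      2 * ((1/2) ^ x * hits x (Suc (Suc m))) + 2 * (\<Sum>t\<le>m. T (Suc t) x (Suc m))" by (simp only: mult.assoc)
    have T0x: "(1/2) ^ x * hits x (Suc (Suc m)) \<le> T 0 x (Suc m)"
    proof (cases "x \<le> Suc (Suc m)")
      case True
      have "(1/2) ^ x * hits x (Suc (Suc m)) = (1/2) ^ x * (hits x (0 + 2 * x) / hits x (2 * x)) * hits x (Suc (Suc m) - 0)"
        using False hits_pos[of x "2 * x"] by simp
      also have "\<dots> \<le> T 0 x (Suc m)"
        unfolding T_def using False True Suc.prems
        by (intro member_le_sum[of x "{1..X}" "\<lambda>y. (1/2) ^ y * (hits x (0 + 2 * y) / hits y (2 * y)) * hits y (Suc (Suc m) - 0)"]) auto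
      finally show ?thesis .
    next
      case False
      then show ?thesis using T0 by (simp add: hits_eq_0)
    qed
    have "T 0 x (Suc m) + (\<Sum>t\<le>m. T (Suc t) x (Suc m)) = (\<Sum>t\<le>Suc m. T t x (Suc m))"
      by (subst sum.atMost_Suc_shift) simp
    with step T0x have "(\<Sum>us\<in>count_lists n (Suc m). ?w x us * drift_sum us) \<le> 2 * (\<Sum>t\<le>Suc m. T t x (Suc m))"
      by linarith
    then show ?thesis unfolding T_def .
  qed
qed

text \<open>Visiting height \<open>y\<close> costs \<open>(e / 2) ^ y\<close> in the comparison with
  first passages, and the drift term pays \<open>(1/2) ^ y\<close>; the product is
  \<open>(e / 4) ^ y\<close>. The pieces before and after time \<open>t\<close> decay separately and
  are then convolved.\<close>

lemma sum_walk_drift_le: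
  "\<exists>C>0. \<forall>n m. (\<Sum>us\<in>count_lists n m. walk (\<lambda>x. of_bool (x = 1)) 1 us * drift_sum us)
    \<le> C * exp (real m) * decay (m + 1)"
proof -
  define \<rho> where "\<rho> = exp 1 / (4 :: real)"
  have \<rho>: "0 \<le> \<rho>" "\<rho> < 1" using e_less_272 by (auto simp: \<rho>_def)
  obtain B where B: "0 < B" "\<And>X. (\<Sum>y\<le>X. real (y + 1) * real (y + 1) * \<rho> ^ y) \<le> B"
    using sum_sq_geometric_bounded[OF \<rho>] by blast
  have "(\<Sum>us\<in>count_lists n m. walk (\<lambda>x. of_bool (x = 1)) 1 us * drift_sum us)
    \<le> (72 * exp 1 * exp 1 * B) * exp (real m) * decay (m + 1)" for n m
  proof -
    define X where "X = Suc m"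
    define T where "T = (\<lambda>t. \<Sum>y\<in>{1..X}. (1/2) ^ y * (hits 1 (t + 2 * y) / hits y (2 * y)) * hits y (Suc m - t))"
    have "(\<Sum>us\<in>count_lists n m. walk (\<lambda>x. of_bool (x = 1)) 1 us * drift_sum us) \<le> 2 * (\<Sum>t\<le>m. T t)"
      unfolding T_def by (rule sum_walk_drift) (simp add: X_def)
    also have "(\<Sum>t\<le>m. T t) \<le> (\<Sum>t\<le>m. (2 * exp 1 * B * exp (real (Suc m))) * (decay (t + 1) * decay (Suc m - t)))"
    proof (rule sum_mono)
      fix t assume t: "t \<in> {..m}"
      have "T t \<le> (\<Sum>y\<in>{1..X}. (1/2) ^ y * (real 1 * exp (real t) * decay (t + 2) * (2 * exp 1 * real y * (exp 1 / 2) ^ y)) *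
          (real y * exp (real (Suc m - t)) * decay (Suc m - t)))"
        unfolding T_def using t
        by (intro sum_mono mult_mono mult_left_mono hits_ratio_le hits_upper mult_nonneg_nonneg divide_nonneg_nonneg) auto
      also have "\<dots> = (\<Sum>y\<in>{1..X}. (2 * exp 1 * exp (real (Suc m)) * decay (t + 2) * decay (Suc m - t)) * (real y * real y * \<rho> ^ y))"
      proof (rule sum.cong[OF refl])
        fix y
        have "exp (real (Suc m)) = exp (real t) * exp (real (Suc m - t))" using t by (simp flip: exp_add)
        moreover have "\<rho> ^ y = (1/2) ^ y * (exp 1 / 2) ^ y" by (simp add: \<rho>_def flip: power_mult_distrib)
        ultimately show "(1/2) ^ y * (real 1 * exp (real t) * decay (t + 2) * (2 * exp 1 * real y * (exp 1 / 2) ^ y)) *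
          (real y * exp (real (Suc m - t)) * decay (Suc m - t)) =
          (2 * exp 1 * exp (real (Suc m)) * decay (t + 2) * decay (Suc m - t)) * (real y * real y * \<rho> ^ y)"
          by (simp only: mult_ac of_nat_1 mult_1)
      qed
      also have "\<dots> \<le> (2 * exp 1 * exp (real (Suc m)) * decay (t + 1) * decay (Suc m - t)) * B"
        unfolding sum_distrib_left[symmetric]
      proof (intro mult_mono mult_left_mono mult_right_mono decay_antimono)
        have "(\<Sum>y\<in>{1..X}. real y * real y * \<rho> ^ y) \<le> (\<Sum>y\<in>{1..X}. real (y + 1) * real (y + 1) * \<rho> ^ y)"
          using \<rho> by (intro sum_mono mult_right_mono mult_mono) auto
        also have "\<dots> \<le> (\<Sum>y\<le>X. real (y + 1) * real (y + 1) * \<rho> ^ y)"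
          using \<rho> by (intro sum_mono2) auto
        finally show "(\<Sum>y\<in>{1..X}. real y * real y * \<rho> ^ y) \<le> B" using B(2)[of X] by linarith
      qed (use \<rho> t in \<open>auto intro!: sum_nonneg mult_nonneg_nonneg\<close>)
      finally show "T t \<le> (2 * exp 1 * B * exp (real (Suc m))) * (decay (t + 1) * decay (Suc m - t))"
        by (simp only: mult_ac)
    qed
    also have "\<dots> \<le> (2 * exp 1 * B * exp (real (Suc m))) * (18 * decay (Suc m))"
      unfolding sum_distrib_left[symmetric] lessThan_Suc_atMost[symmetric]
      using B by (intro mult_left_mono sum_decay_convolution) auto
    finally show ?thesis by (simp add: mult_ac exp_add)
  qed
  then show ?thesis using B by (intro exI[of _ "72 * exp 1 * exp 1 * B"]) auto
qed

section \<open>Splitting a walk at its minimum\<close>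

lemma sum_count_lists_append:
  fixes f g :: "nat list \<Rightarrow> real"
  shows "(\<Sum>bs\<in>count_lists n (a + b). f (take a bs) * g (drop a bs)) =
    (\<Sum>vs\<in>count_lists n a. f vs) * (\<Sum>us\<in>count_lists n b. g us)"
proof -
  have "(\<Sum>vs\<in>count_lists n a. f vs) * (\<Sum>us\<in>count_lists n b. g us) =
      (\<Sum>(vs, us)\<in>count_lists n a \<times> count_lists n b. f vs * g us)"
    by (simp add: sum_product sum.cartesian_product)
  also have "\<dots> = (\<Sum>bs\<in>count_lists n (a + b). f (take a bs) * g (drop a bs))"
    by (rule sum.reindex_bij_witness[of _ "\<lambda>bs. (take a bs, drop a bs)" "\<lambda>(vs, us). vs @ us"])
       (auto simp: count_lists_def dest: in_set_takeD in_set_dropD)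
  finally show ?thesis ..
qed

text \<open>The walk \<open>h\<close> of the overview: as the head of a list is its latest block,
  \<open>h_j\<close> is the deficit of the suffix of length \<open>j\<close>.\<close>

definition deficit :: "nat list \<Rightarrow> int" where
  "deficit us = int (length us) - int (sum_list us)"

lemma deficit_simps [simp]: "deficit [] = 0" "deficit (u # us) = deficit us + 1 - int u"
  "deficit (vs @ us) = deficit vs + deficit us"
  by (auto simp: deficit_def)

definition fact_weight :: "real \<Rightarrow> nat list \<Rightarrow> real" where
  "fact_weight a us = (\<Prod>u\<leftarrow>us. a ^ u / fact u)"

lemma fact_weight_simps [simp]: "fact_weight a [] = 1"
  "fact_weight a (u # us) = a ^ u / fact u * fact_weight a us"
  "fact_weight a (vs @ us) = fact_weight a vs * fact_weight a us"
  by (simp_all add: fact_weight_def)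

lemma fact_weight_nonneg: "0 \<le> a \<Longrightarrow> 0 \<le> fact_weight a us"
  by (induction us) auto

lemma fact_weight_eq: "fact_weight a us = a ^ sum_list us * fact_weight 1 us"
  by (induction us) (auto simp: power_add)

text \<open>With \<open>us'\<close> still to be read the walk is at
  \<open>x - deficit us + deficit us'\<close>. The hypothesis keeps all these positions at least 1,
  so the walk is never killed.\<close>

lemma walk_eval:
  assumes "\<And>ps us'. us = ps @ us' \<Longrightarrow> 1 \<le> int x - deficit us + deficit us'"
  shows "walk \<phi> x us = \<phi> (nat (int x - deficit us)) * fact_weight 1 us"
  using assms
proof (induction us arbitrary: x)
  case (Cons u us)
  have x: "1 \<le> x" using Cons.prems[of "[]" "u # us"] by simp
  have "walk \<phi> (x - 1 + u) us = \<phi> (nat (int (x - 1 + u) - deficit us)) * fact_weight 1 us"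
  proof (rule Cons.IH)
    fix ps us' assume "us = ps @ us'"
    then have "u # us = (u # ps) @ us'" by simp
    from Cons.prems[OF this] x show "1 \<le> int (x - 1 + u) - deficit us + deficit us'"
      by simp
  qed
  also have "int (x - 1 + u) - deficit us = int x - deficit (u # us)" using x by simp
  finally show ?case using x by (simp del: deficit_simps)
qed simp

lemma exists_min_deficit_split:
  obtains vs us where "bs = vs @ us"
    "\<And>ps us'. bs = ps @ us' \<Longrightarrow> deficit us \<le> deficit us'"
proof -
  define S where "S = (\<lambda>i. deficit (drop i bs)) ` {..length bs}"
  have S: "finite S" "S \<noteq> {}" by (auto simp: S_def)
  define m where "m = Min S"
  have "m \<in> S" unfolding m_def by (rule Min_in[OF S])
  then obtain i where i: "m = deficit (drop i bs)" by (auto simp: S_def)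
  show thesis
  proof (rule that[of "take i bs" "drop i bs"])
    fix ps us' assume "bs = ps @ us'"
    then have "deficit us' \<in> S" unfolding S_def by (intro image_eqI[of _ _ "length ps"]) auto
    then show "deficit (drop i bs) \<le> deficit us'" using Min_le[OF S(1)] i m_def by metis
  qed simp
qed

text \<open>The first two inequalities make the sums over the height of the end and of the start of
  the walk above its minimum converge. The third yields \<open>delta_const < 1\<close> and the
  geometric growth over scales.\<close>

lemma e_ln2_bounds: "2 * ln 2 > (1::real)" "ln 2 * exp 1 / 2 < (1::real)" "ln 2 * exp 1 > (3/2::real)"
proof -
  show "2 * ln 2 > (1::real)" using ln2_ge_two_thirds by simp
  have "ln 2 * exp 1 \<le> 25 / 36 * (272 / 100 :: real)"
    using ln2_le_25_over_36 e_less_272 by (intro mult_mono) auto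
  then show "ln 2 * exp 1 / 2 < (1::real)" by simp
  have "2 / 3 * 2.5 \<le> ln 2 * exp (1::real)"
    using ln2_ge_two_thirds abs_le_D2[OF e_approx_32] by (intro mult_mono) auto
  then show "ln 2 * exp 1 > (3/2::real)" by simp
qed

text \<open>The best split is at the minimum of \<open>h\<close>. Read backwards, both segments are
  then walks that stay positive: the later one descends to 1, the earlier one starts at 1 and ends
  with an exponential reward. Each decays like \<open>m powr (-3/2)\<close> in its length, and the
  position of the minimum is summed by convolution.\<close>

lemma sum_fact_weight_min_le:
  "\<exists>C>0. \<forall>n J F. (\<forall>bs\<in>count_lists n J. \<forall>vs us. bs = vs @ us \<longrightarrow>
       F bs \<le> 2 ^ sum_list vs * (2 ^ length us * damped us)) \<longrightarrow>
     (\<Sum>bs\<in>count_lists n J. fact_weight (ln 2) bs * F bs) \<le> C * (2 * (ln 2 * exp 1)) ^ J * decay (J + 1)"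
proof -
  define a where "a = ln (2::real)"
  have a: "0 < a" "a \<le> 1" "2 * a > 1" "a * exp 1 / 2 < 1"
    using e_ln2_bounds ln_2_less_1 by (auto simp: a_def)
  define \<phi> where "\<phi> = (\<lambda>x::nat. if x = 0 then 0 else a ^ x)"
  have \<phi>0: "0 \<le> \<phi> y" for y using a by (simp add: \<phi>_def)
  obtain C1 where C1: "0 < C1" "\<And>n x m. walk_sum n \<phi> x m \<le> C1 * real x * exp (real m) * decay (m + 2)"
    using walk_sum_power_le[OF a(1,4)] unfolding \<phi>_def by blast
  define \<psi> where "\<psi> = (\<lambda>x::nat. of_bool (x = 1) :: real)"
  have \<psi>0: "0 \<le> \<psi> y" for y by (simp add: \<psi>_def)
  define \<rho> where "\<rho> = 1 / (2 * a)"
  have \<rho>: "0 \<le> \<rho>" "\<rho> < 1" using a by (auto simp: \<rho>_def)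
  obtain B where B: "0 < B" "\<And>X. (\<Sum>y\<le>X. real (y + 1) * real (y + 1) * \<rho> ^ y) \<le> B"
    using sum_sq_geometric_bounded[OF \<rho>] by blast
  \<comment> \<open>In \<open>G1\<close>, \<open>a ^ sum_list us\<close> is split into
    \<open>a ^ length us\<close> and the reward; the walk from 1 ends one above
    \<open>sum_list us - length us\<close>, which is compensated by dividing by \<open>a\<close>. In
    \<open>G2\<close>, \<open>e\<close> is the deficit of \<open>vs\<close>, so that
    \<open>(2 * a) ^ sum_list vs = (2 * a) ^ (length vs - e)\<close>.\<close>
  define G1 where "G1 = (\<lambda>us. 2 ^ length us * a ^ length us / a * (walk \<phi> 1 us * damped us))"
  define G2 where "G2 = (\<lambda>vs. \<Sum>e\<le>length vs. (2 * a) ^ (length vs - e) * walk \<psi> (e + 1) vs)"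
  have G1nn: "0 \<le> G1 us" for us
    unfolding G1_def using a walk_nonneg[OF \<phi>0] by (intro mult_nonneg_nonneg divide_nonneg_nonneg) auto
  have G2nn: "0 \<le> G2 us" for us
    unfolding G2_def using a walk_nonneg[OF \<psi>0] by (intro sum_nonneg mult_nonneg_nonneg) auto
  have sumG1: "(\<Sum>us\<in>count_lists n m. G1 us) \<le> 50 * C1 / a * (2 * (a * exp 1)) ^ m * decay (m + 1)" for n m
  proof -
    have "(\<Sum>us\<in>count_lists n m. G1 us) = (2 * a) ^ m / a * (\<Sum>us\<in>count_lists n m. walk \<phi> 1 us * damped us)"
      unfolding sum_distrib_left G1_def
      by (rule sum.cong[OF refl]) (simp add: count_lists_def power_mult_distrib)
    also have "\<dots> \<le> (2 * a) ^ m / a * (50 * C1 * real 1 * exp (real m) * decay (m + 2))"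
      using a C1 by (intro mult_left_mono sum_walk_damped \<phi>0) auto
    also have "\<dots> \<le> (2 * a) ^ m / a * (50 * C1 * real 1 * exp (real m) * decay (m + 1))"
      using a C1 by (intro mult_left_mono decay_antimono) auto
    also have "\<dots> = 50 * C1 / a * (2 * (a * exp 1)) ^ m * decay (m + 1)"
      by (simp add: power_mult_distrib exp_of_nat_mult[symmetric])
    finally show ?thesis .
  qed
  have sumG2: "(\<Sum>vs\<in>count_lists n m. G2 vs) \<le> exp 1 * B * (2 * (a * exp 1)) ^ m * decay (m + 1)" for n m
  proof -
    have "(\<Sum>vs\<in>count_lists n m. G2 vs) = (\<Sum>vs\<in>count_lists n m. \<Sum>e\<le>m. (2 * a) ^ (m - e) * walk \<psi> (e + 1) vs)"
      unfolding G2_def by (rule sum.cong[OF refl]) (simp add: count_lists_def)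
    also have "\<dots> = (\<Sum>e\<le>m. (2 * a) ^ (m - e) * walk_sum n \<psi> (e + 1) m)"
      unfolding walk_sum_def sum_distrib_left by (rule sum.swap)
    also have "\<dots> \<le> (\<Sum>e\<le>m. (2 * a) ^ (m - e) * (real (e + 1) * exp (real (Suc m)) * decay (Suc m)))"
    proof (intro sum_mono mult_left_mono)
      fix e
      have "walk_sum n \<psi> (e + 1) m \<le> hits (e + 1) (Suc m)" unfolding \<psi>_def by (rule walk_sum_return_le)
      also have "\<dots> \<le> real (e + 1) * exp (real (Suc m)) * decay (Suc m)" by (rule hits_upper) simp
      finally show "walk_sum n \<psi> (e + 1) m \<le> real (e + 1) * exp (real (Suc m)) * decay (Suc m)" .
    qed (use a in auto)
    also have "\<dots> = (\<Sum>e\<le>m. exp 1 * (2 * (a * exp 1)) ^ m * decay (m + 1) * (real (e + 1) * \<rho> ^ e))"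
    proof (rule sum.cong[OF refl])
      fix e assume e: "e \<in> {..m}"
      have "(2 * a) ^ m = (2 * a) ^ (m - e) * (2 * a) ^ e"
        using e by (simp only: power_add[symmetric] le_add_diff_inverse2 atMost_iff)
      then have "(2 * a) ^ (m - e) = (2 * a) ^ m * \<rho> ^ e" using a by (simp add: \<rho>_def power_divide)
      moreover have "exp (real (Suc m)) = exp 1 * exp 1 ^ m" by (simp add: exp_add flip: exp_of_nat_mult)
      moreover have "(2 * (a * exp 1)) ^ m = (2 * a) ^ m * exp 1 ^ m" by (simp add: power_mult_distrib)
      ultimately show "(2 * a) ^ (m - e) * (real (e + 1) * exp (real (Suc m)) * decay (Suc m)) =
          exp 1 * (2 * (a * exp 1)) ^ m * decay (m + 1) * (real (e + 1) * \<rho> ^ e)"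
        by (simp only: mult_ac Suc_eq_plus1)
    qed
    also have "\<dots> \<le> exp 1 * (2 * (a * exp 1)) ^ m * decay (m + 1) * B"
      unfolding sum_distrib_left[symmetric]
    proof (intro mult_left_mono)
      have "(\<Sum>e\<le>m. real (e + 1) * \<rho> ^ e) \<le> (\<Sum>e\<le>m. real (e + 1) * real (e + 1) * \<rho> ^ e)"
        using \<rho> by (intro sum_mono mult_right_mono) (auto simp: algebra_simps)
      then show "(\<Sum>e\<le>m. real (e + 1) * \<rho> ^ e) \<le> B" using B(2)[of m] by linarith
    qed (use a in auto)
    finally show ?thesis by (simp add: mult_ac)
  qed
  have main: "fact_weight a bs * y \<le> (\<Sum>m\<le>J. G2 (take (J - m) bs) * G1 (drop (J - m) bs))"
    if bs: "bs \<in> count_lists n J" and F: "\<And>vs us. bs = vs @ us \<Longrightarrow> y \<le> 2 ^ sum_list vs * (2 ^ length us * damped us)"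
    for bs n J and y :: real
  proof -
    obtain vs us where vu: "bs = vs @ us" and min: "\<And>ps us'. bs = ps @ us' \<Longrightarrow> deficit us \<le> deficit us'"
      using exists_min_deficit_split[of bs] by metis
    have J: "J = length vs + length us" using bs vu by (simp add: count_lists_def)
    have d0: "deficit us \<le> 0" using min[of bs "[]"] by simp
    then have len: "length us \<le> sum_list us" by (simp add: deficit_def)
    have e0: "0 \<le> deficit vs" using min[of "[]" bs] vu by simp
    then have lenv: "sum_list vs \<le> length vs" by (simp add: deficit_def)
    have "walk \<phi> 1 us = \<phi> (nat (int 1 - deficit us)) * fact_weight 1 us"
    proof (rule walk_eval)
      fix ps us' assume "us = ps @ us'"
      then have "bs = (vs @ ps) @ us'" using vu by simp
      from min[OF this] show "1 \<le> int 1 - deficit us + deficit us'" by simp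
    qed
    also have "nat (int 1 - deficit us) = Suc (sum_list us - length us)"
      using len by (simp add: deficit_def)
    finally have w1: "walk \<phi> 1 us = a ^ Suc (sum_list us - length us) * fact_weight 1 us"
      by (simp add: \<phi>_def)
    have "a ^ length us * a ^ (sum_list us - length us) = a ^ sum_list us"
      using len by (simp flip: power_add)
    then have "G1 us = 2 ^ length us * damped us * (a ^ sum_list us * fact_weight 1 us)"
      unfolding G1_def w1 using a by (simp add: mult_ac)
    then have g1: "G1 us = fact_weight a us * (2 ^ length us * damped us)"
      by (simp add: fact_weight_eq[of a] mult_ac)
    define e where "e = length vs - sum_list vs"
    have eint: "int e = deficit vs" using lenv by (simp add: e_def deficit_def)
    have "walk \<psi> (e + 1) vs = \<psi> (nat (int (e + 1) - deficit vs)) * fact_weight 1 vs"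
    proof (rule walk_eval)
      fix ps vs' assume "vs = ps @ vs'"
      then have "bs = ps @ (vs' @ us)" using vu by simp
      from min[OF this] show "1 \<le> int (e + 1) - deficit vs + deficit vs'" using eint by simp
    qed
    also have "nat (int (e + 1) - deficit vs) = 1" using eint by simp
    finally have w2: "walk \<psi> (e + 1) vs = fact_weight 1 vs" by (simp add: \<psi>_def)
    have "fact_weight a vs * 2 ^ sum_list vs = (2 * a) ^ (length vs - e) * walk \<psi> (e + 1) vs"
      unfolding w2 fact_weight_eq[of a] using lenv by (simp add: e_def power_mult_distrib)
    also have "\<dots> \<le> G2 vs"
      unfolding G2_def using a walk_nonneg[OF \<psi>0]
      by (intro member_le_sum[of e "{..length vs}" "\<lambda>e. (2 * a) ^ (length vs - e) * walk \<psi> (e + 1) vs"])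
         (auto simp: e_def)
    finally have g2: "fact_weight a vs * 2 ^ sum_list vs \<le> G2 vs" .
    have "fact_weight a bs * y \<le> fact_weight a bs * (2 ^ sum_list vs * (2 ^ length us * damped us))"
      using a by (intro mult_left_mono F vu fact_weight_nonneg) auto
    also have "\<dots> = (fact_weight a vs * 2 ^ sum_list vs) * G1 us"
      unfolding vu g1 by (simp add: mult_ac)
    also have "\<dots> \<le> G2 vs * G1 us" by (intro mult_right_mono g2 G1nn)
    also have "\<dots> = G2 (take (J - length us) bs) * G1 (drop (J - length us) bs)"
      by (simp add: J vu)
    also have "\<dots> \<le> (\<Sum>m\<le>J. G2 (take (J - m) bs) * G1 (drop (J - m) bs))"
      by (rule member_le_sum[of "length us" "{..J}" "\<lambda>m. G2 (take (J - m) bs) * G1 (drop (J - m) bs)"])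
         (use J G1nn G2nn in auto)
    finally show ?thesis .
  qed
  define K where "K = 50 * C1 / a * (exp 1 * B)"
  have K: "0 < K" using C1 a B by (simp add: K_def)
  have "(\<Sum>bs\<in>count_lists n J. fact_weight a bs * F bs) \<le> (18 * K) * (2 * (a * exp 1)) ^ J * decay (J + 1)"
    if F: "\<forall>bs\<in>count_lists n J. \<forall>vs us. bs = vs @ us \<longrightarrow> F bs \<le> 2 ^ sum_list vs * (2 ^ length us * damped us)"
    for n J and F :: "nat list \<Rightarrow> real"
  proof -
    have "(\<Sum>bs\<in>count_lists n J. fact_weight a bs * F bs) \<le>
        (\<Sum>bs\<in>count_lists n J. \<Sum>m\<le>J. G2 (take (J - m) bs) * G1 (drop (J - m) bs))"
      using F by (intro sum_mono main) auto
    also have "\<dots> = (\<Sum>m\<le>J. \<Sum>bs\<in>count_lists n J. G2 (take (J - m) bs) * G1 (drop (J - m) bs))"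
      by (rule sum.swap)
    also have "\<dots> = (\<Sum>m\<le>J. (\<Sum>vs\<in>count_lists n (J - m). G2 vs) * (\<Sum>us\<in>count_lists n m. G1 us))"
    proof (rule sum.cong[OF refl])
      fix m assume "m \<in> {..J}"
      then have "J = (J - m) + m" by simp
      then show "(\<Sum>bs\<in>count_lists n J. G2 (take (J - m) bs) * G1 (drop (J - m) bs)) =
        (\<Sum>vs\<in>count_lists n (J - m). G2 vs) * (\<Sum>us\<in>count_lists n m. G1 us)"
        using sum_count_lists_append[where a = "J - m" and b = m and n = n and f = G2 and g = G1] by simp
    qed
    also have "\<dots> \<le> (\<Sum>m\<le>J. (exp 1 * B * (2 * (a * exp 1)) ^ (J - m) * decay (J - m + 1)) *
        (50 * C1 / a * (2 * (a * exp 1)) ^ m * decay (m + 1)))"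
      using a B G1nn G2nn by (intro sum_mono mult_mono sumG1 sumG2) (auto intro!: sum_nonneg mult_nonneg_nonneg)
    also have "\<dots> = (\<Sum>m\<le>J. (K * (2 * (a * exp 1)) ^ J) * (decay (m + 1) * decay (Suc J - m)))"
    proof (rule sum.cong[OF refl])
      fix m assume m: "m \<in> {..J}"
      have "(2 * (a * exp 1)) ^ J = (2 * (a * exp 1)) ^ (J - m) * (2 * (a * exp 1)) ^ m"
        using m by (simp only: power_add[symmetric] le_add_diff_inverse2 atMost_iff)
      moreover have "J - m + 1 = Suc J - m" using m by simp
      ultimately show "(exp 1 * B * (2 * (a * exp 1)) ^ (J - m) * decay (J - m + 1)) *
        (50 * C1 / a * (2 * (a * exp 1)) ^ m * decay (m + 1)) =
        (K * (2 * (a * exp 1)) ^ J) * (decay (m + 1) * decay (Suc J - m))"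
        by (simp only: K_def mult_ac)
    qed
    also have "\<dots> \<le> (K * (2 * (a * exp 1)) ^ J) * (18 * decay (Suc J))"
      unfolding sum_distrib_left[symmetric] lessThan_Suc_atMost[symmetric]
      using K a by (intro mult_left_mono sum_decay_convolution) auto
    finally show ?thesis by (simp add: mult_ac)
  qed
  then show ?thesis using K unfolding a_def by (intro exI[of _ "18 * K"]) auto
qed

text \<open>Markov's inequality: the weighted sum of \<open>damped + drift_sum\<close> is at most
  \<open>C2\<close> times a lower bound of the total weight, so the threshold \<open>2 * C2\<close>
  retains at least half of that bound. Entries up to \<open>J\<close> suffice for equality in
  \<open>walk_sum_return\<close>.\<close>

lemma walk_sum_typical:
  "\<exists>c>0. \<exists>C1>0. \<forall>J. c * exp (real J) * decay (J + 1) \<le>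
     (\<Sum>us\<in>{us\<in>count_lists J J. damped us + drift_sum us \<le> C1}. walk (\<lambda>x. of_bool (x = 1)) 1 us)"
proof -
  define \<psi> where "\<psi> = (\<lambda>x::nat. of_bool (x = 1) :: real)"
  have \<psi>0: "0 \<le> \<psi> y" for y by (simp add: \<psi>_def)
  have bound: "walk_sum n \<psi> x m \<le> 3 * exp 1 * real x * exp (real m) * decay (m + 2)" for n x m
  proof -
    have "walk_sum n \<psi> x m \<le> hits x (Suc m)" unfolding \<psi>_def by (rule walk_sum_return_le)
    also have "\<dots> \<le> real x * exp (real (Suc m)) * decay (Suc m)" by (rule hits_upper) simp
    also have "\<dots> \<le> real x * exp (real (Suc m)) * (3 * decay (m + 2))"
      by (intro mult_left_mono decay_half) auto
    finally show ?thesis by (simp add: exp_add mult_ac)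
  qed
  obtain C where C: "0 < C" "\<And>n m. (\<Sum>us\<in>count_lists n m. walk \<psi> 1 us * drift_sum us) \<le> C * exp (real m) * decay (m + 1)"
    using sum_walk_drift_le unfolding \<psi>_def by blast
  define C2 where "C2 = 150 * exp 1 + C"
  define C1 where "C1 = 2 * C2"
  have C2: "0 < C2" using C by (simp add: C2_def add_pos_pos)
  have "1 / 2 * exp (real J) * decay (J + 1) \<le>
     (\<Sum>us\<in>{us\<in>count_lists J J. damped us + drift_sum us \<le> C1}. walk \<psi> 1 us)" for J
  proof -
    define E where "E = exp (real J) * decay (J + 1)"
    define S where "S = count_lists J J"
    define G where "G = {us\<in>S. damped us + drift_sum us \<le> C1}"
    have fS: "finite S" by (simp add: S_def)
    have E0: "0 \<le> E" by (simp add: E_def)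
    have tot: "E \<le> (\<Sum>us\<in>S. walk \<psi> 1 us)"
    proof -
      have "exp (real (Suc J)) * decay (Suc J) / exp 1 \<le> hits 1 (Suc J)" by (rule hits_diag_lower) simp
      also have "hits 1 (Suc J) = (\<Sum>us\<in>S. walk \<psi> 1 us)"
        using walk_sum_return[of J J 1] unfolding walk_sum_def \<psi>_def S_def by simp
      finally show ?thesis by (simp add: E_def exp_add)
    qed
    have "(\<Sum>us\<in>S. walk \<psi> 1 us * damped us) \<le> 50 * (3 * exp 1) * real 1 * exp (real J) * decay (J + 2)"
      unfolding S_def by (rule sum_walk_damped[OF \<psi>0 _ bound]) simp
    also have "\<dots> \<le> 50 * (3 * exp 1) * real 1 * exp (real J) * decay (J + 1)"
      by (intro mult_left_mono decay_antimono) auto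
    finally have "(\<Sum>us\<in>S. walk \<psi> 1 us * (damped us + drift_sum us)) \<le> C2 * E"
      using C(2)[of J J] by (simp add: S_def C2_def E_def sum.distrib algebra_simps)
    moreover have "(\<Sum>us\<in>S - G. walk \<psi> 1 us * C1) \<le> (\<Sum>us\<in>S. walk \<psi> 1 us * (damped us + drift_sum us))"
    proof -
      have "(\<Sum>us\<in>S - G. walk \<psi> 1 us * C1) \<le> (\<Sum>us\<in>S - G. walk \<psi> 1 us * (damped us + drift_sum us))"
        by (intro sum_mono mult_left_mono walk_nonneg \<psi>0) (auto simp: G_def)
      also have "\<dots> \<le> (\<Sum>us\<in>S. walk \<psi> 1 us * (damped us + drift_sum us))"
        using fS by (intro sum_mono2) (auto intro!: mult_nonneg_nonneg walk_nonneg \<psi>0 add_nonneg_nonneg)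
      finally show ?thesis .
    qed
    moreover have "(\<Sum>us\<in>S - G. walk \<psi> 1 us * C1) = C2 * (2 * (\<Sum>us\<in>S - G. walk \<psi> 1 us))"
      by (simp add: C1_def sum_distrib_right[symmetric])
    ultimately have "C2 * (2 * (\<Sum>us\<in>S - G. walk \<psi> 1 us)) \<le> C2 * E"
      by linarith
    then have "2 * (\<Sum>us\<in>S - G. walk \<psi> 1 us) \<le> E" using C2 by simp
    moreover have "(\<Sum>us\<in>S. walk \<psi> 1 us) = (\<Sum>us\<in>S - G. walk \<psi> 1 us) + (\<Sum>us\<in>G. walk \<psi> 1 us)"
      by (rule sum.subset_diff) (auto simp: G_def fS)
    ultimately show ?thesis using tot by (simp add: E_def G_def S_def)
  qed
  then show ?thesis using C2 unfolding \<psi>_def C1_def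
    by (intro exI[of _ "1/2"] conjI exI[of _ "2 * C2"]) auto
qed

section \<open>Dyadic blocks: the upper bound\<close>

lemma sum_wt_size_recursion:
  assumes A: "0 \<notin> A" "finite A"
  shows "real (Suc b) * (\<Sum>N\<in>msets_size A (Suc b). wt N * f N) =
    (\<Sum>x\<in>A. (\<Sum>N\<in>msets_size A b. wt N * f (add_mset x N)) / real x)"
proof -
  have "real (Suc b) * (\<Sum>N\<in>msets_size A (Suc b). wt N * f N) =
    (\<Sum>N\<in>msets_size A (Suc b). \<Sum>x\<in>A. wt N * (real (count N x) * real x) * (f (add_mset x (N - {#x#})) / real x))"
  proof (subst sum_distrib_left, rule sum.cong[OF refl])
    fix N assume N: "N \<in> msets_size A (Suc b)"
    then have "real (Suc b) = (\<Sum>x\<in>A. real (count N x))"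
      using size_eq_sum_superset[of A N] A by (simp add: msets_size_def)
    then have "real (Suc b) * (wt N * f N) = (\<Sum>x\<in>A. real (count N x) * (wt N * f N))"
      by (simp only: sum_distrib_right)
    also have "\<dots> = (\<Sum>x\<in>A. wt N * (real (count N x) * real x) * (f (add_mset x (N - {#x#})) / real x))"
    proof (rule sum.cong[OF refl])
      fix x assume "x \<in> A"
      then have "real x \<noteq> 0" using A by (metis of_nat_0_eq_iff)
      moreover have "add_mset x (N - {#x#}) = N" if "count N x \<noteq> 0" using that by (simp add: count_eq_zero_iff)
      ultimately show "real (count N x) * (wt N * f N) =
          wt N * (real (count N x) * real x) * (f (add_mset x (N - {#x#})) / real x)"
        by (cases "count N x = 0") auto
    qed
    finally show "real (Suc b) * (wt N * f N) =
        (\<Sum>x\<in>A. wt N * (real (count N x) * real x) * (f (add_mset x (N - {#x#})) / real x))" .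
  qed
  also have "\<dots> = (\<Sum>x\<in>A. \<Sum>N\<in>msets_size A (Suc b). wt N * (real (count N x) * real x) * (f (add_mset x (N - {#x#})) / real x))"
    by (rule sum.swap)
  also have "\<dots> = (\<Sum>x\<in>A. (\<Sum>N\<in>msets_size A b. wt N * f (add_mset x N)) / real x)"
  proof (rule sum.cong[OF refl])
    fix x assume x: "x \<in> A"
    then have "{N. add_mset x N \<in> msets_size A (Suc b)} = msets_size A b"
      by (auto simp: msets_size_def)
    moreover have "0 < x" using x A by (auto intro: gr0I)
    ultimately show "(\<Sum>N\<in>msets_size A (Suc b). wt N * (real (count N x) * real x) * (f (add_mset x (N - {#x#})) / real x))
        = (\<Sum>N\<in>msets_size A b. wt N * f (add_mset x N)) / real x"
      using sum_wt_marked[of "msets_size A (Suc b)" x "\<lambda>N. f (add_mset x N) / real x"] A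
      by (simp add: sum_divide_distrib)
  qed
  finally show ?thesis .
qed

lemma msets_size_0 [simp]: "msets_size A 0 = {{#}}"
  by (auto simp: msets_size_def)

lemma sum_wt_msets_size:
  assumes A: "0 \<notin> A" "finite A"
  shows "(\<Sum>N\<in>msets_size A b. wt N) = (\<Sum>x\<in>A. 1 / real x) ^ b / fact b"
proof (induction b)
  case (Suc b)
  define t where "t = (\<Sum>N\<in>msets_size A (Suc b). wt N)"
  have "t = real (Suc b) * t / real (Suc b)" by simp
  also have "real (Suc b) * t = (\<Sum>x\<in>A. (\<Sum>N\<in>msets_size A b. wt N) / real x)"
    using sum_wt_size_recursion[OF A, of b "\<lambda>_. 1"] unfolding t_def by simp
  also have "\<dots> = (\<Sum>x\<in>A. 1 / real x) * ((\<Sum>x\<in>A. 1 / real x) ^ b / fact b)"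
    unfolding Suc sum_distrib_right by (simp add: mult.commute)
  also have "\<dots> / real (Suc b) = (\<Sum>x\<in>A. 1 / real x) ^ Suc b / fact (Suc b)" by simp
  finally show ?case by (simp only: t_def)
qed simp

section \<open>Multisets with prescribed numbers of parts in disjoint blocks\<close>

fun block_msets :: "(nat \<Rightarrow> nat set) \<Rightarrow> nat list \<Rightarrow> nat multiset set" where
  "block_msets B [] = {{#}}"
| "block_msets B (b # us) = (\<lambda>(M, N). M + N) ` (block_msets B us \<times> msets_size (B (length us)) b)"

locale blocks =
  fixes B :: "nat \<Rightarrow> nat set"
  assumes finite_block [simp]: "finite (B i)" and zero_block [simp]: "0 \<notin> B i"
    and disjoint_blocks: "i < j \<Longrightarrow> B i \<inter> B j = {}"
begin

lemma finite_block_msets [simp]: "finite (block_msets B us)"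
  by (induction us) auto

lemma block_msets_subset: "M \<in> block_msets B us \<Longrightarrow> set_mset M \<subseteq> (\<Union>i<length us. B i)"
  by (induction us arbitrary: M) (fastforce simp: msets_size_def less_Suc_eq)+

lemma block_msets_size: "M \<in> block_msets B us \<Longrightarrow> size M = sum_list us"
  by (induction us arbitrary: M) (auto simp: msets_size_def)

lemma block_msets_filter:
  assumes "M \<in> block_msets B us" "N \<in> msets_size (B (length us)) b"
  shows "filter_mset (\<lambda>x. x \<notin> B (length us)) (M + N) = M" "filter_mset (\<lambda>x. x \<in> B (length us)) (M + N) = N"
    "set_mset M \<inter> set_mset N = {}"
proof -
  have M: "x \<notin> B (length us)" if "x \<in># M" for x
    using block_msets_subset[OF assms(1)] that disjoint_blocks[of _ "length us"] by fastforce
  have N: "x \<in> B (length us)" if "x \<in># N" for x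
    using assms(2) that by (auto simp: msets_size_def)
  show "set_mset M \<inter> set_mset N = {}" using M N by blast
  have "filter_mset (\<lambda>x. x \<notin> B (length us)) M = M" "filter_mset (\<lambda>x. x \<in> B (length us)) N = N"
    using M N by (auto simp: filter_mset_eq_conv)
  moreover have "filter_mset (\<lambda>x. x \<notin> B (length us)) N = {#}" "filter_mset (\<lambda>x. x \<in> B (length us)) M = {#}"
    using M N by (auto simp: multiset_eq_iff count_eq_zero_iff)
  ultimately show "filter_mset (\<lambda>x. x \<notin> B (length us)) (M + N) = M"
    "filter_mset (\<lambda>x. x \<in> B (length us)) (M + N) = N" by simp_all
qed

lemma sum_block_msets_Cons:
  "(\<Sum>M\<in>block_msets B (b # us). wt M * f M) =
    (\<Sum>M\<in>block_msets B us. wt M * (\<Sum>N\<in>msets_size (B (length us)) b. wt N * f (M + N)))"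
proof -
  have "inj_on (\<lambda>(M, N). M + N) (block_msets B us \<times> msets_size (B (length us)) b)"
  proof (rule inj_onI, clarsimp)
    fix M N M' N' assume "M \<in> block_msets B us" "N \<in> msets_size (B (length us)) b"
      "M' \<in> block_msets B us" "N' \<in> msets_size (B (length us)) b" "M + N = M' + N'"
    then show "M = M' \<and> N = N'"
      using block_msets_filter(1,2)[of M us N b] block_msets_filter(1,2)[of M' us N' b] by metis
  qed
  then have "(\<Sum>M\<in>block_msets B (b # us). wt M * f M) =
      (\<Sum>(M, N)\<in>block_msets B us \<times> msets_size (B (length us)) b. wt (M + N) * f (M + N))"
    by (simp add: sum.reindex case_prod_unfold)
  also have "\<dots> = (\<Sum>(M, N)\<in>block_msets B us \<times> msets_size (B (length us)) b. wt M * (wt N * f (M + N)))"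
    by (rule sum.cong) (auto simp: wt_union block_msets_filter(3))
  also have "\<dots> = (\<Sum>M\<in>block_msets B us. wt M * (\<Sum>N\<in>msets_size (B (length us)) b. wt N * f (M + N)))"
    by (simp add: sum.cartesian_product sum_distrib_left)
  finally show ?thesis .
qed

lemma block_msets_disjoint:
  "length us = length vs \<Longrightarrow> us \<noteq> vs \<Longrightarrow> block_msets B us \<inter> block_msets B vs = {}"
proof (induction us arbitrary: vs)
  case (Cons u us)
  then obtain v vs' where vs: "vs = v # vs'" "length us = length vs'" by (cases vs) auto
  show ?case
  proof (rule ccontr)
    assume "block_msets B (u # us) \<inter> block_msets B vs \<noteq> {}"
    then obtain M N M' N' where M: "M \<in> block_msets B us" "N \<in> msets_size (B (length us)) u"
      "M' \<in> block_msets B vs'" "N' \<in> msets_size (B (length us)) v" "M + N = M' + N'"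
      unfolding vs using vs(2) by auto
    have "M = M'" "N = N'"
      using block_msets_filter(1,2)[OF M(1,2)] block_msets_filter(1,2)[of M' vs' N' v] M vs(2) by auto
    then have "u = v" using M by (auto simp: msets_size_def)
    then have "us \<noteq> vs'" using Cons.prems vs by auto
    then show False using Cons.IH[OF vs(2)] M \<open>M = M'\<close> by auto
  qed
qed simp

definition block_mass :: "nat list \<Rightarrow> real" where
  "block_mass us = (\<Sum>M\<in>block_msets B us. wt M)"

definition harm_block :: "nat \<Rightarrow> real" where
  "harm_block i = (\<Sum>x\<in>B i. 1 / real x)"

lemma block_mass_simps [simp]: "block_mass [] = 1"
  "block_mass (b # us) = harm_block (length us) ^ b / fact b * block_mass us"
  using sum_block_msets_Cons[where b = b and us = us and f = "\<lambda>_. 1"]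
  by (simp_all add: block_mass_def sum_wt_msets_size harm_block_def mult.commute
      flip: sum_distrib_right sum_divide_distrib)

lemma block_mass_nonneg: "0 \<le> block_mass us"
  unfolding block_mass_def by (intro sum_nonneg) simp

lemma harm_block_nonneg: "0 \<le> harm_block i"
  unfolding harm_block_def by (intro sum_nonneg) simp

lemma block_mass_le:
  assumes "\<And>i. harm_block i \<le> a"
  shows "block_mass us \<le> fact_weight a us"
proof (induction us)
  case (Cons b us)
  have "0 \<le> a" using assms harm_block_nonneg order_trans by blast
  then have "harm_block (length us) ^ b / fact b * block_mass us \<le> a ^ b / fact b * fact_weight a us"
    using assms Cons.IH
    by (intro mult_mono divide_right_mono power_mono harm_block_nonneg block_mass_nonneg) auto
  then show ?case by simp
qed simp

lemma block_mass_ge: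
  assumes "\<And>i. a \<le> harm_block i" "0 \<le> a"
  shows "fact_weight a us \<le> block_mass us"
proof (induction us)
  case (Cons b us)
  have "a ^ b / fact b * fact_weight a us \<le> harm_block (length us) ^ b / fact b * block_mass us"
    using assms Cons.IH
    by (intro mult_mono divide_right_mono power_mono fact_weight_nonneg divide_nonneg_nonneg)
       (auto intro!: zero_le_power harm_block_nonneg)
  then show ?case by simp
qed simp

lemma block_msets_append:
  "M \<in> block_msets B (vs @ us) \<Longrightarrow> \<exists>M1 M2. M1 \<in> block_msets B us \<and> M = M1 + M2 \<and> size M2 = sum_list vs"
proof (induction vs arbitrary: M)
  case (Cons v vs)
  then obtain M' N where M': "M' \<in> block_msets B (vs @ us)" "N \<in> msets_size (B (length (vs @ us))) v" "M = M' + N"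
    by auto
  from Cons.IH[OF M'(1)] obtain M1 M2 where "M1 \<in> block_msets B us" "M' = M1 + M2" "size M2 = sum_list vs" by blast
  then show ?case using M' by (intro exI[of _ M1] exI[of _ "M2 + N"]) (auto simp: msets_size_def)
qed simp

lemma block_msets_cover:
  assumes "set_mset M \<subseteq> (\<Union>i<J. B i)" "size M \<le> n"
  shows "\<exists>us\<in>count_lists n J. M \<in> block_msets B us"
  using assms
proof (induction J arbitrary: M)
  case 0
  then show ?case by simp
next
  case (Suc J)
  define M1 N where "M1 = filter_mset (\<lambda>x. x \<notin> B J) M" and "N = filter_mset (\<lambda>x. x \<in> B J) M"
  have MN: "M = M1 + N" unfolding M1_def N_def by (metis add.commute multiset_partition)
  have "set_mset M1 \<subseteq> (\<Union>i<J. B i)" using Suc.prems by (fastforce simp: M1_def less_Suc_eq)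
  moreover have sz: "size M1 \<le> n" "size N \<le> n" using Suc.prems MN by auto
  ultimately obtain us where us: "us \<in> count_lists n J" "M1 \<in> block_msets B us" using Suc.IH by blast
  have "N \<in> msets_size (B (length us)) (size N)"
    using us by (auto simp: msets_size_def N_def count_lists_def)
  then have "M \<in> block_msets B (size N # us)" using us MN by auto
  moreover have "size N # us \<in> count_lists n (Suc J)" using us sz by (auto simp: count_lists_def)
  ultimately show ?case by blast
qed

lemma sum_mset_block_msets:
  assumes "\<And>i x. x \<in> B i \<Longrightarrow> x \<le> 2 ^ Suc i"
  shows "M \<in> block_msets B us \<Longrightarrow> 1 + real (\<Sum>\<^sub># M) \<le> 2 ^ length us * damped us"
proof (induction us arbitrary: M)
  case (Cons b us)
  then obtain M' N where M': "M' \<in> block_msets B us" "N \<in> msets_size (B (length us)) b" "M = M' + N" by auto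
  have "\<Sum>\<^sub># N \<le> size N * 2 ^ Suc (length us)" if "set_mset N \<subseteq> B (length us)" for N
    using that
  proof (induction N)
    case (add x N)
    then have "x \<le> 2 ^ Suc (length us)" using assms by auto
    with add show ?case by simp
  qed simp
  then have "\<Sum>\<^sub># N \<le> b * 2 ^ Suc (length us)" using M'(2) by (auto simp: msets_size_def)
  then have "real (\<Sum>\<^sub># N) \<le> real (b * 2 ^ Suc (length us))" by (simp only: of_nat_le_iff)
  moreover have "real (\<Sum>\<^sub># M) = real (\<Sum>\<^sub># M') + real (\<Sum>\<^sub># N)" unfolding M' by simp
  moreover have "1 + real (\<Sum>\<^sub># M') \<le> 2 ^ length us * damped us" by (rule Cons.IH[OF M'(1)])
  ultimately show ?case by (simp add: algebra_simps)
qed simp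

end

text \<open>Two families of dyadic blocks, closed at opposite ends: comparison with logarithms makes
  the harmonic mass at most \<open>ln 2\<close> here and at least \<open>ln 2\<close> for
  \<open>lower_blocks\<close>. Exact one-sided bounds matter, because the masses are raised to the
  counts and multiplied over all blocks. The part 1 lies in no block of the present family.\<close>

interpretation upper_blocks: blocks "\<lambda>i. {2 ^ i<..2 ^ Suc i}"
proof
  fix i j :: nat assume "i < j"
  then have "2 ^ Suc i \<le> (2::nat) ^ j" by (intro power_increasing) auto
  then show "{2 ^ i<..2 ^ Suc i} \<inter> {2 ^ j<..2 ^ Suc j} = ({} :: nat set)" by auto
qed auto

interpretation lower_blocks: blocks "\<lambda>i. {2 ^ i..<2 ^ Suc i}"
proof
  fix i j :: nat assume "i < j"
  then have "2 ^ Suc i \<le> (2::nat) ^ j" by (intro power_increasing) auto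
  then show "{2 ^ i..<2 ^ Suc i} \<inter> {2 ^ j..<2 ^ Suc j} = ({} :: nat set)" by auto
qed auto

lemma ln_Suc_diff_bounds:
  assumes "1 \<le> x"
  shows "1 / real (Suc x) \<le> ln (real (Suc x)) - ln (real x)" "ln (real (Suc x)) - ln (real x) \<le> 1 / real x"
proof -
  have x: "0 < real x" using assms by simp
  have "ln (real x / real (Suc x)) \<le> real x / real (Suc x) - 1" using x by (intro ln_le_minus_one) auto
  then show "1 / real (Suc x) \<le> ln (real (Suc x)) - ln (real x)"
    using x by (simp add: ln_div field_simps)
  have "ln (real (Suc x) / real x) \<le> real (Suc x) / real x - 1" using x by (intro ln_le_minus_one) auto
  then show "ln (real (Suc x)) - ln (real x) \<le> 1 / real x"
    using x by (simp add: ln_div field_simps)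
qed

lemma sum_ln_dyadic: "(\<Sum>x\<in>{2 ^ i..<2 ^ Suc i}. ln (real (Suc x)) - ln (real x)) = ln 2"
  by (subst sum_Suc_diff') (auto simp: ln_realpow algebra_simps ln_mult)

lemma upper_harm: "upper_blocks.harm_block i \<le> ln 2"
proof -
  have "upper_blocks.harm_block i = (\<Sum>x\<in>{2 ^ i..<2 ^ Suc i}. 1 / real (Suc x))"
    unfolding upper_blocks.harm_block_def
    by (rule sum.reindex_bij_witness[of _ Suc "\<lambda>x. x - 1"]) auto
  also have "\<dots> \<le> (\<Sum>x\<in>{2 ^ i..<2 ^ Suc i}. ln (real (Suc x)) - ln (real x))"
    by (intro sum_mono ln_Suc_diff_bounds) (auto intro: order_trans[OF one_le_power])
  finally show ?thesis by (simp only: sum_ln_dyadic)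
qed

lemma lower_harm: "ln 2 \<le> lower_blocks.harm_block i"
  unfolding lower_blocks.harm_block_def sum_ln_dyadic[of i, symmetric]
  by (intro sum_mono ln_Suc_diff_bounds) (auto intro: order_trans[OF one_le_power])

lemma Union_upper_blocks: "(\<Union>i<J. {2 ^ i<..2 ^ Suc i}) = {1<..2 ^ J :: nat}"
proof (induction J)
  case (Suc J)
  have "(\<Union>i<Suc J. {2 ^ i<..2 ^ Suc i}) = {1<..2 ^ J :: nat} \<union> {2 ^ J<..2 ^ Suc J}"
    by (simp only: lessThan_Suc UN_insert Suc Un_commute)
  also have "\<dots> = {1<..2 ^ Suc J}" by auto
  finally show ?case .
qed simp

lemma sum_exp_two: "(\<Sum>c\<le>n. 2 ^ c / fact c) \<le> exp (2::real)"
proof -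
  have "(\<lambda>c. 2 ^ c / fact c) sums exp (2::real)"
    using exp_converges[of "2::real"] by (simp add: divide_inverse mult.commute)
  then show ?thesis using sum_le_suminf[of "\<lambda>c. 2 ^ c / fact c :: real" "{..n}"]
    by (simp add: sums_iff)
qed

lemma real_card_subsums_union: "real (card (subsums (M + N))) \<le> 2 ^ size N * real (card (subsums M))"
proof -
  have "real (card (subsums (M + N))) \<le> real (2 ^ size N * card (subsums M))"
    by (simp only: of_nat_le_iff card_subsums_union)
  then show ?thesis by simp
qed

text \<open>A number \<open>c\<close> of parts equal to 1 has weight \<open>1 / c!\<close> and
  multiplies the number of subset sums by at most \<open>2 ^ c\<close>; summing over
  \<open>c\<close> gives \<open>exp 2\<close>.\<close>

lemma smooth_sum_remove_ones:
  "smooth_sum n Q \<le> exp 2 * (\<Sum>M\<in>msets_sum_le {1<..Q} n. wt M * real (card (subsums M)))"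
proof -
  define X where "X = msets_sum_le {1<..Q} n"
  define Y where "Y = (\<Union>c\<le>n. msets_size {1::nat} c)"
  have fX: "finite X" and fY: "finite Y" by (simp_all add: X_def Y_def)
  define f where "f = (\<lambda>M. wt M * real (card (subsums M)))"
  have f0: "0 \<le> f M" for M by (simp add: f_def)
  have "msets_sum_le {1..Q} n \<subseteq> (\<lambda>(M, N). M + N) ` (X \<times> Y)"
  proof
    fix M assume M: "M \<in> msets_sum_le {1..Q} n"
    define P N where "P = filter_mset (\<lambda>x. x \<noteq> 1) M" and "N = filter_mset (\<lambda>x. x = 1) M"
    have MPN: "M = P + N" unfolding P_def N_def by (metis add.commute multiset_partition)
    have s: "\<Sum>\<^sub># P + \<Sum>\<^sub># N \<le> n" using M unfolding MPN by (simp add: msets_sum_le_def)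
    have "P \<in> X" using M s by (fastforce simp: X_def P_def msets_sum_le_def)
    moreover have "size N \<le> n" using size_le_sum_mset[of N] s by (simp add: N_def)
    then have "N \<in> Y" unfolding Y_def by (auto simp: msets_size_def N_def)
    ultimately show "M \<in> (\<lambda>(M, N). M + N) ` (X \<times> Y)" using MPN by auto
  qed
  then have "smooth_sum n Q \<le> (\<Sum>M\<in>(\<lambda>(M, N). M + N) ` (X \<times> Y). f M)"
    unfolding smooth_sum_def f_def[symmetric] using fX fY f0 by (intro sum_mono2) auto
  also have "\<dots> \<le> (\<Sum>z\<in>X \<times> Y. f ((\<lambda>(M, N). M + N) z))"
    using sum_image_le[of "X \<times> Y" f "\<lambda>(M, N). M + N"] fX fY f0 by (simp add: comp_def)
  also have "\<dots> \<le> (\<Sum>(M, N)\<in>X \<times> Y. f M * (wt N * 2 ^ size N))"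
  proof (rule sum_mono)
    fix z assume z: "z \<in> X \<times> Y"
    obtain M N where MN: "z = (M, N)" by (cases z)
    have "wt (M + N) = wt M * wt N"
      using z MN by (intro wt_union) (auto simp: X_def Y_def msets_sum_le_def msets_size_def)
    moreover have "real (card (subsums (M + N))) \<le> 2 ^ size N * real (card (subsums M))"
      by (rule real_card_subsums_union)
    ultimately have "f (M + N) \<le> wt M * wt N * (2 ^ size N * real (card (subsums M)))"
      unfolding f_def by (auto intro!: mult_left_mono)
    then show "f ((\<lambda>(M, N). M + N) z) \<le> (case z of (M, N) \<Rightarrow> f M * (wt N * 2 ^ size N))"
      by (simp add: MN f_def mult_ac)
  qed
  also have "\<dots> = (\<Sum>M\<in>X. f M) * (\<Sum>N\<in>Y. wt N * 2 ^ size N)"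
    by (simp add: sum_product sum.cartesian_product)
  also have "(\<Sum>N\<in>Y. wt N * 2 ^ size N) = (\<Sum>c\<le>n. \<Sum>N\<in>msets_size {1} c. wt N * 2 ^ size N)"
    unfolding Y_def by (rule sum.UNION_disjoint) (auto simp: msets_size_def finite_msets_size[unfolded msets_size_def])
  also have "\<dots> = (\<Sum>c\<le>n. 2 ^ c / fact c)"
  proof (rule sum.cong[OF refl])
    fix c
    have "(\<Sum>N\<in>msets_size {1} c. wt N * 2 ^ size N) = (\<Sum>N\<in>msets_size {1} c. wt N) * 2 ^ c"
      unfolding sum_distrib_right by (rule sum.cong) (auto simp: msets_size_def)
    then show "(\<Sum>N\<in>msets_size {1} c. wt N * 2 ^ size N) = 2 ^ c / (fact c :: real)"
      by (simp add: sum_wt_msets_size)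
  qed
  also have "(\<Sum>M\<in>X. f M) * \<dots> \<le> (\<Sum>M\<in>X. f M) * exp 2"
    by (intro mult_left_mono sum_exp_two sum_nonneg f0)
  finally show ?thesis by (simp add: X_def f_def mult.commute)
qed

text \<open>For a split \<open>bs = vs @ us\<close>, the subset sums of the parts counted by
  \<open>us\<close> lie in an interval of at most \<open>2 ^ length us * damped us\<close> integers,
  and each part counted by \<open>vs\<close> at most doubles their number.\<close>

theorem smooth_sum_upper:
  "\<exists>C>0. \<forall>n J. smooth_sum n (2 ^ J) \<le> C * (2 * (ln 2 * exp 1)) ^ J * decay (J + 1)"
proof -
  obtain C where C: "0 < C" and CF: "\<forall>n J F. (\<forall>bs\<in>count_lists n J. \<forall>vs us. bs = vs @ us \<longrightarrow>
       F bs \<le> 2 ^ sum_list vs * (2 ^ length us * damped us)) \<longrightarrow>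
     (\<Sum>bs\<in>count_lists n J. fact_weight (ln 2) bs * F bs) \<le> C * (2 * (ln 2 * exp 1)) ^ J * decay (J + 1)"
    using sum_fact_weight_min_le by (elim exE conjE) (rule that)
  define B where "B = (\<lambda>i::nat. {2 ^ i<..2 ^ Suc i :: nat})"
  define f where "f = (\<lambda>M. wt M * real (card (subsums M)))"
  have "smooth_sum n (2 ^ J) \<le> exp 2 * C * (2 * (ln 2 * exp 1)) ^ J * decay (J + 1)" for n J
  proof -
    define S where "S = count_lists n J"
    have lenS: "length us = J" if "us \<in> S" for us using that by (simp add: S_def count_lists_def)
    have pos: "0 < fact_weight (ln 2) us" for us by (induction us) auto
    \<comment> \<open>Dividing by the positive weight brings the block sums into the form of
      \<open>CF\<close>; its hypothesis then follows from \<open>block_mass_le\<close>.\<close>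
    define F where "F = (\<lambda>us. (\<Sum>M\<in>block_msets B us. f M) / fact_weight (ln 2) us)"
    have "msets_sum_le {1<..2 ^ J} n \<subseteq> (\<Union>us\<in>S. block_msets B us)"
    proof
      fix M assume M: "M \<in> msets_sum_le {1<..2 ^ J} n"
      then have "0 \<notin># M" by (auto simp: msets_sum_le_def)
      with M have "size M \<le> n" using size_le_sum_mset[of M] by (simp add: msets_sum_le_def)
      moreover have "set_mset M \<subseteq> (\<Union>i<J. B i)"
        using M unfolding B_def Union_upper_blocks by (simp add: msets_sum_le_def)
      ultimately show "M \<in> (\<Union>us\<in>S. block_msets B us)"
        using upper_blocks.block_msets_cover[folded B_def, of M J n] by (auto simp: S_def)
    qed
    then have "(\<Sum>M\<in>msets_sum_le {1<..2 ^ J} n. f M) \<le> (\<Sum>M\<in>(\<Union>us\<in>S. block_msets B us). f M)"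
      by (intro sum_mono2) (auto simp: S_def f_def upper_blocks.finite_block_msets[folded B_def])
    also have "\<dots> = (\<Sum>us\<in>S. \<Sum>M\<in>block_msets B us. f M)"
      using upper_blocks.block_msets_disjoint[folded B_def] lenS
      by (intro sum.UNION_disjoint) (auto simp: S_def upper_blocks.finite_block_msets[folded B_def])
    also have "\<dots> = (\<Sum>us\<in>S. fact_weight (ln 2) us * F us)"
      by (rule sum.cong[OF refl]) (use pos in \<open>simp add: F_def less_imp_neq[THEN not_sym]\<close>)
    also have "\<dots> \<le> C * (2 * (ln 2 * exp 1)) ^ J * decay (J + 1)"
      unfolding S_def
    proof (rule CF[rule_format])
      fix bs vs us assume bs: "bs \<in> count_lists n J" "bs = vs @ us"
      define K where "K = 2 ^ sum_list vs * (2 ^ length us * damped us)"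
      have "0 \<le> K" by (simp add: K_def)
      have "(\<Sum>M\<in>block_msets B bs. f M) \<le> (\<Sum>M\<in>block_msets B bs. wt M * K)"
        unfolding f_def
      proof (intro sum_mono mult_left_mono)
        fix M assume "M \<in> block_msets B bs"
        then obtain M1 M2 where M: "M1 \<in> block_msets B us" "M = M1 + M2" "size M2 = sum_list vs"
          using upper_blocks.block_msets_append[folded B_def] bs by blast
        have "real (card (subsums M)) \<le> 2 ^ size M2 * real (card (subsums M1))"
          unfolding M(2) by (rule real_card_subsums_union)
        also have "real (card (subsums M1)) \<le> real (1 + \<Sum>\<^sub># M1)"
          using card_subsums_le_sum[of M1] by (simp only: of_nat_le_iff)
        also have "real (1 + \<Sum>\<^sub># M1) = 1 + real (\<Sum>\<^sub># M1)" by (simp only: of_nat_add of_nat_1)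
        also have "\<dots> \<le> 2 ^ length us * damped us"
          by (rule upper_blocks.sum_mset_block_msets[folded B_def, OF _ M(1)]) (simp add: B_def)
        finally show "real (card (subsums M)) \<le> K" by (simp add: K_def M(3))
      qed simp
      also have "\<dots> = upper_blocks.block_mass bs * K"
        unfolding upper_blocks.block_mass_def B_def sum_distrib_right ..
      also have "\<dots> \<le> fact_weight (ln 2) bs * K"
        using \<open>0 \<le> K\<close> by (intro mult_right_mono upper_blocks.block_mass_le upper_harm) auto
      finally show "F bs \<le> 2 ^ sum_list vs * (2 ^ length us * damped us)"
        unfolding F_def K_def using pos[of bs] by (simp add: pos_divide_le_eq mult.commute)
    qed
    finally have "exp 2 * (\<Sum>M\<in>msets_sum_le {1<..2 ^ J} n. f M) \<le> exp 2 * (C * (2 * (ln 2 * exp 1)) ^ J * decay (J + 1))"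
      by (intro mult_left_mono) auto
    with smooth_sum_remove_ones[of n "2 ^ J"] show ?thesis
      unfolding f_def mult.assoc by (rule order_trans)
  qed
  then show ?thesis using C by (intro exI[of _ "exp 2 * C"]) auto
qed

section \<open>Dyadic blocks: the lower bound\<close>

text \<open>The coefficient at \<open>l\<close> counts the selections of parts with sum
  \<open>l\<close>, equal parts being distinguishable.\<close>

definition gen_poly :: "nat multiset \<Rightarrow> real poly" where
  "gen_poly M = (\<Prod>x\<in>#M. 1 + monom 1 x)"

text \<open>The number of pairs of selections with equal sums.\<close>

definition energy :: "nat multiset \<Rightarrow> real" where
  "energy M = (\<Sum>l\<le>\<Sum>\<^sub># M. (coeff (gen_poly M) l)\<^sup>2)"

lemma gen_poly_empty [simp]: "gen_poly {#} = 1"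
  by (simp add: gen_poly_def)

lemma coeff_gen_poly_add:
  "coeff (gen_poly (add_mset x M)) l = coeff (gen_poly M) l + (if x \<le> l then coeff (gen_poly M) (l - x) else 0)"
  by (simp add: gen_poly_def distrib_right coeff_monom_mult)

lemma coeff_gen_poly_nonneg: "0 \<le> coeff (gen_poly M) l"
  by (induction M arbitrary: l) (auto simp: coeff_gen_poly_add)

lemma coeff_gen_poly_eq_0: "l \<notin> subsums M \<Longrightarrow> coeff (gen_poly M) l = 0"
proof (induction M arbitrary: l)
  case (add x M)
  then have "l \<notin> subsums M" "\<And>l'. l = x + l' \<Longrightarrow> l' \<notin> subsums M" by (auto simp: subsums_add_mset)
  with add.IH show ?case by (auto simp: coeff_gen_poly_add)
qed auto

lemma coeff_gen_poly_large: "\<Sum>\<^sub># M < l \<Longrightarrow> coeff (gen_poly M) l = 0"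
  by (rule coeff_gen_poly_eq_0) (auto dest: subsums_le)

lemma sum_coeff_shift:
  fixes g :: "nat \<Rightarrow> real"
  assumes "S + x \<le> T"
  shows "(\<Sum>l\<le>T. if x \<le> l then (if l - x \<le> S then g (l - x) else 0) else 0) = (\<Sum>l\<le>S. g l)"
proof -
  have "(\<Sum>l\<le>T. if x \<le> l then (if l - x \<le> S then g (l - x) else 0) else 0) =
      (\<Sum>l\<in>{x..S + x}. g (l - x))"
    using assms by (intro sum.mono_neutral_cong_right) auto
  also have "\<dots> = (\<Sum>l\<le>S. g l)"
    by (rule sum.reindex_bij_witness[of _ "\<lambda>l. l + x" "\<lambda>l. l - x"]) auto
  finally show ?thesis .
qed

lemma sum_coeff_extend:
  assumes "\<Sum>\<^sub># M \<le> T" "h 0 = (0::real)"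
  shows "(\<Sum>l\<le>T. h (coeff (gen_poly M) l)) = (\<Sum>l\<le>\<Sum>\<^sub># M. h (coeff (gen_poly M) l))"
  by (rule sum.mono_neutral_right) (use assms in \<open>simp_all add: coeff_gen_poly_large not_le\<close>)

lemma sum_coeff_gen_poly: "(\<Sum>l\<le>\<Sum>\<^sub># M. coeff (gen_poly M) l) = 2 ^ size M"
proof (induction M)
  case (add x M)
  let ?c = "coeff (gen_poly M)"
  have "(\<Sum>l\<le>\<Sum>\<^sub># (add_mset x M). coeff (gen_poly (add_mset x M)) l) =
      (\<Sum>l\<le>\<Sum>\<^sub># M + x. ?c l) + (\<Sum>l\<le>\<Sum>\<^sub># M + x. if x \<le> l then ?c (l - x) else 0)"
    by (simp add: coeff_gen_poly_add sum.distrib add.commute)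
  also have "(\<Sum>l\<le>\<Sum>\<^sub># M + x. ?c l) = 2 ^ size M"
    using sum_coeff_extend[of M "\<Sum>\<^sub># M + x" "\<lambda>c. c"] add by simp
  also have "(\<Sum>l\<le>\<Sum>\<^sub># M + x. if x \<le> l then ?c (l - x) else 0) =
      (\<Sum>l\<le>\<Sum>\<^sub># M + x. if x \<le> l then (if l - x \<le> \<Sum>\<^sub># M then ?c (l - x) else 0) else 0)"
    by (rule sum.cong) (auto intro!: coeff_gen_poly_large)
  also have "\<dots> = 2 ^ size M" using sum_coeff_shift[of "\<Sum>\<^sub># M" x "\<Sum>\<^sub># M + x" ?c] add by simp
  finally show ?case by simp
qed simp

text \<open>Pairs in which both or neither selection uses the new part give
  \<open>2 * energy M\<close>. Mixed pairs give twice the autocorrelation of the coefficients at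
  shift \<open>x\<close>.\<close>

lemma energy_add_mset:
  "energy (add_mset x M) = 2 * energy M +
    2 * (\<Sum>l\<le>\<Sum>\<^sub># M. if x \<le> l then coeff (gen_poly M) l * coeff (gen_poly M) (l - x) else 0)"
proof -
  let ?c = "coeff (gen_poly M)" and ?S = "\<Sum>\<^sub># M"
  have "energy (add_mset x M) = (\<Sum>l\<le>?S + x. (?c l)\<^sup>2 + (if x \<le> l then (?c (l - x))\<^sup>2 else 0) +
      2 * (if x \<le> l then ?c l * ?c (l - x) else 0))"
    unfolding energy_def by (rule sum.cong) (auto simp: coeff_gen_poly_add power2_eq_square algebra_simps)
  also have "\<dots> = (\<Sum>l\<le>?S + x. (?c l)\<^sup>2) + (\<Sum>l\<le>?S + x. if x \<le> l then (?c (l - x))\<^sup>2 else 0) +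
      2 * (\<Sum>l\<le>?S + x. if x \<le> l then ?c l * ?c (l - x) else 0)"
    by (simp only: sum.distrib sum_distrib_left)
  also have "(\<Sum>l\<le>?S + x. (?c l)\<^sup>2) = energy M"
    unfolding energy_def using sum_coeff_extend[of M "?S + x" "\<lambda>c. c\<^sup>2"] by simp
  also have "(\<Sum>l\<le>?S + x. if x \<le> l then (?c (l - x))\<^sup>2 else 0) =
      (\<Sum>l\<le>?S + x. if x \<le> l then (if l - x \<le> ?S then (?c (l - x))\<^sup>2 else 0) else 0)"
    by (rule sum.cong) (auto simp: coeff_gen_poly_large)
  also have "\<dots> = energy M" unfolding energy_def by (rule sum_coeff_shift) simp
  also have "(\<Sum>l\<le>?S + x. if x \<le> l then ?c l * ?c (l - x) else 0) =
      (\<Sum>l\<le>?S. if x \<le> l then ?c l * ?c (l - x) else 0)"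
    by (rule sum.mono_neutral_right) (auto simp: coeff_gen_poly_large)
  finally show ?thesis by simp
qed

text \<open>Summed over all shifts \<open>x\<close>, the autocorrelations count each ordered pair of
  selections at most once, hence at most \<open>4 ^ size M\<close> in all; the weight
  \<open>1 / x <= 1 / a\<close> makes this small.\<close>

lemma sum_energy_add_mset:
  assumes A: "finite A" "\<And>x. x \<in> A \<Longrightarrow> a \<le> x" and a: "1 \<le> a"
  shows "(\<Sum>x\<in>A. energy (add_mset x M) / real x) \<le>
    2 * (\<Sum>x\<in>A. 1 / real x) * energy M + 2 / real a * 4 ^ size M"
proof -
  let ?c = "coeff (gen_poly M)" and ?S = "\<Sum>\<^sub># M"
  define X where "X = (\<lambda>x. \<Sum>l\<le>?S. if x \<le> l then ?c l * ?c (l - x) else 0)"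
  have X0: "0 \<le> X x" for x
    unfolding X_def by (intro sum_nonneg) (auto intro!: mult_nonneg_nonneg coeff_gen_poly_nonneg)
  have "(\<Sum>x\<in>A. X x) = (\<Sum>l\<le>?S. ?c l * (\<Sum>x\<in>A. if x \<le> l then ?c (l - x) else 0))"
    unfolding X_def by (subst sum.swap) (auto simp: sum_distrib_left intro!: sum.cong)
  also have "\<dots> \<le> (\<Sum>l\<le>?S. ?c l * 2 ^ size M)"
  proof (intro sum_mono mult_left_mono coeff_gen_poly_nonneg)
    fix l assume l: "l \<in> {..?S}"
    have "(\<Sum>x\<in>A. if x \<le> l then ?c (l - x) else 0) = (\<Sum>x\<in>{x\<in>A. x \<le> l}. ?c (l - x))"
      using A(1) by (simp add: sum.inter_filter)
    also have "\<dots> = (\<Sum>j\<in>(\<lambda>x. l - x) ` {x\<in>A. x \<le> l}. ?c j)"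
      by (subst sum.reindex) (auto intro!: inj_onI)
    also have "\<dots> \<le> (\<Sum>j\<le>?S. ?c j)"
      using l by (intro sum_mono2) (auto intro: coeff_gen_poly_nonneg)
    finally show "(\<Sum>x\<in>A. if x \<le> l then ?c (l - x) else 0) \<le> 2 ^ size M"
      by (simp only: sum_coeff_gen_poly)
  qed
  also have "\<dots> = 4 ^ size M"
    unfolding sum_distrib_right[symmetric] sum_coeff_gen_poly by (simp flip: power_mult_distrib)
  finally have sX: "(\<Sum>x\<in>A. X x) \<le> 4 ^ size M" .
  have "(\<Sum>x\<in>A. energy (add_mset x M) / real x) = (\<Sum>x\<in>A. 2 * (1 / real x) * energy M + 2 * (X x / real x))"
    by (rule sum.cong[OF refl]) (simp add: energy_add_mset X_def add_divide_distrib)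
  also have "\<dots> = 2 * (\<Sum>x\<in>A. 1 / real x) * energy M + 2 * (\<Sum>x\<in>A. X x / real x)"
    by (simp only: sum.distrib sum_distrib_left sum_distrib_right)
  also have "(\<Sum>x\<in>A. X x / real x) \<le> (\<Sum>x\<in>A. X x / real a)"
    using A a X0 by (intro sum_mono divide_left_mono) (auto intro!: mult_pos_pos dest: A(2))
  also have "\<dots> = (\<Sum>x\<in>A. X x) / real a" by (simp add: sum_divide_distrib)
  also have "\<dots> \<le> 4 ^ size M / real a" by (intro divide_right_mono sX) simp
  finally show ?thesis by simp
qed

text \<open>The error term reproduces itself. A further part doubles the inherited error and adds a
  fresh one of the same size, so together it grows by the factor 4 that
  \<open>4 ^ (size M + b)\<close> provides.\<close>

lemma sum_energy_msets_size:
  assumes A: "finite A" "\<And>x. x \<in> A \<Longrightarrow> a \<le> x" and a: "1 \<le> a"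
  defines "\<Lambda> \<equiv> (\<Sum>x\<in>A. 1 / real x)"
  assumes \<Lambda>: "0 < \<Lambda>"
  shows "(\<Sum>N\<in>msets_size A b. wt N * energy (M + N)) \<le>
    \<Lambda> ^ b / fact b * (2 ^ b * energy M + 4 ^ (size M + b) / (real a * \<Lambda>))"
proof (induction b)
  case 0
  show ?case using \<Lambda> a by simp
next
  case (Suc b)
  have A0: "0 \<notin> A" using A(2)[of 0] a by auto
  define t where "t = (\<Sum>N\<in>msets_size A (Suc b). wt N * energy (M + N))"
  define y where "y = 4 ^ (size M + b) / (real a * \<Lambda>)"
  have "real (Suc b) * t = (\<Sum>x\<in>A. (\<Sum>N\<in>msets_size A b. wt N * energy (M + add_mset x N)) / real x)"
    unfolding t_def by (rule sum_wt_size_recursion[OF A0 A(1)])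
  also have "\<dots> = (\<Sum>N\<in>msets_size A b. wt N * (\<Sum>x\<in>A. energy (add_mset x (M + N)) / real x))"
    unfolding sum_divide_distrib sum_distrib_left by (subst sum.swap) simp
  also have "\<dots> \<le> (\<Sum>N\<in>msets_size A b. wt N * (2 * \<Lambda> * energy (M + N) + 2 / real a * 4 ^ (size M + b)))"
  proof (intro sum_mono mult_left_mono)
    fix N assume "N \<in> msets_size A b"
    then have "size (M + N) = size M + b" by (simp add: msets_size_def)
    then show "(\<Sum>x\<in>A. energy (add_mset x (M + N)) / real x) \<le> 2 * \<Lambda> * energy (M + N) + 2 / real a * 4 ^ (size M + b)"
      using sum_energy_add_mset[OF A a, of "M + N"] by (simp add: \<Lambda>_def)
  qed simp
  also have "\<dots> = 2 * \<Lambda> * (\<Sum>N\<in>msets_size A b. wt N * energy (M + N)) +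
      (\<Sum>N\<in>msets_size A b. wt N) * (2 / real a * 4 ^ (size M + b))"
    by (simp only: distrib_left sum.distrib sum_distrib_left sum_distrib_right mult_ac)
  also have "(\<Sum>N\<in>msets_size A b. wt N) = \<Lambda> ^ b / fact b"
    unfolding \<Lambda>_def by (rule sum_wt_msets_size[OF A0 A(1)])
  also have "2 * \<Lambda> * (\<Sum>N\<in>msets_size A b. wt N * energy (M + N)) \<le>
      2 * \<Lambda> * (\<Lambda> ^ b / fact b * (2 ^ b * energy M + y))"
    unfolding y_def using \<Lambda> by (intro mult_left_mono Suc.IH) auto
  finally have "real (Suc b) * t \<le> 2 * \<Lambda> * (\<Lambda> ^ b / fact b * (2 ^ b * energy M + y)) +
      \<Lambda> ^ b / fact b * (2 / real a * 4 ^ (size M + b))" by simp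
  also have "2 / real a * 4 ^ (size M + b) = 2 * \<Lambda> * y" using \<Lambda> by (simp add: y_def)
  also have "2 * \<Lambda> * (\<Lambda> ^ b / fact b * (2 ^ b * energy M + y)) + \<Lambda> ^ b / fact b * (2 * \<Lambda> * y) =
      \<Lambda> ^ Suc b / fact b * (2 ^ Suc b * energy M + 4 * y)" by (simp add: algebra_simps)
  finally have le: "real (Suc b) * t \<le> \<Lambda> ^ Suc b / fact b * (2 ^ Suc b * energy M + 4 * y)" .
  have "t = real (Suc b) * t / real (Suc b)" by simp
  also have "\<dots> \<le> \<Lambda> ^ Suc b / fact b * (2 ^ Suc b * energy M + 4 * y) / real (Suc b)"
    by (intro divide_right_mono le) simp
  also have "\<dots> = \<Lambda> ^ Suc b / fact (Suc b) * (2 ^ Suc b * energy M + 4 * y)" by simp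
  also have "4 * y = 4 ^ (size M + Suc b) / (real a * \<Lambda>)" by (simp add: y_def)
  finally show ?case by (simp only: t_def)
qed

lemma energy_pos: "0 < energy M"
proof -
  have "coeff (gen_poly M) 0 \<ge> 1"
    by (induction M) (auto simp: coeff_gen_poly_add coeff_gen_poly_nonneg intro: add_increasing2)
  then have "0 < (coeff (gen_poly M) 0)\<^sup>2" by simp
  also have "\<dots> \<le> energy M" unfolding energy_def by (rule member_le_sum) auto
  finally show ?thesis .
qed

lemma card_subsums_energy: "4 ^ size M \<le> real (card (subsums M)) * energy M"
proof -
  let ?c = "coeff (gen_poly M)"
  have "(\<Sum>l\<in>subsums M. ?c l) = (\<Sum>l\<le>\<Sum>\<^sub># M. ?c l)"
    by (rule sum.mono_neutral_left) (auto simp: subsums_le coeff_gen_poly_eq_0)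
  then have "(2 ^ size M)\<^sup>2 = (\<Sum>l\<in>subsums M. ?c l)\<^sup>2" by (simp add: sum_coeff_gen_poly)
  also have "\<dots> \<le> real (card (subsums M)) * (\<Sum>l\<in>subsums M. (?c l)\<^sup>2)"
    using sum_squared_le_sum_of_squares[of ?c "subsums M"] by (simp add: mult.commute)
  also have "(\<Sum>l\<in>subsums M. (?c l)\<^sup>2) = energy M"
    unfolding energy_def by (rule sum.mono_neutral_left) (auto simp: subsums_le coeff_gen_poly_eq_0)
  finally show ?thesis by (simp add: power2_eq_square flip: power_mult_distrib)
qed

text \<open>Linearised Cauchy--Schwarz: for every \<open>t > 0\<close> we have \<open>1 / r \<ge> 2 / t - r / t\<^sup>2\<close>.\<close>

lemma card_subsums_ge:
  assumes "0 < t"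
  shows "4 ^ size M * (2 / t - energy M / t\<^sup>2) \<le> real (card (subsums M))"
proof -
  define r where "r = energy M"
  have r: "0 < r" by (simp add: r_def energy_pos)
  have "0 \<le> (1 - r / t)\<^sup>2 / r" using r by simp
  also have "\<dots> = 1 / r - (2 / t - r / t\<^sup>2)"
    using r assms by (simp add: field_simps power2_eq_square)
  finally have "4 ^ size M * (2 / t - r / t\<^sup>2) \<le> 4 ^ size M * (1 / r)" by (intro mult_left_mono) auto
  also have "\<dots> \<le> real (card (subsums M))"
    using card_subsums_energy[of M] r by (simp add: r_def field_simps)
  finally show ?thesis by (simp add: r_def)
qed

text \<open>Relative to \<open>2 ^ sum_list\<close>, each block adds its term of
  \<open>drift_sum\<close> to the mean energy. The factor 3 comes from the mass bound
  \<open>\<Lambda> >= 2 / 3\<close>, which gives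
  \<open>1 / (2 ^ i * \<Lambda>) <= 3 / 2 ^ Suc i\<close>.\<close>

lemma sum_energy_block_msets:
  "(\<Sum>M\<in>block_msets (\<lambda>i. {2 ^ i..<2 ^ Suc i}) us. wt M * energy M) \<le>
    lower_blocks.block_mass us * (2 ^ sum_list us * (1 + 3 * drift_sum us))"
proof (induction us)
  case Nil
  show ?case by (simp add: energy_def del: power_Suc)
next
  case (Cons b us)
  define B where "B = (\<lambda>i::nat. {2 ^ i..<2 ^ Suc i :: nat})"
  define i where "i = length us"
  define s where "s = sum_list us"
  define W where "W = lower_blocks.block_mass us"
  define \<Lambda> where "\<Lambda> = lower_blocks.harm_block i"
  have \<Lambda>2: "2 / 3 \<le> \<Lambda>" using lower_harm[of i] ln2_ge_two_thirds by (simp add: \<Lambda>_def)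
  then have \<Lambda>: "0 < \<Lambda>" by linarith
  define p where "p = \<Lambda> ^ b / fact b"
  have p: "0 \<le> p" using \<Lambda> by (simp add: p_def)
  have Weq: "W = (\<Sum>M\<in>block_msets B us. wt M)" by (simp only: W_def B_def lower_blocks.block_mass_def)
  have "(\<Sum>M\<in>block_msets B (b # us). wt M * energy M) =
      (\<Sum>M\<in>block_msets B us. wt M * (\<Sum>N\<in>msets_size (B i) b. wt N * energy (M + N)))"
    unfolding i_def B_def by (rule lower_blocks.sum_block_msets_Cons)
  also have "\<dots> \<le> (\<Sum>M\<in>block_msets B us. wt M * (p * (2 ^ b * energy M + 3 * (4 ^ (s + b) / 2 ^ Suc i))))"
  proof (intro sum_mono mult_left_mono)
    fix M assume M: "M \<in> block_msets B us"
    have sz: "size M = s" using lower_blocks.block_msets_size[folded B_def, OF M] by (simp add: s_def)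
    have \<Lambda>eq: "(\<Sum>x\<in>B i. 1 / real x) = \<Lambda>" unfolding \<Lambda>_def lower_blocks.harm_block_def B_def ..
    have "(\<Sum>N\<in>msets_size (B i) b. wt N * energy (M + N)) \<le>
        \<Lambda> ^ b / fact b * (2 ^ b * energy M + 4 ^ (size M + b) / (real (2 ^ i) * \<Lambda>))"
      using sum_energy_msets_size[where A = "B i" and a = "2 ^ i" and b = b and M = M] \<Lambda> unfolding \<Lambda>eq by (simp add: B_def)
    also have "\<dots> \<le> p * (2 ^ b * energy M + 3 * (4 ^ (s + b) / 2 ^ Suc i))"
      unfolding p_def sz
    proof (intro mult_left_mono add_left_mono)
      have "4 ^ (s + b) / (real (2 ^ i) * \<Lambda>) \<le> 4 ^ (s + b) / (real (2 ^ i) * (2 / 3))"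
        using \<Lambda>2 \<Lambda> by (intro divide_left_mono mult_left_mono) auto
      then show "4 ^ (s + b) / (real (2 ^ i) * \<Lambda>) \<le> 3 * (4 ^ (s + b) / 2 ^ Suc i)" by simp
    qed (use \<Lambda> in auto)
    finally show "(\<Sum>N\<in>msets_size (B i) b. wt N * energy (M + N)) \<le>
        p * (2 ^ b * energy M + 3 * (4 ^ (s + b) / 2 ^ Suc i))" .
  qed simp
  also have "\<dots> = p * (2 ^ b * (\<Sum>M\<in>block_msets B us. wt M * energy M) + W * (3 * (4 ^ (s + b) / 2 ^ Suc i)))"
    unfolding Weq
    by (simp only: distrib_left sum.distrib sum_distrib_left sum_distrib_right mult_ac)
  also have "\<dots> \<le> p * (2 ^ b * (W * (2 ^ s * (1 + 3 * drift_sum us))) + W * (3 * (4 ^ (s + b) / 2 ^ Suc i)))"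
    using Cons.IH p unfolding W_def s_def B_def by (intro mult_left_mono add_right_mono) auto
  also have "\<dots> = p * W * (2 ^ (s + b) * (1 + 3 * (2 ^ (s + b) / 2 ^ Suc i + drift_sum us)))"
  proof -
    have "(4::real) ^ (s + b) = 2 ^ (s + b) * 2 ^ (s + b)" by (simp flip: power_mult_distrib)
    moreover have "(2::real) ^ (s + b) = 2 ^ b * 2 ^ s" by (simp add: power_add)
    ultimately show ?thesis by (simp only:) (simp add: algebra_simps)
  qed
  also have "p * W = lower_blocks.block_mass (b # us)"
    by (simp add: p_def W_def \<Lambda>_def i_def del: power_Suc)
  also have "2 ^ (s + b) / 2 ^ Suc i + drift_sum us = drift_sum (b # us)"
    by (simp add: s_def i_def add.commute)
  also have "s + b = sum_list (b # us)" by (simp add: s_def)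
  finally show ?case by (simp only: B_def)
qed

text \<open>The linearised inequality is affine in the energy, so a bound on the mean energy
  suffices. Taking \<open>t\<close> equal to that bound leaves \<open>4 ^ r * W / t\<close>.\<close>

lemma sum_card_subsums_block_msets:
  "fact_weight (ln 2) us * 2 ^ sum_list us / (1 + 3 * drift_sum us) \<le>
    (\<Sum>M\<in>block_msets (\<lambda>i. {2 ^ i..<2 ^ Suc i}) us. wt M * real (card (subsums M)))"
proof -
  define X where "X = block_msets (\<lambda>i. {2 ^ i..<2 ^ Suc i}) us"
  define r where "r = sum_list us"
  define W where "W = lower_blocks.block_mass us"
  define t where "t = 2 ^ r * (1 + 3 * drift_sum us)"
  have d: "0 < 1 + 3 * drift_sum us" using drift_sum_nonneg[of us] by linarith
  then have t: "0 < t" by (simp add: t_def)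
  have Weq: "W = (\<Sum>M\<in>X. wt M)" by (simp only: W_def X_def lower_blocks.block_mass_def)
  have E: "(\<Sum>M\<in>X. wt M * energy M) \<le> W * t"
    unfolding X_def W_def t_def r_def by (rule sum_energy_block_msets)
  have "fact_weight (ln 2) us * 2 ^ r / (1 + 3 * drift_sum us) \<le> W * 2 ^ r / (1 + 3 * drift_sum us)"
    unfolding W_def using d by (intro divide_right_mono mult_right_mono lower_blocks.block_mass_ge lower_harm) auto
  also have "\<dots> = 4 ^ r * (W / t)"
  proof -
    have "(4::real) ^ r = 2 ^ r * 2 ^ r" by (simp flip: power_mult_distrib)
    then show ?thesis using d by (simp add: t_def)
  qed
  also have "W / t = W * (2 / t) - W * t / t\<^sup>2" using t by (simp add: power2_eq_square field_simps)
  also have "4 ^ r * \<dots> \<le> 4 ^ r * (W * (2 / t) - (\<Sum>M\<in>X. wt M * energy M) / t\<^sup>2)"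
    using E by (intro mult_left_mono diff_left_mono divide_right_mono) auto
  also have "\<dots> = (\<Sum>M\<in>X. wt M * (4 ^ r * (2 / t - energy M / t\<^sup>2)))"
    unfolding Weq by (simp add: sum_distrib_left sum_distrib_right sum_divide_distrib sum_subtractf algebra_simps)
  also have "\<dots> \<le> (\<Sum>M\<in>X. wt M * real (card (subsums M)))"
  proof (intro sum_mono mult_left_mono)
    fix M assume "M \<in> X"
    then have "size M = r" unfolding X_def r_def by (rule lower_blocks.block_msets_size)
    then show "4 ^ r * (2 / t - energy M / t\<^sup>2) \<le> real (card (subsums M))"
      using card_subsums_ge[OF t, of M] by simp
  qed simp
  finally show ?thesis by (simp add: X_def r_def)
qed

lemma walk_le_fact_weight: "walk (\<lambda>x. of_bool (x = 1)) x us \<le> fact_weight 1 us"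
  by (induction us arbitrary: x) (auto intro!: divide_right_mono divide_nonneg_nonneg fact_weight_nonneg)

text \<open>The lists used have \<open>sum_list us = J\<close>. Bounded \<open>drift_sum\<close>
  makes the weighted mean of \<open>card (subsums M)\<close> of order \<open>2 ^ J\<close>, and
  bounded \<open>damped\<close> keeps the total of all parts below \<open>C1 * 2 ^ J\<close>, hence
  below \<open>K\<close>.\<close>

theorem subsums_sum_lower:
  "\<exists>c>0. \<exists>C>0. \<forall>J K. C * 2 ^ J \<le> real K \<longrightarrow> c * (2 * (ln 2 * exp 1)) ^ J * decay (J + 1) \<le>
    smooth_sum K K"
proof -
  obtain c C1 where c: "0 < c" and C1: "0 < C1" and low: "\<And>J. c * exp (real J) * decay (J + 1) \<le>
     (\<Sum>us\<in>{us\<in>count_lists J J. damped us + drift_sum us \<le> C1}. walk (\<lambda>x. of_bool (x = 1)) 1 us)"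
    using walk_sum_typical by blast
  define B where "B = (\<lambda>i::nat. {2 ^ i..<2 ^ Suc i :: nat})"
  define f where "f = (\<lambda>M. wt M * real (card (subsums M)))"
  have "c / (1 + 3 * C1) * (2 * (ln 2 * exp 1)) ^ J * decay (J + 1) \<le> smooth_sum K K"
    if K: "C1 * 2 ^ J \<le> real K" for J K
  proof -
    define G where "G = {us\<in>count_lists J J. damped us + drift_sum us \<le> C1 \<and>
      walk (\<lambda>x. of_bool (x = 1)) 1 us \<noteq> 0}"
    have fG: "finite G" by (simp add: G_def)
    have G: "length us = J" "sum_list us = J" "damped us \<le> C1" "drift_sum us \<le> C1" if "us \<in> G" for us
    proof -
      from that have us: "length us = J" "damped us + drift_sum us \<le> C1"
        "walk (\<lambda>x. of_bool (x = 1)) 1 us \<noteq> 0" by (auto simp: G_def count_lists_def)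
      from walk_return_length[OF us(3)] us(1) show "length us = J" "sum_list us = J" by auto
      show "damped us \<le> C1" "drift_sum us \<le> C1" using us(2) damped_nonneg[of us] drift_sum_nonneg[of us] by linarith+
    qed
    have "c * exp (real J) * decay (J + 1) \<le>
        (\<Sum>us\<in>{us\<in>count_lists J J. damped us + drift_sum us \<le> C1}. walk (\<lambda>x. of_bool (x = 1)) 1 us)"
      by (rule low)
    also have "\<dots> = (\<Sum>us\<in>G. walk (\<lambda>x. of_bool (x = 1)) 1 us)"
      by (rule sum.mono_neutral_right) (auto simp: G_def)
    finally have low': "c * exp (real J) * decay (J + 1) \<le> (\<Sum>us\<in>G. walk (\<lambda>x. of_bool (x = 1)) 1 us)" .
    have "c / (1 + 3 * C1) * (2 * (ln 2 * exp 1)) ^ J * decay (J + 1) =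
        (2 * ln 2) ^ J / (1 + 3 * C1) * (c * exp (real J) * decay (J + 1))"
      by (simp add: power_mult_distrib flip: exp_of_nat_mult)
    also have "\<dots> \<le> (2 * ln 2) ^ J / (1 + 3 * C1) * (\<Sum>us\<in>G. walk (\<lambda>x. of_bool (x = 1)) 1 us)"
      using C1 low' by (intro mult_left_mono) auto
    also have "\<dots> \<le> (\<Sum>us\<in>G. \<Sum>M\<in>block_msets B us. f M)"
      unfolding sum_distrib_left
    proof (rule sum_mono)
      fix us assume us: "us \<in> G"
      have "(2 * ln 2) ^ J / (1 + 3 * C1) * walk (\<lambda>x. of_bool (x = 1)) 1 us \<le>
          (2 * ln 2) ^ J / (1 + 3 * drift_sum us) * fact_weight 1 us"
        using G[OF us] C1 add_pos_nonneg[of 1 "3 * drift_sum us"]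
        by (intro mult_mono divide_left_mono walk_le_fact_weight mult_pos_pos walk_nonneg divide_nonneg_nonneg) auto
      also have "\<dots> = fact_weight (ln 2) us * 2 ^ sum_list us / (1 + 3 * drift_sum us)"
        using G(2)[OF us] by (simp add: fact_weight_eq[of "ln 2"] power_mult_distrib)
      also have "\<dots> \<le> (\<Sum>M\<in>block_msets B us. f M)"
        unfolding B_def f_def by (rule sum_card_subsums_block_msets)
      finally show "(2 * ln 2) ^ J / (1 + 3 * C1) * walk (\<lambda>x. of_bool (x = 1)) 1 us \<le>
          (\<Sum>M\<in>block_msets B us. f M)" .
    qed
    also have "\<dots> = (\<Sum>M\<in>(\<Union>us\<in>G. block_msets B us). f M)"
      using lower_blocks.block_msets_disjoint[folded B_def] G(1) fG
      by (intro sum.UNION_disjoint[symmetric]) (auto simp: lower_blocks.finite_block_msets[folded B_def])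
    also have "\<dots> \<le> smooth_sum K K"
      unfolding smooth_sum_def f_def[symmetric]
    proof (rule sum_mono2)
      show "(\<Union>us\<in>G. block_msets B us) \<subseteq> msets_sum_le {1..K} K"
      proof safe
        fix us M assume us: "us \<in> G" and M: "M \<in> block_msets B us"
        have "1 + real (\<Sum>\<^sub># M) \<le> 2 ^ length us * damped us"
          by (rule lower_blocks.sum_mset_block_msets[folded B_def, OF _ M]) (simp add: B_def)
        also have "\<dots> \<le> 2 ^ J * C1" unfolding G(1)[OF us] by (intro mult_left_mono G(3)[OF us]) simp
        also have "\<dots> \<le> real K" using K by (simp add: mult.commute)
        finally have "real (\<Sum>\<^sub># M) \<le> real K" by linarith
        then have le: "\<Sum>\<^sub># M \<le> K" by (simp only: of_nat_le_iff)
        have "set_mset M \<subseteq> {1..K}"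
        proof
          fix x assume x: "x \<in># M"
          then obtain i where "x \<in> B i" using lower_blocks.block_msets_subset[folded B_def, OF M] by auto
          then have "2 ^ i \<le> x" by (simp add: B_def)
          then have "1 \<le> x" by (meson one_le_numeral one_le_power order_trans)
          then show "x \<in> {1..K}" using member_le_sum_mset[OF x] le by simp
        qed
        with le show "M \<in> msets_sum_le {1..K} K" by (simp add: msets_sum_le_def)
      qed
    qed (auto simp: f_def)
    finally show ?thesis .
  qed
  then show ?thesis using c C1
    by (intro exI[of _ "c / (1 + 3 * C1)"] conjI exI[of _ C1]) auto
qed

section \<open>The rate\<close>

definition rate :: "nat \<Rightarrow> real" where
  "rate k = real k powr (- delta_const) * (1 + ln (real k)) powr (-3/2)"

lemma decay_eq_powr: "1 \<le> m \<Longrightarrow> decay m = real m powr (-3/2)"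
proof -
  assume "1 \<le> m"
  then have m: "0 < real m" by simp
  have "real m powr (3/2) = real m powr (1 + 1/2)" by simp
  also have "\<dots> = real m * sqrt (real m)" unfolding powr_add using m by (simp add: powr_half_sqrt)
  finally show ?thesis using m by (simp add: decay_def powr_minus_divide)
qed

lemma two_powr_delta: "2 powr (1 - delta_const) = ln 2 * exp 1"
proof -
  have "2 powr (1 - delta_const) = exp ((1 - delta_const) * ln 2)" by (simp add: powr_def)
  also have "(1 - delta_const) * ln 2 = 1 + ln (ln 2)" by (simp add: delta_const_def field_simps)
  also have "exp \<dots> = ln 2 * exp 1" by (simp add: exp_add)
  finally show ?thesis .
qed

lemma delta_bounds: "0 < delta_const" "delta_const < 1"
proof -
  have "2 powr (1 - delta_const) < 2 powr 1" unfolding two_powr_delta using e_ln2_bounds(2) by simp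
  then show "0 < delta_const" by (subst (asm) powr_less_cancel_iff) auto
  have "2 powr 0 < 2 powr (1 - delta_const)" unfolding two_powr_delta using e_ln2_bounds(3) by simp
  then show "delta_const < 1" by (subst (asm) powr_less_cancel_iff) auto
qed

lemma rate_pos: "1 \<le> k \<Longrightarrow> 0 < rate k"
proof -
  assume "1 \<le> k"
  then have "0 \<le> ln (real k)" "0 < real k" by auto
  then have "0 < 1 + ln (real k)" by linarith
  then show ?thesis using \<open>0 < real k\<close> by (simp add: rate_def)
qed

lemma rate_le_1: "1 \<le> k \<Longrightarrow> rate k \<le> 1"
proof -
  assume k: "1 \<le> k"
  then have l: "0 \<le> ln (real k)" by simp
  have "real k powr (- delta_const) \<le> real k powr 0"
    using k delta_bounds by (intro powr_mono) auto
  moreover have "(1 + ln (real k)) powr (-3/2) \<le> (1 + ln (real k)) powr 0"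
    using l by (intro powr_mono) auto
  ultimately have "rate k \<le> real k powr 0 * (1 + ln (real k)) powr 0"
    unfolding rate_def by (intro mult_mono) auto
  then show ?thesis using k l by (simp add: add_pos_nonneg less_imp_neq[THEN not_sym])
qed

text \<open>On a dyadic interval \<open>k powr (1 - delta_const)\<close> lies between
  \<open>\<xi> ^ p\<close> and \<open>2 * \<xi> ^ p\<close>, and \<open>1 + ln k\<close> agrees with
  \<open>p + 1\<close> up to a factor 2, which costs \<open>2 powr (3/2) <= 4\<close>.\<close>

lemma rate_dyadic:
  assumes "2 ^ p \<le> k" "k < 2 ^ Suc p"
  defines "X \<equiv> (ln 2 * exp 1) ^ p * decay (p + 1)"
  shows "X \<le> 4 * (real k * rate k)" and "real k * rate k \<le> 8 * X"
proof -
  define \<xi> where "\<xi> = ln 2 * exp (1::real)"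
  define \<gamma> where "\<gamma> = 1 - delta_const"
  have \<gamma>: "0 < \<gamma>" "\<gamma> < 1" using delta_bounds by (auto simp: \<gamma>_def)
  have \<xi>: "0 < \<xi>" "\<xi> \<le> 2" using e_ln2_bounds by (auto simp: \<xi>_def)
  have "1 \<le> (2::nat) ^ p" by simp
  then have k: "1 \<le> k" using assms(1) by linarith
  have rk: "real (2 ^ p) \<le> real k" "real k \<le> real (2 ^ Suc p)"
    using assms by (simp_all only: of_nat_le_iff less_imp_le)
  have pw: "(2 ^ m :: real) powr \<gamma> = \<xi> ^ m" for m
  proof -
    have "(2 ^ m :: real) powr \<gamma> = (2 powr real m) powr \<gamma>" by (simp add: powr_realpow)
    also have "\<dots> = (2 powr \<gamma>) powr real m" by (simp add: powr_powr mult.commute)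
    also have "2 powr \<gamma> = \<xi>" by (simp add: \<gamma>_def two_powr_delta \<xi>_def)
    also have "\<xi> powr real m = \<xi> ^ m" using \<xi> by (simp add: powr_realpow)
    finally show ?thesis .
  qed
  define Y where "Y = (1 + ln (real k)) powr (-3/2)"
  have kr: "real k * rate k = real k powr \<gamma> * Y"
  proof -
    have "real k * real k powr (- delta_const) = real k powr 1 * real k powr (- delta_const)" using k by simp
    also have "\<dots> = real k powr \<gamma>" unfolding powr_add[symmetric] \<gamma>_def by simp
    finally show ?thesis by (simp add: rate_def Y_def mult.assoc[symmetric])
  qed
  have "real (2 ^ p) powr \<gamma> \<le> real k powr \<gamma>" using rk \<gamma> by (intro powr_mono2) auto
  then have a1: "\<xi> ^ p \<le> real k powr \<gamma>" using pw[of p] by simp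
  have "real k powr \<gamma> \<le> real (2 ^ Suc p) powr \<gamma>" using rk \<gamma> by (intro powr_mono2) auto
  also have "\<dots> = \<xi> ^ Suc p" using pw[of "Suc p"] by simp
  also have "\<dots> \<le> 2 * \<xi> ^ p" using \<xi> by simp
  finally have a2: "real k powr \<gamma> \<le> 2 * \<xi> ^ p" .
  have "ln (real (2 ^ p)) \<le> ln (real k)" using rk k by (subst ln_le_cancel_iff) auto
  then have "real p * ln 2 \<le> ln (real k)" by (simp add: ln_realpow)
  moreover have "real p * (1/2) \<le> real p * ln 2" using ln2_ge_two_thirds by (intro mult_left_mono) auto
  ultimately have lo: "1 / 2 * real (p + 1) \<le> 1 + ln (real k)" by simp
  have "ln (real k) \<le> ln (real (2 ^ Suc p))" using rk k by (subst ln_le_cancel_iff) auto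
  also have "\<dots> = real (Suc p) * ln 2" by (simp only: of_nat_power of_nat_numeral ln_realpow)
  also have "\<dots> \<le> real (Suc p) * 1" using ln_2_less_1 by (intro mult_left_mono) auto
  finally have hi: "1 + ln (real k) \<le> 2 * real (p + 1)" by simp
  have lk: "0 < 1 + ln (real k)" using lo by (smt (verit) of_nat_0_less_iff mult_pos_pos add_gr_0 zero_less_one half_gt_zero)
  have q: "(2::real) powr (3/2) \<le> 4"
  proof -
    have "(2::real) powr (3/2) \<le> 2 powr 2" by (intro powr_mono) auto
    then show ?thesis by simp
  qed
  have d: "decay (p + 1) = real (p + 1) powr (-3/2)" by (rule decay_eq_powr) simp
  have "Y \<le> (1 / 2 * real (p + 1)) powr (-3/2)"
    unfolding Y_def using lo by (intro powr_mono2') auto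
  also have "\<dots> = 2 powr (3/2) * decay (p + 1)"
    unfolding d by (subst powr_mult) (auto simp: powr_divide powr_minus_divide)
  also have "\<dots> \<le> 4 * decay (p + 1)" by (intro mult_right_mono q) simp
  finally have Y1: "Y \<le> 4 * decay (p + 1)" .
  have "(2 * real (p + 1)) powr (-3/2) \<le> Y"
    unfolding Y_def using hi lk by (intro powr_mono2') auto
  moreover have "(2 * real (p + 1)) powr (-3/2) = decay (p + 1) / 2 powr (3/2)"
    unfolding d by (subst powr_mult) (auto simp: powr_minus_divide)
  moreover have "decay (p + 1) / 4 \<le> decay (p + 1) / 2 powr (3/2)"
    using q by (intro divide_left_mono) auto
  ultimately have Y2: "decay (p + 1) \<le> 4 * Y" by linarith
  have Y0: "0 \<le> Y" by (simp add: Y_def)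
  have "X \<le> real k powr \<gamma> * (4 * Y)"
    unfolding X_def \<xi>_def[symmetric] using a1 Y2 by (intro mult_mono) auto
  then show "X \<le> 4 * (real k * rate k)" by (simp add: kr)
  have "real k powr \<gamma> * Y \<le> (2 * \<xi> ^ p) * (4 * decay (p + 1))"
    using a2 Y1 Y0 \<xi> by (intro mult_mono) auto
  then show "real k * rate k \<le> 8 * X" by (simp add: kr X_def \<xi>_def)
qed

lemma decay_le_mult:
  assumes "1 \<le> a" "1 \<le> b" "m \<le> a * b" "1 \<le> m"
  shows "decay a \<le> real b * real b * decay m"
proof -
  have b: "sqrt (real b) \<le> real b"
    using assms(2) real_sqrt_le_mono[of "real b" "(real b)\<^sup>2"] by (simp add: power2_eq_square)
  have "decay a = real b * sqrt (real b) * decay (a * b)"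
    using assms by (simp add: decay_def real_sqrt_mult)
  also have "\<dots> \<le> real b * real b * decay m"
    using assms b by (intro mult_mono decay_antimono mult_left_mono) auto
  finally show ?thesis .
qed

text \<open>From \<open>J + 1 <= (j + 1) * (J - j + 1)\<close> it follows that going back from
  \<open>J\<close> to \<open>j\<close> costs at most the polynomial factor
  \<open>(J - j + 1)^2\<close>, which the geometric factor absorbs. So the last scale
  dominates.\<close>

lemma sum_geometric_decay_le:
  fixes x :: real
  assumes "1 < x"
  shows "\<exists>C>0. \<forall>J. (\<Sum>j\<le>J. x ^ j * decay (j + 1)) \<le> C * (x ^ J * decay (J + 1))"
proof -
  obtain C where C: "0 < C" "\<And>J. (\<Sum>i\<le>J. real (i + 1) * real (i + 1) * (1 / x) ^ i) \<le> C"
    using sum_sq_geometric_bounded[of "1 / x"] assms by auto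
  have "(\<Sum>j\<le>J. x ^ j * decay (j + 1)) \<le> C * (x ^ J * decay (J + 1))" for J
  proof -
    have "(\<Sum>j\<le>J. x ^ j * decay (j + 1)) \<le>
        (\<Sum>j\<le>J. x ^ J * decay (J + 1) * (real (J - j + 1) * real (J - j + 1) * (1 / x) ^ (J - j)))"
    proof (rule sum_mono)
      fix j assume j: "j \<in> {..J}"
      have "x ^ J = x ^ (J - j) * x ^ j"
        using j by (simp only: power_add[symmetric] le_add_diff_inverse2 atMost_iff)
      then have e: "x ^ j = x ^ J * (1 / x) ^ (J - j)" using assms by (simp add: power_divide)
      obtain d where "J = j + d" using j le_Suc_ex by auto
      then have "J + 1 \<le> (j + 1) * (J - j + 1)" by simp
      then have "decay (j + 1) \<le> real (J - j + 1) * real (J - j + 1) * decay (J + 1)"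
        by (intro decay_le_mult) auto
      then have "x ^ j * decay (j + 1) \<le> x ^ j * (real (J - j + 1) * real (J - j + 1) * decay (J + 1))"
        using assms by (intro mult_left_mono) auto
      also have "\<dots> = x ^ J * decay (J + 1) * (real (J - j + 1) * real (J - j + 1) * (1 / x) ^ (J - j))"
        unfolding e by (simp only: mult_ac)
      finally show "x ^ j * decay (j + 1) \<le>
        x ^ J * decay (J + 1) * (real (J - j + 1) * real (J - j + 1) * (1 / x) ^ (J - j))" .
    qed
    also have "\<dots> = x ^ J * decay (J + 1) * (\<Sum>i\<le>J. real (i + 1) * real (i + 1) * (1 / x) ^ i)"
      unfolding sum_distrib_left[symmetric]
      by (intro arg_cong2[where f = "(*)"] refl sum.reindex_bij_witness[of _ "\<lambda>i. J - i" "\<lambda>i. J - i"]) auto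
    also have "\<dots> \<le> x ^ J * decay (J + 1) * C" using assms by (intro mult_left_mono C(2)) auto
    finally show ?thesis by (simp add: mult.commute)
  qed
  then show ?thesis using C(1) by blast
qed

lemma dyadic_interval:
  assumes "1 \<le> k"
  obtains p where "2 ^ p \<le> k" "k < (2::nat) ^ Suc p"
  using ex_power_ivl1[of 2 k] assms by auto

lemma inv_prop_upper_rate:
  "\<exists>C>0. \<forall>n k. 1 \<le> k \<and> 2 * k \<le> n \<longrightarrow> inv_prop n k \<le> C * rate k"
proof -
  define \<xi> where "\<xi> = ln 2 * exp (1::real)"
  have \<xi>: "1 < \<xi>" "\<xi> \<le> 2" using e_ln2_bounds by (auto simp: \<xi>_def)
  obtain C1 where C1: "0 < C1" "\<And>n J. smooth_sum n (2 ^ J) \<le> C1 * (2 * \<xi>) ^ J * decay (J + 1)"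
    using smooth_sum_upper unfolding \<xi>_def by blast
  obtain C2 where C2: "0 < C2" "\<And>J. (\<Sum>j\<le>J. \<xi> ^ j * decay (j + 1)) \<le> C2 * (\<xi> ^ J * decay (J + 1))"
    using sum_geometric_decay_le[OF \<xi>(1)] by blast
  have "inv_prop n k \<le> (96 * C1 * C2 * 8) * rate k" if k: "1 \<le> k" and n: "2 * k \<le> n" for n k
  proof -
    obtain p where p: "2 ^ p \<le> k" "k < (2::nat) ^ Suc p" using dyadic_interval[OF k] .
    have "inv_prop n k \<le> 96 / real k * (\<Sum>j\<le>Suc p. smooth_sum n (2 ^ j) / 2 ^ j)"
      using p by (intro inv_prop_upper k n) simp
    also have "\<dots> \<le> 96 / real k * (\<Sum>j\<le>Suc p. C1 * (2 * \<xi>) ^ j * decay (j + 1) / 2 ^ j)"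
      by (intro mult_left_mono sum_mono divide_right_mono C1(2)) auto
    also have "\<dots> = 96 / real k * (C1 * (\<Sum>j\<le>Suc p. \<xi> ^ j * decay (j + 1)))"
      by (simp add: power_mult_distrib sum_distrib_left mult_ac del: sum.atMost_Suc)
    also have "\<dots> \<le> 96 / real k * (C1 * (C2 * (\<xi> ^ Suc p * decay (Suc p + 1))))"
      using C1(1) by (intro mult_left_mono C2(2)) auto
    also have "\<dots> \<le> 96 / real k * (C1 * (C2 * (2 * \<xi> ^ p * decay (p + 1))))"
      using C1(1) C2(1) \<xi> by (intro mult_left_mono mult_mono decay_antimono) auto
    also have "\<dots> \<le> 96 / real k * (C1 * (C2 * (2 * (4 * (real k * rate k)))))"
      using rate_dyadic(1)[OF p] C1(1) C2(1) unfolding \<xi>_def by (intro mult_left_mono) (auto simp: mult_ac)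
    also have "\<dots> = (96 * C1 * C2 * 8) * rate k" using k by simp
    finally show ?thesis .
  qed
  then show ?thesis using C1(1) C2(1) by (intro exI[of _ "96 * C1 * C2 * 8"]) auto
qed

lemma inv_prop_lower_rate:
  "\<exists>c>0. \<forall>n k. 1 \<le> k \<and> 2 * k \<le> n \<longrightarrow> c * rate k \<le> inv_prop n k"
proof -
  define \<xi> where "\<xi> = ln 2 * exp (1::real)"
  have \<xi>: "1 < \<xi>" "\<xi> \<le> 2" using e_ln2_bounds by (auto simp: \<xi>_def)
  obtain c0 C0 where c0: "0 < c0" and C0: "0 < C0" and low: "\<And>J K. C0 * 2 ^ J \<le> real K \<Longrightarrow>
      c0 * (2 * \<xi>) ^ J * decay (J + 1) \<le> smooth_sum K K"
    using subsums_sum_lower unfolding \<xi>_def by blast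
  \<comment> \<open>\<open>s\<close> doublings absorb \<open>C0\<close> and two more absorb
    \<open>K = k div 4\<close>; this is why \<open>J = p - (s + 2)\<close> blocks are used. For
    \<open>p < s + 2\<close> only boundedly many \<open>k\<close> occur, and the empty multiset
    suffices.\<close>
  obtain s where s: "C0 \<le> 2 ^ s" using real_arch_pow[of 2 C0] by (auto intro: less_imp_le)
  define c1 where "c1 = (1::real) / (6 * 4 ^ (s + 2))"
  \<comment> \<open>Here \<open>96 = 6 * 2 * 8\<close>: the denominator \<open>6 * k^2\<close> of
    the reduction, \<open>k <= 2 * 2 ^ p\<close>, and the factor 8 of
    \<open>rate_dyadic\<close>.\<close>
  define c2 where "c2 = c0 / (96 * (2 * \<xi>) ^ (s + 2))"
  have c12: "0 < c1" "0 < c2" using c0 \<xi> by (auto simp: c1_def c2_def)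
  have "min c1 c2 * rate k \<le> inv_prop n k" if k: "1 \<le> k" and n: "2 * k \<le> n" for n k
  proof -
    obtain p where p: "2 ^ p \<le> k" "k < (2::nat) ^ Suc p" using dyadic_interval[OF k] .
    have rk: "2 ^ p \<le> real k" "real k \<le> 2 * 2 ^ p"
    proof -
      have "real (2 ^ p) \<le> real k" "real k \<le> real (2 ^ Suc p)"
        using p by (simp_all only: of_nat_le_iff less_imp_le)
      then show "2 ^ p \<le> real k" "real k \<le> 2 * 2 ^ p" by simp_all
    qed
    define K where "K = k div 4"
    define S where "S = smooth_sum K K"
    have S0: "0 \<le> S" unfolding S_def by (rule smooth_sum_nonneg)
    have "2 * real k * (2 * real k + 1) \<le> 6 * (real k * real k)"
      using k by (simp add: algebra_simps)
    then have "S / (6 * (real k * real k)) \<le> S / (2 * real k * (2 * real k + 1))"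
      using k S0 by (intro divide_left_mono) (auto intro!: mult_pos_pos)
    also have "\<dots> \<le> inv_prop n k" unfolding S_def K_def by (rule inv_prop_lower[OF k n])
    finally have low1: "S / (6 * (real k * real k)) \<le> inv_prop n k" .
    show ?thesis
    proof (cases "p < s + 2")
      case True
      have "(2::nat) ^ Suc p \<le> 2 ^ (s + 2)" using True by (intro power_increasing) auto
      then have "real k \<le> real (2 ^ (s + 2))" using p(2) by (simp only: of_nat_le_iff)
      then have "real k * real k \<le> 2 ^ (s + 2) * 2 ^ (s + 2)" by (intro mult_mono) auto
      also have "\<dots> = 4 ^ (s + 2)" by (simp only: power_mult_distrib[symmetric]) simp
      finally have kk: "real k * real k \<le> 4 ^ (s + 2)" .
      have "wt {#} * real (card (subsums {#})) \<le> S"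
        unfolding S_def smooth_sum_def by (rule member_le_sum) (auto simp: msets_sum_le_def[of _ K] simp del: finite_msets_sum_le
          intro!: finite_msets_sum_le[unfolded msets_sum_le_def])
      then have "1 \<le> S" by simp
      have "min c1 c2 * rate k \<le> c1 * 1" using c12 rate_le_1[OF k] rate_pos[OF k] by (intro mult_mono) auto
      also have "\<dots> \<le> 1 / (6 * (real k * real k))"
        unfolding c1_def using kk k by (auto intro!: divide_left_mono mult_pos_pos)
      also have "\<dots> \<le> S / (6 * (real k * real k))" using \<open>1 \<le> S\<close> by (intro divide_right_mono) auto
      finally show ?thesis using low1 by linarith
    next
      case False
      define J where "J = p - (s + 2)"
      have pJ: "p = J + (s + 2)" using False by (simp add: J_def)
      have "2 ^ (J + s) \<le> K"
      proof -
        have "2 ^ (J + s) * 4 \<le> k" using p(1) unfolding pJ by (simp add: power_add)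
        then show ?thesis unfolding K_def by (metis div_le_mono nonzero_mult_div_cancel_right zero_neq_numeral)
      qed
      then have "real (2 ^ (J + s)) \<le> real K" by (simp only: of_nat_le_iff)
      moreover have "C0 * 2 ^ J \<le> 2 ^ s * 2 ^ J" using s by (intro mult_right_mono) auto
      moreover have "2 ^ s * 2 ^ J = real (2 ^ (J + s))" by (simp add: power_add)
      ultimately have "C0 * 2 ^ J \<le> real K" by linarith
      from low[OF this] have "c0 * (2 * \<xi>) ^ J * decay (J + 1) \<le> S" by (simp add: S_def)
      moreover have "c0 * (2 * \<xi>) ^ J * decay (p + 1) \<le> c0 * (2 * \<xi>) ^ J * decay (J + 1)"
        using c0 \<xi> pJ by (intro mult_left_mono decay_antimono) auto
      ultimately have "c0 * (2 * \<xi>) ^ J * decay (p + 1) \<le> S" by linarith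
      also have "c0 * (2 * \<xi>) ^ J = 96 * c2 * (2 ^ p * \<xi> ^ p)"
        unfolding c2_def pJ power_mult_distrib[symmetric] using \<xi> by (simp add: power_add)
      finally have S1: "96 * c2 * 2 ^ p * (\<xi> ^ p * decay (p + 1)) \<le> S" by (simp only: mult_ac)
      have "min c1 c2 * rate k \<le> c2 * rate k" using rate_pos[OF k] by (intro mult_right_mono) auto
      also have "\<dots> = 6 * c2 * real k * (real k * rate k) / (6 * (real k * real k))" using k by simp
      also have "\<dots> \<le> 6 * c2 * (2 * 2 ^ p) * (8 * (\<xi> ^ p * decay (p + 1))) / (6 * (real k * real k))"
      proof (rule divide_right_mono)
        have h: "real k * rate k \<le> 8 * (\<xi> ^ p * decay (p + 1))"
          unfolding \<xi>_def by (rule rate_dyadic(2)[OF p])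
        have "6 * c2 * real k \<le> 6 * c2 * (2 * 2 ^ p)" using rk c12 by (intro mult_left_mono) auto
        then show "6 * c2 * real k * (real k * rate k) \<le> 6 * c2 * (2 * 2 ^ p) * (8 * (\<xi> ^ p * decay (p + 1)))"
          by (rule mult_mono[OF _ h]) (use c12 rate_pos[OF k] in auto)
      qed simp
      also have "\<dots> = 96 * c2 * 2 ^ p * (\<xi> ^ p * decay (p + 1)) / (6 * (real k * real k))" by simp
      also have "\<dots> \<le> S / (6 * (real k * real k))" by (intro divide_right_mono S1) auto
      finally show ?thesis using low1 by linarith
    qed
  qed
  then show ?thesis using c12 by (intro exI[of _ "min c1 c2"]) auto
qed

theorem theorem1p1:
  shows "\<exists>c C :: real. 0 < c \<and> c < C \<and>
    (\<forall>n k :: nat. 1 \<le> k \<and> 2 * k \<le> n \<longrightarrow>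
      c * real k powr (- delta_const) * (1 + ln (real k)) powr (-3/2) \<le> inv_prop n k \<and>
      inv_prop n k \<le> C * real k powr (- delta_const) * (1 + ln (real k)) powr (-3/2))"
proof -
  obtain c where c: "0 < c" "\<And>n k. 1 \<le> k \<Longrightarrow> 2 * k \<le> n \<Longrightarrow> c * rate k \<le> inv_prop n k"
    using inv_prop_lower_rate by blast
  obtain C where C: "0 < C" "\<And>n k. 1 \<le> k \<Longrightarrow> 2 * k \<le> n \<Longrightarrow> inv_prop n k \<le> C * rate k"
    using inv_prop_upper_rate by blast
  \<comment> \<open>Passing from \<open>C\<close> to \<open>C + c\<close> makes the upper constant
    strictly larger than \<open>c\<close>.\<close>
  have "inv_prop n k \<le> (C + c) * rate k" if "1 \<le> k" "2 * k \<le> n" for n k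
  proof -
    have "C * rate k \<le> (C + c) * rate k" using c(1) rate_pos[OF that(1)] by (intro mult_right_mono) auto
    then show ?thesis using C(2)[OF that] by linarith
  qed
  then show ?thesis using c C(1)
    by (intro exI[of _ c] exI[of _ "C + c"]) (auto simp: rate_def mult.assoc)
qed

end
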